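(* Let $(M,g_M)$ be a Riemannian manifold and let $(E,\pi_M,M)$ be a differentiable vector bundle over $M$ endowed with a Euclidean structure (bundle metric) $g_E$ and a metric connection $K_E\colon TE\to E$. Then the Cheeger–Gromoll metric $G_E^{CG}$, defined for every $\nu\in TE$ by $$G_E^{CG}(\nu)=g_M(D\pi_M(\nu))+\frac{g_E(K_E(\nu))+\bigl(g_E(K_E(\nu),\pi_E(\nu))\bigr)^2}{1+g_E(\pi_E(\nu))},$$ is strongly concordant with $g_E$.
   Context: For metrics, the same symbol denotes the bilinear form and the associated quadratic form: $g_E(e)=g_E(e,e)$, etc. $\pi_E\colon TE\to E$ is the tangent bundle projection of $E$ and $\pi_M\colon E\to M$ (also $TM\to M$) the bundle projection; $M$ is identified with the zero section of $E$, so that $TM\subset TE$ and $D\pi_M(\nu)\in TM\subset TE$ for $\nu\in TE$. The vertical lift at $e\in E$ of $\eta$ in the fiber $\pi_M^{-1}(\{\pi_M(e)\})$ is $\mathrm{Vert}_e(\eta)=\frac{d}{dt}(e+t\eta)|_{t=0}\in T_eE$. A connection is a map $K_E\colon TE\to E$ that is a bundle morphism from $(TE,\pi_E,E)$ to $(E,\pi_M,M)$ covering $\pi_M\colon E\to M$, and a bundle morphism from $(TE,D\pi_M,TM)$ to $(E,\pi_M,M)$ covering $\pi_M\colon TM\to M$, and satisfies $K_E\circ\mathrm{Vert}_e=\mathrm{id}$ on $\pi_M^{-1}(\{\pi_M(e)\})$ for every $e\in E$. It is metric if $Dg_E(\nu)=2g_E(K_E(\nu),\pi_E(\nu))$ for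 every $\nu\in TE$, where $Dg_E$ is the derivative of the quadratic form $g_E\colon E\to\mathbb{R}$. A Riemannian metric $G_E$ on the manifold $E$ is strongly concordant with $g_E$ if: (a) for every $\nu\in TE$, $G_E(D\pi_M(\nu))\le G_E(\nu)$; (b) there exists $\kappa>0$ such that for every $\nu\in TE$, $(\kappa^{-1}Dg_E(\nu))^2\le4\,g_E(\pi_E(\nu))\,G_E(\nu)$, and for every $e\in E$, $G_E(\mathrm{Vert}_e(e))\le\kappa^2g_E(e)$. *)

theory Defs
  imports "HOL-Analysis.Analysis"
begin

section \<open>Smooth functions on open subsets of the model space\<close>

text \<open>
  For an open set \<open>S\<close> of a finite-dimensional space, \<open>Ck_on k f S\<close> is the usual class \<open>C\<^sup>k\<close>,
  expressed by iterated directional derivatives.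
\<close>

primrec Ck_on ::
  "nat \<Rightarrow> ('a::real_normed_vector \<Rightarrow> 'b::real_normed_vector) \<Rightarrow> 'a set \<Rightarrow> bool" where
  "Ck_on 0 f S \<longleftrightarrow> continuous_on S f"
| "Ck_on (Suc k) f S \<longleftrightarrow>
     (\<forall>x\<in>S. f differentiable (at x)) \<and> (\<forall>v. Ck_on k (\<lambda>x. frechet_derivative f (at x) v) S)"

definition smooth_on ::
  "('a::real_normed_vector \<Rightarrow> 'b::real_normed_vector) \<Rightarrow> 'a set \<Rightarrow> bool" where
  "smooth_on f S \<longleftrightarrow> (\<forall>k. Ck_on k f S)"


section \<open>Smooth manifolds\<close>

text \<open>
  A chart is a pair of its domain and a map, of which only the values on the domain matter.
  The topology of a manifold is the one induced by its atlas; the atlas need not be maximal.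
\<close>

type_synonym ('x, 'b) chart = "'x set \<times> ('x \<Rightarrow> 'b)"

record ('x, 'b) mfd =
  pts :: "'x set"
  charts :: "('x, 'b) chart set"

abbreviation chart_inv :: "('x, 'b) chart \<Rightarrow> 'b \<Rightarrow> 'x" where
  "chart_inv c \<equiv> inv_into (fst c) (snd c)"

abbreviation charts_at :: "('x, 'b) mfd \<Rightarrow> 'x \<Rightarrow> ('x, 'b) chart set" where
  "charts_at X p \<equiv> {c \<in> charts X. p \<in> fst c}"

definition mfd_topology :: "('x, 'b::real_normed_vector) mfd \<Rightarrow> 'x topology" where
  "mfd_topology X =
     topology (\<lambda>W. W \<subseteq> pts X \<and> (\<forall>c\<in>charts X. open (snd c ` (fst c \<inter> W))))"

lemma openin_mfd_topology:
  assumes "\<forall>c\<in>charts X. inj_on (snd c) (fst c)"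
  shows "openin (mfd_topology X) W \<longleftrightarrow>
           W \<subseteq> pts X \<and> (\<forall>c\<in>charts X. open (snd c ` (fst c \<inter> W)))"
proof -
  have "istopology (\<lambda>W. W \<subseteq> pts X \<and> (\<forall>c\<in>charts X. open (snd c ` (fst c \<inter> W))))"
    unfolding istopology_def
  proof (intro conjI allI impI ballI)
    fix S T c
    assume S: "S \<subseteq> pts X \<and> (\<forall>c\<in>charts X. open (snd c ` (fst c \<inter> S)))"
      and T: "T \<subseteq> pts X \<and> (\<forall>c\<in>charts X. open (snd c ` (fst c \<inter> T)))"
      and c: "c \<in> charts X"
    have "snd c ` (fst c \<inter> (S \<inter> T)) = snd c ` (fst c \<inter> S) \<inter> snd c ` (fst c \<inter> T)"
      using assms c by (auto dest: inj_onD)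
    then show "open (snd c ` (fst c \<inter> (S \<inter> T)))"
      using S T c by (simp add: open_Int)
  next
    fix \<K> c
    assume K: "\<forall>S\<in>\<K>. S \<subseteq> pts X \<and> (\<forall>c\<in>charts X. open (snd c ` (fst c \<inter> S)))"
      and c: "c \<in> charts X"
    have "snd c ` (fst c \<inter> \<Union>\<K>) = (\<Union>S\<in>\<K>. snd c ` (fst c \<inter> S))" by auto
    then show "open (snd c ` (fst c \<inter> \<Union>\<K>))" using K c by auto
  qed blast+
  then show ?thesis unfolding mfd_topology_def by (simp add: topology_inverse')
qed

text \<open>
  The model space is an arbitrary finite-dimensional inner product space rather than a type of
  class \<open>euclidean_space\<close>, because the latter excludes dimension zero.
\<close>

definition smooth_manifold :: "('x, 'b::real_inner) mfd \<Rightarrow> bool" where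
  "smooth_manifold X \<longleftrightarrow>
     (\<exists>B::'b set. finite B \<and> span B = UNIV) \<and>
     (\<Union>c\<in>charts X. fst c) = pts X \<and>
     (\<forall>c\<in>charts X. inj_on (snd c) (fst c) \<and> open (snd c ` fst c)) \<and>
     (\<forall>c\<in>charts X. \<forall>d\<in>charts X.
        open (snd c ` (fst c \<inter> fst d)) \<and>
        smooth_on (snd d \<circ> chart_inv c) (snd c ` (fst c \<inter> fst d))) \<and>
     Hausdorff_space (mfd_topology X) \<and>
     (\<exists>\<B>. countable \<B> \<and> (\<forall>U\<in>\<B>. openin (mfd_topology X) U) \<and>
        (\<forall>W p. openin (mfd_topology X) W \<and> p \<in> W \<longrightarrow> (\<exists>U\<in>\<B>. p \<in> U \<and> U \<subseteq> W)))"

text \<open>The openness requirement below is the continuity of \<open>f\<close>.\<close>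

definition smooth_map ::
  "('x, 'b::real_normed_vector) mfd \<Rightarrow> ('y, 'c::real_normed_vector) mfd \<Rightarrow> ('x \<Rightarrow> 'y) \<Rightarrow> bool" where
  "smooth_map X Y f \<longleftrightarrow>
     f ` pts X \<subseteq> pts Y \<and>
     (\<forall>c\<in>charts X. \<forall>d\<in>charts Y.
        open (snd c ` (fst c \<inter> f -` fst d)) \<and>
        smooth_on (snd d \<circ> f \<circ> chart_inv c) (snd c ` (fst c \<inter> f -` fst d)))"

definition diffeomorphism ::
  "('x, 'b::real_normed_vector) mfd \<Rightarrow> ('y, 'c::real_normed_vector) mfd \<Rightarrow> ('x \<Rightarrow> 'y) \<Rightarrow> bool" where
  "diffeomorphism X Y f \<longleftrightarrow>
     bij_betw f (pts X) (pts Y) \<and> smooth_map X Y f \<and> smooth_map Y X (inv_into (pts X) f)"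

definition model_mfd :: "('b, 'b) mfd" where
  "model_mfd = \<lparr>pts = UNIV, charts = {(UNIV, \<lambda>x. x)}\<rparr>"

definition open_submfd :: "('x, 'b) mfd \<Rightarrow> 'x set \<Rightarrow> ('x, 'b) mfd" where
  "open_submfd X W = \<lparr>pts = pts X \<inter> W, charts = (\<lambda>c. (fst c \<inter> W, snd c)) ` charts X\<rparr>"

definition prod_mfd :: "('x, 'b) mfd \<Rightarrow> ('y, 'c) mfd \<Rightarrow> ('x \<times> 'y, 'b \<times> 'c) mfd" where
  "prod_mfd X Y =
     \<lparr>pts = pts X \<times> pts Y,
      charts = (\<lambda>(c, d). (fst c \<times> fst d, map_prod (snd c) (snd d))) ` (charts X \<times> charts Y)\<rparr>"


section \<open>Tangent vectors and derivatives\<close>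

text \<open>
  A tangent vector at \<open>p\<close> is represented as the pair of \<open>p\<close> and the family of its coordinate
  vectors in all the charts of the atlas around \<open>p\<close>, which are related by the derivatives of the
  transition maps. The value \<open>0\<close> at all other arguments makes the representation unique.
\<close>

type_synonym ('x, 'b) tvec = "'x \<times> (('x, 'b) chart \<Rightarrow> 'b)"

definition tangent_vectors :: "('x, 'b::real_normed_vector) mfd \<Rightarrow> ('x, 'b) tvec set" where
  "tangent_vectors X =
     {(p, \<xi>). p \<in> pts X \<and>
        (\<forall>c\<in>charts_at X p. \<forall>d\<in>charts_at X p.
           \<xi> d = frechet_derivative (snd d \<circ> chart_inv c) (at (snd c p)) (\<xi> c)) \<and>
        (\<forall>c. c \<notin> charts_at X p \<longrightarrow> \<xi> c = 0)}"

definition tangent_mfd ::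
  "('x, 'b::real_normed_vector) mfd \<Rightarrow> (('x, 'b) tvec, 'b \<times> 'b) mfd" where
  "tangent_mfd X =
     \<lparr>pts = tangent_vectors X,
      charts = (\<lambda>c. ({\<nu> \<in> tangent_vectors X. fst \<nu> \<in> fst c}, \<lambda>\<nu>. (snd c (fst \<nu>), snd \<nu> c)))
                 ` charts X\<rparr>"

text \<open>
  The derivative of a vector-valued function in the direction of a tangent vector; it does not
  depend on the chart.
\<close>

definition dfun ::
  "('x, 'b::real_normed_vector) mfd \<Rightarrow> ('x \<Rightarrow> 'v::real_normed_vector) \<Rightarrow> ('x, 'b) tvec \<Rightarrow> 'v" where
  "dfun X f \<nu> =
     (let c = (SOME c. c \<in> charts_at X (fst \<nu>))
      in frechet_derivative (f \<circ> chart_inv c) (at (snd c (fst \<nu>))) (snd \<nu> c))"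

definition tangent_map ::
  "('x, 'b::real_normed_vector) mfd \<Rightarrow> ('y, 'c::real_normed_vector) mfd \<Rightarrow> ('x \<Rightarrow> 'y) \<Rightarrow>
   ('x, 'b) tvec \<Rightarrow> ('y, 'c) tvec" where
  "tangent_map X Y f \<nu> =
     (f (fst \<nu>), \<lambda>d. if d \<in> charts_at Y (f (fst \<nu>)) then dfun X (snd d \<circ> f) \<nu> else 0)"

definition velocity ::
  "('x, 'b::real_normed_vector) mfd \<Rightarrow> (real \<Rightarrow> 'x) \<Rightarrow> ('x, 'b) tvec" where
  "velocity X \<gamma> =
     (\<gamma> 0, \<lambda>c. if c \<in> charts_at X (\<gamma> 0) then vector_derivative (snd c \<circ> \<gamma>) (at 0) else 0)"


section \<open>Vector bundles\<close>

record ('e, 'c, 'm, 'b) vbundle =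
  tot_space :: "('e, 'c) mfd"
  base_space :: "('m, 'b) mfd"
  proj :: "'e \<Rightarrow> 'm"
  vadd :: "'e \<Rightarrow> 'e \<Rightarrow> 'e"
  vsmul :: "real \<Rightarrow> 'e \<Rightarrow> 'e"
  vzero :: "'m \<Rightarrow> 'e"

definition fibre :: "('e, 'c, 'm, 'b) vbundle \<Rightarrow> 'm \<Rightarrow> 'e set" where
  "fibre V x = {e \<in> pts (tot_space V). proj V e = x}"

text \<open>
  Over each point a local trivialization restricts to a bijection of the fibre onto the model fibre
  that carries the operations of the bundle to those of the model fibre; in particular the
  operations make each fibre a vector space.
\<close>

definition local_trivialization ::
  "('e, 'b::real_normed_vector \<times> 'f::real_normed_vector, 'm, 'b) vbundle \<Rightarrow>
   'm set \<Rightarrow> ('e \<Rightarrow> 'f) \<Rightarrow> bool" where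
  "local_trivialization V U \<Phi> \<longleftrightarrow>
     openin (mfd_topology (base_space V)) U \<and>
     diffeomorphism (open_submfd (tot_space V) (proj V -` U))
       (prod_mfd (open_submfd (base_space V) U) model_mfd) (\<lambda>e. (proj V e, \<Phi> e)) \<and>
     (\<forall>x\<in>U. \<Phi> (vzero V x) = 0 \<and>
        (\<forall>e\<in>fibre V x. \<forall>e'\<in>fibre V x. \<Phi> (vadd V e e') = \<Phi> e + \<Phi> e') \<and>
        (\<forall>r. \<forall>e\<in>fibre V x. \<Phi> (vsmul V r e) = r *\<^sub>R \<Phi> e))"

definition vector_bundle ::
  "('e, 'b::real_inner \<times> 'f::real_inner, 'm, 'b) vbundle \<Rightarrow> bool" where
  "vector_bundle V \<longleftrightarrow>
     smooth_manifold (tot_space V) \<and> smooth_manifold (base_space V) \<and>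
     smooth_map (tot_space V) (base_space V) (proj V) \<and>
     (\<forall>x\<in>pts (base_space V). vzero V x \<in> fibre V x \<and>
        (\<forall>e\<in>fibre V x. \<forall>e'\<in>fibre V x. vadd V e e' \<in> fibre V x) \<and>
        (\<forall>r. \<forall>e\<in>fibre V x. vsmul V r e \<in> fibre V x)) \<and>
     (\<forall>x\<in>pts (base_space V). \<exists>U \<Phi>. x \<in> U \<and> local_trivialization V U \<Phi>)"

definition bundle_morphism ::
  "('e, 'c::real_normed_vector, 'm, 'b::real_normed_vector) vbundle \<Rightarrow>
   ('e2, 'c2::real_normed_vector, 'm2, 'b2::real_normed_vector) vbundle \<Rightarrow>
   ('e \<Rightarrow> 'e2) \<Rightarrow> ('m \<Rightarrow> 'm2) \<Rightarrow> bool" where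
  "bundle_morphism V W F f \<longleftrightarrow>
     smooth_map (tot_space V) (tot_space W) F \<and>
     smooth_map (base_space V) (base_space W) f \<and>
     (\<forall>e\<in>pts (tot_space V). proj W (F e) = f (proj V e)) \<and>
     (\<forall>x\<in>pts (base_space V).
        (\<forall>e\<in>fibre V x. \<forall>e'\<in>fibre V x. F (vadd V e e') = vadd W (F e) (F e')) \<and>
        (\<forall>r. \<forall>e\<in>fibre V x. F (vsmul V r e) = vsmul W r (F e)))"

definition tangent_bundle ::
  "('x, 'b::real_normed_vector) mfd \<Rightarrow> (('x, 'b) tvec, 'b \<times> 'b, 'x, 'b) vbundle" where
  "tangent_bundle X =
     \<lparr>tot_space = tangent_mfd X, base_space = X, proj = fst,
      vadd = (\<lambda>\<nu> \<mu>. (fst \<nu>, \<lambda>c. snd \<nu> c + snd \<mu> c)),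
      vsmul = (\<lambda>r \<nu>. (fst \<nu>, \<lambda>c. r *\<^sub>R snd \<nu> c)),
      vzero = (\<lambda>p. (p, \<lambda>c. 0))\<rparr>"

text \<open>
  The second vector bundle structure on the tangent manifold of the total space \<open>E\<close>, over the
  tangent manifold of the base: its operations are the derivatives of the operations of \<open>E\<close>. The
  addition is the derivative of the fibrewise addition \<open>E \<times>\<^sub>M E \<rightarrow> E\<close>, evaluated along pairs of
  curves, so that the submanifold \<open>E \<times>\<^sub>M E\<close> of \<open>E \<times> E\<close> need not be constructed.
\<close>

definition prolonged_add ::
  "('e, 'c::real_normed_vector, 'm, 'b) vbundle \<Rightarrow>
   ('e, 'c) tvec \<Rightarrow> ('e, 'c) tvec \<Rightarrow> ('e, 'c) tvec" where
  "prolonged_add V \<nu> \<mu> =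
     (THE \<omega>. \<exists>\<gamma> \<delta>. smooth_map model_mfd (tot_space V) \<gamma> \<and> smooth_map model_mfd (tot_space V) \<delta> \<and>
        (\<forall>t. proj V (\<gamma> t) = proj V (\<delta> t)) \<and>
        velocity (tot_space V) \<gamma> = \<nu> \<and> velocity (tot_space V) \<delta> = \<mu> \<and>
        \<omega> = velocity (tot_space V) (\<lambda>t. vadd V (\<gamma> t) (\<delta> t)))"

definition prolonged_bundle ::
  "('e, 'c::real_normed_vector, 'm, 'b::real_normed_vector) vbundle \<Rightarrow>
   (('e, 'c) tvec, 'c \<times> 'c, ('m, 'b) tvec, 'b \<times> 'b) vbundle" where
  "prolonged_bundle V =
     \<lparr>tot_space = tangent_mfd (tot_space V), base_space = tangent_mfd (base_space V),
      proj = tangent_map (tot_space V) (base_space V) (proj V),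
      vadd = prolonged_add V,
      vsmul = (\<lambda>r. tangent_map (tot_space V) (tot_space V) (vsmul V r)),
      vzero = tangent_map (base_space V) (tot_space V) (vzero V)\<rparr>"


section \<open>Metrics and connections\<close>

definition local_section ::
  "('e, 'c::real_normed_vector, 'm, 'b::real_normed_vector) vbundle \<Rightarrow>
   'm set \<Rightarrow> ('m \<Rightarrow> 'e) \<Rightarrow> bool" where
  "local_section V U s \<longleftrightarrow>
     smooth_map (open_submfd (base_space V) U) (tot_space V) s \<and>
     (\<forall>x \<in> pts (base_space V) \<inter> U. proj V (s x) = x)"

definition bundle_metric ::
  "('e, 'c::real_normed_vector, 'm, 'b::real_normed_vector) vbundle \<Rightarrow>
   ('e \<Rightarrow> 'e \<Rightarrow> real) \<Rightarrow> bool" where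
  "bundle_metric V g \<longleftrightarrow>
     (\<forall>x\<in>pts (base_space V).
        (\<forall>e\<in>fibre V x. \<forall>e'\<in>fibre V x. g e e' = g e' e) \<and>
        (\<forall>e\<in>fibre V x. \<forall>e'\<in>fibre V x. \<forall>e''\<in>fibre V x. g (vadd V e e') e'' = g e e'' + g e' e'') \<and>
        (\<forall>r. \<forall>e\<in>fibre V x. \<forall>e'\<in>fibre V x. g (vsmul V r e) e' = r * g e e') \<and>
        (\<forall>e\<in>fibre V x. e \<noteq> vzero V x \<longrightarrow> g e e > 0)) \<and>
     (\<forall>U s t. openin (mfd_topology (base_space V)) U \<and> local_section V U s \<and> local_section V U t \<longrightarrow>
        smooth_map (open_submfd (base_space V) U) model_mfd (\<lambda>x. g (s x) (t x)))"

definition riemannian_metric ::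
  "('x, 'b::real_normed_vector) mfd \<Rightarrow> (('x, 'b) tvec \<Rightarrow> ('x, 'b) tvec \<Rightarrow> real) \<Rightarrow> bool" where
  "riemannian_metric X g \<longleftrightarrow> bundle_metric (tangent_bundle X) g"

definition riemannian_manifold ::
  "('x, 'b::real_inner) mfd \<Rightarrow> (('x, 'b) tvec \<Rightarrow> ('x, 'b) tvec \<Rightarrow> real) \<Rightarrow> bool" where
  "riemannian_manifold X g \<longleftrightarrow> smooth_manifold X \<and> riemannian_metric X g"

definition vertical_lift ::
  "('e, 'c::real_normed_vector, 'm, 'b) vbundle \<Rightarrow> 'e \<Rightarrow> 'e \<Rightarrow> ('e, 'c) tvec" where
  "vertical_lift V e \<eta> = velocity (tot_space V) (\<lambda>t. vadd V e (vsmul V t \<eta>))"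

definition connection ::
  "('e, 'c::real_normed_vector, 'm, 'b::real_normed_vector) vbundle \<Rightarrow>
   (('e, 'c) tvec \<Rightarrow> 'e) \<Rightarrow> bool" where
  "connection V K \<longleftrightarrow>
     bundle_morphism (tangent_bundle (tot_space V)) V K (proj V) \<and>
     bundle_morphism (prolonged_bundle V) V K fst \<and>
     (\<forall>e\<in>pts (tot_space V). \<forall>\<eta>\<in>fibre V (proj V e). K (vertical_lift V e \<eta>) = \<eta>)"

definition metric_connection ::
  "('e, 'c::real_normed_vector, 'm, 'b::real_normed_vector) vbundle \<Rightarrow>
   ('e \<Rightarrow> 'e \<Rightarrow> real) \<Rightarrow> (('e, 'c) tvec \<Rightarrow> 'e) \<Rightarrow> bool" where
  "metric_connection V g K \<longleftrightarrow>
     connection V K \<and>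
     (\<forall>\<nu>\<in>tangent_vectors (tot_space V). dfun (tot_space V) (\<lambda>e. g e e) \<nu> = 2 * g (K \<nu>) (fst \<nu>))"


section \<open>Strong concordance and the Cheeger--Gromoll metric\<close>

text \<open>
  The derivative of the projection of a vector of \<open>TE\<close> is regarded as an element of \<open>TE\<close> through the
  derivative of the zero section.
\<close>

definition strongly_concordant ::
  "('e, 'c::real_normed_vector, 'm, 'b::real_normed_vector) vbundle \<Rightarrow>
   ('e \<Rightarrow> 'e \<Rightarrow> real) \<Rightarrow> (('e, 'c) tvec \<Rightarrow> ('e, 'c) tvec \<Rightarrow> real) \<Rightarrow> bool" where
  "strongly_concordant V g G \<longleftrightarrow>
     (let E = tot_space V; M = base_space V;
          hor = (\<lambda>\<nu>. tangent_map M E (vzero V) (tangent_map E M (proj V) \<nu>))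
      in riemannian_metric E G \<and>
         (\<forall>\<nu>\<in>tangent_vectors E. G (hor \<nu>) (hor \<nu>) \<le> G \<nu> \<nu>) \<and>
         (\<exists>\<kappa>>0.
            (\<forall>\<nu>\<in>tangent_vectors E.
               (inverse \<kappa> * dfun E (\<lambda>e. g e e) \<nu>)\<^sup>2 \<le> 4 * g (fst \<nu>) (fst \<nu>) * G \<nu> \<nu>) \<and>
            (\<forall>e\<in>pts E. G (vertical_lift V e e) (vertical_lift V e e) \<le> \<kappa>\<^sup>2 * g e e)))"

text \<open>
  The Cheeger--Gromoll metric is the symmetric bilinear form whose quadratic form is given by the
  lemma below; both arguments are meant to be tangent at the same point.
\<close>

definition cheeger_gromoll ::
  "('e, 'c::real_normed_vector, 'm, 'b::real_normed_vector) vbundle \<Rightarrow>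
   (('m, 'b) tvec \<Rightarrow> ('m, 'b) tvec \<Rightarrow> real) \<Rightarrow> ('e \<Rightarrow> 'e \<Rightarrow> real) \<Rightarrow> (('e, 'c) tvec \<Rightarrow> 'e) \<Rightarrow>
   ('e, 'c) tvec \<Rightarrow> ('e, 'c) tvec \<Rightarrow> real" where
  "cheeger_gromoll V gM gE K \<nu> \<mu> =
     (let D = tangent_map (tot_space V) (base_space V) (proj V)
      in gM (D \<nu>) (D \<mu>) +
         (gE (K \<nu>) (K \<mu>) + gE (K \<nu>) (fst \<nu>) * gE (K \<mu>) (fst \<mu>)) / (1 + gE (fst \<nu>) (fst \<nu>)))"

lemma cheeger_gromoll_quadratic:
  "cheeger_gromoll V gM gE K \<nu> \<nu> =
     (let D = tangent_map (tot_space V) (base_space V) (proj V)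
      in gM (D \<nu>) (D \<nu>) + (gE (K \<nu>) (K \<nu>) + (gE (K \<nu>) (fst \<nu>))\<^sup>2) / (1 + gE (fst \<nu>) (fst \<nu>)))"
  by (simp add: cheeger_gromoll_def Let_def power2_eq_square)

end

theory Submission
  imports Defs
begin

text \<open>
  Write \<open>G\<close> for the Cheeger--Gromoll metric, \<open>e\<close> for the base point of \<open>\<nu>\<close> and
  \<open>i = g\<^sub>E(K \<nu>, e)\<close>. The projection of \<open>\<nu>\<close> to the tangent space of the zero section
  has the same image under \<open>D\<pi>\<close> as \<open>\<nu>\<close> and is annihilated by \<open>K\<close>, so passing to it
  only drops the nonnegative second summand of \<open>G\<close>: this is (a). Condition (b) holds with \<open>\<kappa> = 1\<close>.
  As \<open>K\<close> is metric, the first inequality says \<open>i\<^sup>2 \<le> g\<^sub>E(e) G(\<nu>)\<close>, which follows from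
  \<open>i\<^sup>2 (1 + g\<^sub>E(e)) \<le> g\<^sub>E(e) (g\<^sub>E(K \<nu>) + i\<^sup>2)\<close>, that is, from the Cauchy--Schwarz inequality;
  the second is an equality, because the vertical lift of \<open>e\<close> is annihilated by \<open>D\<pi>\<close> and mapped
  to \<open>e\<close> by \<open>K\<close>.

  \<open>G\<close> is positive definite because a vector annihilated by \<open>D\<pi>\<close> is the vertical lift of its
  image under \<open>K\<close>. It is smooth because, in a local frame, both metrics are given by smooth
  coefficient functions on the base and the coordinates of \<open>D\<pi>(\<nu>)\<close> and \<open>K \<nu>\<close> depend smoothly
  on \<open>\<nu>\<close>.
\<close>

section \<open>Calculus of smooth functions\<close>

text \<open>The constant 1 comes from the denominator: if \<open>a\<close> is the square norm of
  \<open>e\<close>, the second summand at the vertical lift of \<open>e\<close> is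
  \<open>(a + a\<^sup>2) / (1 + a) = a\<close>. That \<open>K\<close> annihilates the projected
  vector cannot be had from linearity over \<open>E\<close>: this vector is tangent at a zero vector
  and is nonzero as soon as \<open>D\<pi>(\<nu>)\<close> is. It comes from the second morphism
  property of a connection, linearity over \<open>TM\<close>. Smoothness takes most of the work.
  \<open>G\<close> is tested along vector fields \<open>s\<close> on \<open>E\<close>, and
  \<open>D\<pi> \<circ> s\<close> and \<open>K \<circ> s\<close> are sections along the projection
  only, whereas the given metrics are smooth along sections over \<open>M\<close>; hence the passage
  to frames. These maps also factor through \<open>TE\<close>. Smoothness is therefore a pointwise
  notion whose composition rule asks of the middle space only a finite-dimensional model and
  injective charts that cover it, and for \<open>TE\<close> just this is established.\<close>

definition findim :: "'a::real_inner itself \<Rightarrow> bool" where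
  "findim _ \<longleftrightarrow> (\<exists>B::'a set. finite B \<and> span B = UNIV)"

text \<open>Gram-Schmidt on a finite spanning set, with 0 dropped and the rest normalised. Later
  arguments work with the expansion formula alone, which in dimension zero holds with an empty
  \<open>B\<close>.\<close>

lemma findim_basis:
  assumes "findim TYPE('a::real_inner)"
  obtains B :: "'a::real_inner set" where "finite B" "\<And>w. (\<Sum>b\<in>B. (w \<bullet> b) *\<^sub>R b) = w"
proof -
  obtain B0 :: "'a set" where B0: "finite B0" "span B0 = UNIV"
    using assms unfolding findim_def by blast
  obtain C :: "'a set" where C: "finite C" "span C = UNIV" "pairwise orthogonal C"
    using basis_orthogonal[OF B0(1)] B0(2) by metis
  define D where "D = C - {0}"
  have D: "finite D" "span D = UNIV" "pairwise orthogonal D" "0 \<notin> D"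
    using C by (auto simp: D_def span_delete_0 intro: pairwise_subset)
  define B where "B = (\<lambda>x. x /\<^sub>R norm x) ` D"
  \<comment> \<open>Distinct members of \<open>D\<close> are orthogonal and so cannot share a unit
    vector. Injectivity lets the sum over \<open>B\<close> be reindexed by \<open>D\<close>.\<close>
  have inj: "inj_on (\<lambda>x. x /\<^sub>R norm x) D"
  proof (rule inj_onI)
    fix x y assume xy: "x \<in> D" "y \<in> D" "x /\<^sub>R norm x = y /\<^sub>R norm y"
    show "x = y"
    proof (rule ccontr)
      assume "x \<noteq> y"
      then have "x \<bullet> y = 0" using D(3) xy unfolding pairwise_def orthogonal_def by blast
      moreover have "(x /\<^sub>R norm x) \<bullet> (y /\<^sub>R norm y) = 1"
        unfolding xy(3)[symmetric] using xy(1) D(4)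
        by (cases "x = 0") (auto simp: dot_square_norm power2_eq_square)
      ultimately show False by simp
    qed
  qed
  have "(\<Sum>b\<in>B. (w \<bullet> b) *\<^sub>R b) = w" for w
  proof -
    \<comment> \<open>The orthogonal projection of \<open>w\<close>: the difference
      \<open>w - u\<close> is orthogonal to \<open>D\<close>, hence to the whole space, in
      particular to itself.\<close>
    define u where "u = (\<Sum>d\<in>D. (w \<bullet> (d /\<^sub>R norm d)) *\<^sub>R (d /\<^sub>R norm d))"
    have "orthogonal (w - u) d" if "d \<in> D" for d
    proof -
      have "u \<bullet> d = (\<Sum>x\<in>D. ((w \<bullet> (x /\<^sub>R norm x)) *\<^sub>R (x /\<^sub>R norm x)) \<bullet> d)"
        by (simp add: u_def inner_sum_left)
      also have "\<dots> = (\<Sum>x\<in>D. if x = d then w \<bullet> d else 0)"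
      proof (rule sum.cong)
        fix x assume "x \<in> D"
        show "((w \<bullet> (x /\<^sub>R norm x)) *\<^sub>R (x /\<^sub>R norm x)) \<bullet> d = (if x = d then w \<bullet> d else 0)"
        proof (cases "x = d")
          case True
          moreover have "d \<noteq> 0" using that D(4) by auto
          then have "inverse (norm d) * (inverse (norm d) * (norm d * norm d)) = 1"
            by (simp add: field_simps)
          ultimately show ?thesis by (simp add: dot_square_norm power2_eq_square)
        next
          case False
          then have "x \<bullet> d = 0" using D(3) \<open>x \<in> D\<close> that unfolding pairwise_def orthogonal_def by blast
          then show ?thesis using False by simp
        qed
      qed simp
      also have "\<dots> = w \<bullet> d" using D(1) that by simp
      finally show ?thesis by (simp add: orthogonal_def inner_diff_left)
    qed
    then have "orthogonal (w - u) y" if "y \<in> span D" for y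
      using that orthogonal_to_span by metis
    then have "orthogonal (w - u) (w - u)" using D(2) by auto
    then have "w = u" by (simp add: orthogonal_def)
    then show ?thesis unfolding B_def by (simp add: sum.reindex[OF inj] u_def)
  qed
  with D(1) show thesis using that[of B] by (simp add: B_def)
qed

lemma findim_prod:
  assumes "findim TYPE('a::real_inner)" "findim TYPE('b::real_inner)"
  shows "findim TYPE('a \<times> 'b)"
proof -
  obtain A :: "'a set" where A: "finite A" "span A = UNIV" using assms unfolding findim_def by blast
  obtain B :: "'b set" where B: "finite B" "span B = UNIV" using assms unfolding findim_def by blast
  let ?C = "(\<lambda>a. (a, 0)) ` A \<union> (\<lambda>b. (0, b)) ` B"
  have l: "linear (\<lambda>a. (a, 0::'b))" "linear (\<lambda>b. (0::'a, b))" by (auto intro!: linearI)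
  have "(a, b) \<in> span ?C" for a b
  proof -
    have "(a, 0) \<in> span ?C"
      using A(2) linear_span_image[OF l(1), of A] span_mono[of "(\<lambda>a. (a, 0)) ` A" ?C] by blast
    moreover have "(0, b) \<in> span ?C"
      using B(2) linear_span_image[OF l(2), of B] span_mono[of "(\<lambda>b. (0, b)) ` B" ?C] by blast
    ultimately show ?thesis using span_add[of "(a, 0)" ?C "(0, b)"] by simp
  qed
  then have "span ?C = UNIV" by auto
  moreover have "finite ?C" using A(1) B(1) by simp
  ultimately show ?thesis unfolding findim_def by (intro exI[of _ ?C] conjI)
qed

lemma findim_snd:
  assumes "findim TYPE('a::real_inner \<times> 'b::real_inner)"
  shows "findim TYPE('b)"
proof -
  obtain A :: "('a \<times> 'b) set" where A: "finite A" "span A = UNIV" using assms unfolding findim_def by blast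
  have "span (snd ` A) = UNIV"
    using linear_span_image[of "snd :: 'a \<times> 'b \<Rightarrow> 'b" A] A(2) by (simp add: linear_snd)
  then show ?thesis using A(1) unfolding findim_def by blast
qed

lemma findim_real: "findim TYPE(real)"
proof -
  have "span {1::real} = UNIV" by (auto simp: span_singleton)
  then show ?thesis unfolding findim_def by blast
qed

lemma bilinear_expand:
  assumes B: "finite B" "\<And>w. (\<Sum>b\<in>B. (w \<bullet> b) *\<^sub>R b) = w"
    and \<beta>: "bilinear \<beta>"
  shows "\<beta> v w = (\<Sum>b\<in>B. \<Sum>c\<in>B. (v \<bullet> b) *\<^sub>R (w \<bullet> c) *\<^sub>R \<beta> b c)"
proof -
  have "\<beta> v w = \<beta> (\<Sum>b\<in>B. (v \<bullet> b) *\<^sub>R b) (\<Sum>b\<in>B. (w \<bullet> b) *\<^sub>R b)" by (simp add: B)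
  also have "\<dots> = (\<Sum>b\<in>B. \<Sum>c\<in>B. (v \<bullet> b) *\<^sub>R (w \<bullet> c) *\<^sub>R \<beta> b c)"
    using \<beta> by (simp add: bilinear_sum sum.cartesian_product bilinear_lmul bilinear_rmul scaleR_left_commute)
  finally show ?thesis .
qed

section \<open>Differentiation rules for the classes \<open>C^k\<close>\<close>

lemma frechet_derivativeI: "(f has_derivative f') (at x) \<Longrightarrow> frechet_derivative f (at x) = f'"
  by (rule frechet_derivative_at[symmetric])

text \<open>\<open>frechet_derivative\<close> chooses among all derivatives at \<open>x\<close>.
  Since \<open>f\<close> and \<open>g\<close> have the same ones, the choices agree even where
  neither function is differentiable.\<close>

lemma frechet_derivative_cong_open:
  assumes "open S" "x \<in> S" "\<And>y. y \<in> S \<Longrightarrow> f y = g y"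
  shows "frechet_derivative f (at x) = frechet_derivative g (at x)"
    and "f differentiable (at x) \<longleftrightarrow> g differentiable (at x)"
proof -
  have "(f has_derivative f') (at x) \<longleftrightarrow> (g has_derivative f') (at x)" for f'
    using has_derivative_transform_within_open[OF _ assms(1,2)] assms(3) by metis
  then show "frechet_derivative f (at x) = frechet_derivative g (at x)"
    "f differentiable (at x) \<longleftrightarrow> g differentiable (at x)"
    by (simp_all add: frechet_derivative_def differentiable_def)
qed

text \<open>Allows a derivative to be replaced by the formula that computes it on \<open>S\<close>
  alone, which is how the rules below pass from \<open>k\<close> to \<open>Suc k\<close>.\<close>

lemma Ck_on_cong:
  assumes "open S" "\<And>y. y \<in> S \<Longrightarrow> f y = g y"
  shows "Ck_on k f S \<longleftrightarrow> Ck_on k g S"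
  using assms(2)
proof (induction k arbitrary: f g)
  case 0
  then show ?case by simp
next
  case (Suc k)
  have "Ck_on k (\<lambda>x. frechet_derivative f (at x) v) S = Ck_on k (\<lambda>x. frechet_derivative g (at x) v) S" for v
    by (rule Suc.IH) (simp add: frechet_derivative_cong_open[OF assms(1) _ Suc.prems])
  then show ?case by (simp add: frechet_derivative_cong_open[OF assms(1) _ Suc.prems])
qed

text \<open>The derivatives in \<open>Ck_on\<close> are taken in the full space, so \<open>T\<close>
  may be any subset.\<close>

lemma Ck_on_subset: "Ck_on k f S \<Longrightarrow> T \<subseteq> S \<Longrightarrow> Ck_on k f T"
  by (induction k arbitrary: f) (auto intro: continuous_on_subset)

lemma Ck_on_local:
  assumes "\<And>x. x \<in> S \<Longrightarrow> \<exists>T. open T \<and> x \<in> T \<and> Ck_on k f T"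
  shows "Ck_on k f S"
  using assms
proof (induction k arbitrary: f)
  case 0
  then show ?case
    by (auto intro!: continuous_at_imp_continuous_on simp: continuous_on_eq_continuous_at) 
      (metis continuous_on_eq_continuous_at)
next
  case (Suc k)
  show ?case
  proof (simp, intro conjI ballI allI)
    show "f differentiable at x" if "x \<in> S" for x using Suc.prems[OF that] by auto
    show "Ck_on k (\<lambda>x. frechet_derivative f (at x) v) S" for v
    proof (rule Suc.IH)
      fix x assume "x \<in> S"
      then obtain T where "open T" "x \<in> T" "Ck_on (Suc k) f T" using Suc.prems by blast
      then show "\<exists>T. open T \<and> x \<in> T \<and> Ck_on k (\<lambda>x. frechet_derivative f (at x) v) T" by auto
    qed
  qed
qed

lemma Ck_on_continuous: "Ck_on k f S \<Longrightarrow> continuous_on S f"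
proof (cases k)
  case (Suc n)
  then show "Ck_on k f S \<Longrightarrow> continuous_on S f"
    by (simp add: continuous_at_imp_continuous_on differentiable_imp_continuous_within)
qed auto

lemma Ck_on_SucD: "Ck_on (Suc k) f S \<Longrightarrow> Ck_on k f S"
proof (induction k arbitrary: f)
  case 0
  then show ?case using Ck_on_continuous[of "Suc 0" f S] by simp
next
  case (Suc k)
  then show ?case by (metis Ck_on.simps(2))
qed

lemma Ck_on_const: "Ck_on k (\<lambda>x. c) S"
  by (induction k arbitrary: c) (auto simp: frechet_derivative_const)

lemma Ck_on_add:
  assumes "open S" "Ck_on k f S" "Ck_on k g S"
  shows "Ck_on k (\<lambda>x. f x + g x) S"
  using assms(2,3)
proof (induction k arbitrary: f g)
  case (Suc k)
  have d: "((\<lambda>x. f x + g x) has_derivative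
      (\<lambda>v. frechet_derivative f (at x) v + frechet_derivative g (at x) v)) (at x)" if "x \<in> S" for x
    using Suc.prems that by (auto intro!: has_derivative_add simp: frechet_derivative_works[symmetric])
  have "Ck_on k (\<lambda>x. frechet_derivative (\<lambda>x. f x + g x) (at x) v) S" for v
    by (subst Ck_on_cong[OF assms(1), where g = "\<lambda>x. frechet_derivative f (at x) v + frechet_derivative g (at x) v"])
      (use Suc in \<open>auto simp: frechet_derivativeI[OF d]\<close>)
  then show ?case using Suc by auto
qed (auto intro: continuous_on_add)

lemma Ck_on_sum:
  assumes "open S" "\<And>i. i \<in> I \<Longrightarrow> Ck_on k (f i) S"
  shows "Ck_on k (\<lambda>x. \<Sum>i\<in>I. f i x) S"
  using assms(2)
proof (induction I rule: infinite_finite_induct)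
  case (insert i I)
  then show ?case using Ck_on_add[OF assms(1), of k "f i"] by simp
qed (simp_all add: Ck_on_const)

lemma Ck_on_linear:
  assumes "open S" "bounded_linear L" "Ck_on k f S"
  shows "Ck_on k (\<lambda>x. L (f x)) S"
  using assms(3)
proof (induction k arbitrary: f)
  case 0
  then show ?case using bounded_linear.continuous_on[OF assms(2)] by auto
next
  case (Suc k)
  have d: "((\<lambda>x. L (f x)) has_derivative (\<lambda>v. L (frechet_derivative f (at x) v))) (at x)" if "x \<in> S" for x
    using Suc.prems that
    by (auto intro!: bounded_linear.has_derivative[OF assms(2)] simp: frechet_derivative_works[symmetric])
  have "Ck_on k (\<lambda>x. frechet_derivative (\<lambda>x. L (f x)) (at x) v) S" for v
    by (subst Ck_on_cong[OF assms(1), where g = "\<lambda>x. L (frechet_derivative f (at x) v)"])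
      (use Suc in \<open>auto simp: frechet_derivativeI[OF d]\<close>)
  then show ?case using d by (auto simp: differentiable_def)
qed

lemma Ck_on_id: "open S \<Longrightarrow> Ck_on k (\<lambda>x. x) S"
proof (cases k)
  case (Suc n)
  then show ?thesis by (auto intro: Ck_on_const simp: frechet_derivative_ident)
qed auto

lemma Ck_on_bilinear:
  assumes "open S" "bounded_bilinear P" "Ck_on k f S" "Ck_on k g S"
  shows "Ck_on k (\<lambda>x. P (f x) (g x)) S"
  using assms(3,4)
proof (induction k arbitrary: f g)
  case 0
  then show ?case using bounded_bilinear.continuous_on[OF assms(2)] by auto
next
  case (Suc k)
  have d: "((\<lambda>x. P (f x) (g x)) has_derivative
      (\<lambda>v. P (f x) (frechet_derivative g (at x) v) + P (frechet_derivative f (at x) v) (g x))) (at x)" if "x \<in> S" for x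
    using Suc.prems that
    by (auto intro!: bounded_bilinear.FDERIV[OF assms(2)] simp: frechet_derivative_works[symmetric])
  \<comment> \<open>The product rule pairs each derivative with an undifferentiated factor, which
    the induction hypothesis must see at order \<open>k\<close>.\<close>
  have fg: "Ck_on k f S" "Ck_on k g S" using Suc.prems Ck_on_SucD by blast+
  have "Ck_on k (\<lambda>x. frechet_derivative (\<lambda>x. P (f x) (g x)) (at x) v) S" for v
    by (subst Ck_on_cong[OF assms(1), where g = "\<lambda>x. P (f x) (frechet_derivative g (at x) v) + P (frechet_derivative f (at x) v) (g x)"])
      (use Suc.prems fg in \<open>auto simp: frechet_derivativeI[OF d] intro!: Ck_on_add assms(1) Suc.IH\<close>)
  then show ?case using d by (auto simp: differentiable_def)
qed

text \<open>The pair is the sum of the images of \<open>f\<close> and \<open>g\<close> under the two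
  linear inclusions into the product.\<close>

lemma Ck_on_Pair:
  assumes "open S" "Ck_on k f S" "Ck_on k g S"
  shows "Ck_on k (\<lambda>x. (f x, g x)) S"
proof -
  have "bounded_linear (\<lambda>v. (v, 0))" "bounded_linear (\<lambda>v. (0, v))"
    by (auto intro!: bounded_linear_Pair bounded_linear_ident bounded_linear_zero)
  from Ck_on_add[OF assms(1) Ck_on_linear[OF assms(1) this(1) assms(2)] Ck_on_linear[OF assms(1) this(2) assms(3)]]
  show ?thesis by simp
qed

text \<open>The derivative of \<open>1/f\<close> is a product of \<open>1/f\<close>, the derivative
  of \<open>f\<close> and \<open>1/f\<close> again. The induction hypothesis for the same
  \<open>f\<close> covers the outer factors, so each step gains one order.\<close>

lemma Ck_on_inverse:
  fixes f :: "'a::real_normed_vector \<Rightarrow> real"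
  assumes "open S" "Ck_on k f S" "\<And>x. x \<in> S \<Longrightarrow> f x \<noteq> 0"
  shows "Ck_on k (\<lambda>x. inverse (f x)) S"
  using assms(2)
proof (induction k)
  case 0
  then show ?case using assms by (auto intro: continuous_on_inverse)
next
  case (Suc k)
  have d: "((\<lambda>x. inverse (f x)) has_derivative
      (\<lambda>v. - (inverse (f x) * frechet_derivative f (at x) v * inverse (f x)))) (at x)" if "x \<in> S" for x
    using Suc.prems that assms(3)
    by (auto intro!: has_derivative_inverse simp: frechet_derivative_works[symmetric])
  have i: "Ck_on k (\<lambda>x. inverse (f x)) S" using Suc Ck_on_SucD by blast
  have c: "Ck_on k (\<lambda>x. - (inverse (f x) * frechet_derivative f (at x) v * inverse (f x))) S" for v
  proof -
    have f: "Ck_on k (\<lambda>x. frechet_derivative f (at x) v) S" using Suc.prems by simp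
    show ?thesis
      by (rule Ck_on_linear[OF assms(1) bounded_linear_minus[OF bounded_linear_ident]
          Ck_on_bilinear[OF assms(1) bounded_bilinear_mult
            Ck_on_bilinear[OF assms(1) bounded_bilinear_mult i f] i]])
  qed
  have "Ck_on k (\<lambda>x. frechet_derivative (\<lambda>x. inverse (f x)) (at x) v) S" for v
    by (subst Ck_on_cong[OF assms(1), where g = "\<lambda>x. - (inverse (f x) * frechet_derivative f (at x) v * inverse (f x))"])
      (simp_all add: frechet_derivativeI[OF d] c)
  then show ?case using d by (auto simp: differentiable_def)
qed

lemma frechet_expand:
  assumes "f differentiable (at x)" "(\<Sum>b\<in>B. (w \<bullet> b) *\<^sub>R b) = w"
  shows "frechet_derivative f (at x) w = (\<Sum>b\<in>B. (w \<bullet> b) *\<^sub>R frechet_derivative f (at x) b)"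
proof -
  have l: "linear (frechet_derivative f (at x))" using assms(1) by (rule linear_frechet_derivative)
  have "frechet_derivative f (at x) (\<Sum>b\<in>B. (w \<bullet> b) *\<^sub>R b) = (\<Sum>b\<in>B. (w \<bullet> b) *\<^sub>R frechet_derivative f (at x) b)"
    by (simp add: linear_sum[OF l] linear_scale[OF l])
  then show ?thesis unfolding assms(2) .
qed

text \<open>\<open>Ck_on\<close> controls derivatives in fixed directions, but the chain rule
  evaluates the derivative of \<open>g\<close> in the moving direction given by the derivative of
  \<open>f\<close>. Expanding that direction in an orthonormal basis leaves derivatives of
  \<open>g\<close> in basis directions with smooth coefficients; here finite dimension enters. The
  induction varies \<open>g\<close> because it is applied to those directional derivatives.\<close>

lemma Ck_on_compose:
  fixes f :: "'a::real_normed_vector \<Rightarrow> 'b::real_inner"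
  assumes fd: "findim TYPE('b)" and S: "open S" and "f ` S \<subseteq> T" "Ck_on k f S" "Ck_on k g T"
  shows "Ck_on k (\<lambda>x. g (f x)) S"
  using assms(4,5)
proof (induction k arbitrary: g)
  case 0
  then show ?case using assms(3) by (auto intro: continuous_on_compose2)
next
  case (Suc k)
  obtain B :: "'b set" where B: "finite B" "\<And>w. (\<Sum>b\<in>B. (w \<bullet> b) *\<^sub>R b) = w"
    using findim_basis[OF fd] by blast
  have dg: "g differentiable at (f x)" if "x \<in> S" for x using Suc.prems(2) that assms(3) by auto
  have d: "((\<lambda>x. g (f x)) has_derivative
      (\<lambda>v. frechet_derivative g (at (f x)) (frechet_derivative f (at x) v))) (at x)" if "x \<in> S" for x
    using Suc.prems that dg[OF that]
    by (auto intro!: has_derivative_compose[where g = g and f = f] simp: frechet_derivative_works[symmetric])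
  have "Ck_on k (\<lambda>x. frechet_derivative (\<lambda>x. g (f x)) (at x) v) S" for v
  proof (subst Ck_on_cong[OF S, where g = "\<lambda>x. \<Sum>b\<in>B. (frechet_derivative f (at x) v \<bullet> b) *\<^sub>R frechet_derivative g (at (f x)) b"])
    show "frechet_derivative (\<lambda>x. g (f x)) (at x) v =
       (\<Sum>b\<in>B. (frechet_derivative f (at x) v \<bullet> b) *\<^sub>R frechet_derivative g (at (f x)) b)" if "x \<in> S" for x
      unfolding frechet_derivativeI[OF d[OF that]] by (rule frechet_expand[OF dg[OF that] B(2)])
    show "Ck_on k (\<lambda>x. \<Sum>b\<in>B. (frechet_derivative f (at x) v \<bullet> b) *\<^sub>R frechet_derivative g (at (f x)) b) S"
    proof (intro Ck_on_sum S Ck_on_bilinear[OF S bounded_bilinear_scaleR])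
      fix b
      show "Ck_on k (\<lambda>x. frechet_derivative f (at x) v \<bullet> b) S"
        using Suc.prems by (intro Ck_on_linear[OF S bounded_linear_inner_left, where f = "\<lambda>x. frechet_derivative f (at x) v"]) simp
      show "Ck_on k (\<lambda>x. frechet_derivative g (at (f x)) b) S"
        by (rule Suc.IH[OF Ck_on_SucD[OF Suc.prems(1)]]) (use Suc.prems(2) in simp)
    qed
  qed
  then show ?case using d by (auto simp: differentiable_def)
qed

lemma smooth_on_cong:
  "open S \<Longrightarrow> (\<And>y. y \<in> S \<Longrightarrow> f y = g y) \<Longrightarrow> smooth_on f S \<longleftrightarrow> smooth_on g S"
  unfolding smooth_on_def using Ck_on_cong by blast

lemma smooth_on_subset: "smooth_on f S \<Longrightarrow> T \<subseteq> S \<Longrightarrow> smooth_on f T"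
  unfolding smooth_on_def using Ck_on_subset by blast

lemma smooth_on_local:
  assumes "\<And>x. x \<in> S \<Longrightarrow> \<exists>T. open T \<and> x \<in> T \<and> smooth_on f T"
  shows "smooth_on f S"
  unfolding smooth_on_def
proof (intro allI Ck_on_local)
  fix k x assume "x \<in> S"
  from assms[OF this] show "\<exists>T. open T \<and> x \<in> T \<and> Ck_on k f T"
    unfolding smooth_on_def by blast
qed

lemma smooth_on_continuous: "smooth_on f S \<Longrightarrow> continuous_on S f"
  unfolding smooth_on_def using Ck_on_continuous by blast

lemma smooth_on_differentiable: "smooth_on f S \<Longrightarrow> x \<in> S \<Longrightarrow> f differentiable (at x)"
  unfolding smooth_on_def by (metis Ck_on.simps(2))

lemma smooth_on_frechet: "smooth_on f S \<Longrightarrow> smooth_on (\<lambda>x. frechet_derivative f (at x) v) S"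
  unfolding smooth_on_def by (metis Ck_on.simps(2))

lemma smooth_on_const: "smooth_on (\<lambda>x. c) S"
  unfolding smooth_on_def using Ck_on_const by blast

lemma smooth_on_id: "open S \<Longrightarrow> smooth_on (\<lambda>x. x) S"
  unfolding smooth_on_def using Ck_on_id by blast

lemma smooth_on_add: "open S \<Longrightarrow> smooth_on f S \<Longrightarrow> smooth_on g S \<Longrightarrow> smooth_on (\<lambda>x. f x + g x) S"
  unfolding smooth_on_def using Ck_on_add by blast

lemma smooth_on_sum:
  "open S \<Longrightarrow> (\<And>i. i \<in> I \<Longrightarrow> smooth_on (f i) S) \<Longrightarrow> smooth_on (\<lambda>x. \<Sum>i\<in>I. f i x) S"
  unfolding smooth_on_def by (intro allI Ck_on_sum) simp_all

lemma smooth_on_linear: "open S \<Longrightarrow> bounded_linear L \<Longrightarrow> smooth_on f S \<Longrightarrow> smooth_on (\<lambda>x. L (f x)) S"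
  unfolding smooth_on_def by (simp add: Ck_on_linear)

lemma smooth_on_bilinear:
  "open S \<Longrightarrow> bounded_bilinear P \<Longrightarrow> smooth_on f S \<Longrightarrow> smooth_on g S \<Longrightarrow> smooth_on (\<lambda>x. P (f x) (g x)) S"
  unfolding smooth_on_def by (simp add: Ck_on_bilinear)

lemma smooth_on_Pair: "open S \<Longrightarrow> smooth_on f S \<Longrightarrow> smooth_on g S \<Longrightarrow> smooth_on (\<lambda>x. (f x, g x)) S"
  unfolding smooth_on_def using Ck_on_Pair by blast

lemma smooth_on_inverse:
  fixes f :: "'a::real_normed_vector \<Rightarrow> real"
  assumes "open S" "smooth_on f S" "\<And>x. x \<in> S \<Longrightarrow> f x \<noteq> 0"
  shows "smooth_on (\<lambda>x. inverse (f x)) S"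
  unfolding smooth_on_def
proof
  fix k show "Ck_on k (\<lambda>x. inverse (f x)) S"
    by (rule Ck_on_inverse[OF assms(1) assms(2)[unfolded smooth_on_def, rule_format] assms(3)])
qed

lemma smooth_on_compose:
  fixes f :: "'a::real_normed_vector \<Rightarrow> 'b::real_inner"
  assumes "findim TYPE('b)" "open S" "f ` S \<subseteq> T" "smooth_on f S" "smooth_on g T"
  shows "smooth_on (\<lambda>x. g (f x)) S"
  unfolding smooth_on_def
proof
  fix k
  show "Ck_on k (\<lambda>x. g (f x)) S"
    by (rule Ck_on_compose[OF assms(1-3) assms(4)[unfolded smooth_on_def, rule_format]
        assms(5)[unfolded smooth_on_def, rule_format]])
qed

text \<open>Joint smoothness in point and direction, by the same expansion in a basis. This is the
  form in which the derivative of a function appears in a chart of the tangent manifold.\<close>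

lemma smooth_on_derivative:
  fixes f :: "'a::real_inner \<Rightarrow> 'b::real_normed_vector"
  assumes fd: "findim TYPE('a)" and S: "open S" and f: "smooth_on f S"
  shows "smooth_on (\<lambda>(x, v). frechet_derivative f (at x) v) (S \<times> UNIV)"
proof -
  obtain B :: "'a set" where B: "finite B" "\<And>w. (\<Sum>b\<in>B. (w \<bullet> b) *\<^sub>R b) = w"
    using findim_basis[OF fd] by blast
  have o: "open (S \<times> (UNIV::'a set))" using S by (simp add: open_Times)
  have 1: "smooth_on (\<lambda>z. frechet_derivative f (at (fst z)) b) (S \<times> (UNIV::'a set))" for b
    by (rule smooth_on_compose[OF fd o _ smooth_on_linear[OF o bounded_linear_fst smooth_on_id[OF o]]
          smooth_on_frechet[OF f]]) auto
  have 2: "smooth_on (\<lambda>z. snd z \<bullet> b) (S \<times> (UNIV::'a set))" for b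
    using smooth_on_linear[OF o bounded_linear_inner_left
        smooth_on_linear[OF o bounded_linear_snd smooth_on_id[OF o]]] .
  have "smooth_on (\<lambda>z. \<Sum>b\<in>B. (snd z \<bullet> b) *\<^sub>R frechet_derivative f (at (fst z)) b) (S \<times> (UNIV::'a set))"
    by (intro smooth_on_sum o smooth_on_bilinear[OF o bounded_bilinear_scaleR] 1 2)
  then show ?thesis
    by (rule smooth_on_cong[THEN iffD2, OF o, rotated])
      (auto intro!: frechet_expand[OF _ B(2)] smooth_on_differentiable[OF f])
qed

section \<open>Smoothness at a point of a manifold\<close>

text \<open>
  \<open>smooth_atlas\<close> is \<open>smooth_manifold\<close> without its topological conditions; in this form it is
  immediate for \<open>model_mfd\<close>.
\<close>

definition atlas :: "('x, 'b::real_normed_vector) mfd \<Rightarrow> bool" where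
  "atlas X \<longleftrightarrow> (\<Union>c\<in>charts X. fst c) = pts X \<and> (\<forall>c\<in>charts X. inj_on (snd c) (fst c))"

definition smooth_atlas :: "('x, 'b::real_inner) mfd \<Rightarrow> bool" where
  "smooth_atlas X \<longleftrightarrow> findim TYPE('b) \<and> atlas X \<and>
     (\<forall>c\<in>charts X. open (snd c ` fst c)) \<and>
     (\<forall>c\<in>charts X. \<forall>d\<in>charts X.
        open (snd c ` (fst c \<inter> fst d)) \<and>
        smooth_on (snd d \<circ> chart_inv c) (snd c ` (fst c \<inter> fst d)))"

lemma smooth_manifold_atlas: "smooth_manifold X \<Longrightarrow> smooth_atlas X"
  unfolding smooth_manifold_def smooth_atlas_def atlas_def findim_def by auto

lemma smooth_atlasD:
  fixes X :: "('x, 'b::real_inner) mfd"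
  assumes "smooth_atlas X"
  shows "findim TYPE('b)" "atlas X"
    "c \<in> charts X \<Longrightarrow> open (snd c ` fst c)"
    "c \<in> charts X \<Longrightarrow> d \<in> charts X \<Longrightarrow> open (snd c ` (fst c \<inter> fst d))"
    "c \<in> charts X \<Longrightarrow> d \<in> charts X \<Longrightarrow> smooth_on (snd d \<circ> chart_inv c) (snd c ` (fst c \<inter> fst d))"
  using assms unfolding smooth_atlas_def by blast+

lemma atlas_pts: "atlas X \<Longrightarrow> c \<in> charts X \<Longrightarrow> p \<in> fst c \<Longrightarrow> p \<in> pts X"
  unfolding atlas_def by blast

lemma atlas_chart: "atlas X \<Longrightarrow> p \<in> pts X \<Longrightarrow> \<exists>c. c \<in> charts_at X p"
  unfolding atlas_def by blast

lemma atlas_chart_inv: "atlas X \<Longrightarrow> c \<in> charts X \<Longrightarrow> p \<in> fst c \<Longrightarrow> chart_inv c (snd c p) = p"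
  unfolding atlas_def by (simp add: inv_into_f_f)

lemma atlas_inj: "atlas X \<Longrightarrow> c \<in> charts X \<Longrightarrow> p \<in> fst c \<Longrightarrow> q \<in> fst c \<Longrightarrow> snd c p = snd c q \<Longrightarrow> p = q"
  unfolding atlas_def by (auto dest: inj_onD)

lemma atlas_openin:
  "atlas X \<Longrightarrow> openin (mfd_topology X) W \<longleftrightarrow>
     W \<subseteq> pts X \<and> (\<forall>c\<in>charts X. open (snd c ` (fst c \<inter> W)))"
  by (rule openin_mfd_topology) (simp add: atlas_def)

lemma openin_chart_domain: "smooth_atlas X \<Longrightarrow> c \<in> charts X \<Longrightarrow> openin (mfd_topology X) (fst c)"
  using smooth_atlasD[of X] by (simp add: atlas_openin) (meson atlas_pts subsetI)

lemma openin_pts: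
  assumes "smooth_atlas X"
  shows "openin (mfd_topology X) (pts X)"
proof -
  have "fst c \<inter> pts X = fst c" if "c \<in> charts X" for c
    using atlas_pts[OF smooth_atlasD(2)[OF assms] that] by blast
  then show ?thesis using smooth_atlasD[OF assms] by (simp add: atlas_openin)
qed

text \<open>
  Quantifying over all charts on both sides makes compositions smooth without any compatibility
  of the charts of the intermediate manifold.
\<close>

definition smooth_at ::
  "('x, 'b::real_normed_vector) mfd \<Rightarrow> ('y, 'c::real_normed_vector) mfd \<Rightarrow> ('x \<Rightarrow> 'y) \<Rightarrow> 'x \<Rightarrow> bool" where
  "smooth_at X Y f p \<longleftrightarrow> f p \<in> pts Y \<and>
     (\<forall>c\<in>charts_at X p. \<forall>d\<in>charts_at Y (f p). \<exists>T. open T \<and> snd c p \<in> T \<and>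
        T \<subseteq> snd c ` (fst c \<inter> f -` fst d) \<and> smooth_on (snd d \<circ> f \<circ> chart_inv c) T)"

lemma smooth_atI:
  assumes "f p \<in> pts Y"
    and "\<And>c d. c \<in> charts X \<Longrightarrow> p \<in> fst c \<Longrightarrow> d \<in> charts Y \<Longrightarrow> f p \<in> fst d \<Longrightarrow>
      \<exists>T. open T \<and> snd c p \<in> T \<and>
        T \<subseteq> snd c ` (fst c \<inter> f -` fst d) \<and> smooth_on (snd d \<circ> f \<circ> chart_inv c) T"
  shows "smooth_at X Y f p"
  using assms unfolding smooth_at_def by blast

lemma smooth_atE:
  assumes "smooth_at X Y f p" "c \<in> charts X" "p \<in> fst c" "d \<in> charts Y" "f p \<in> fst d"
  obtains T where "open T" "snd c p \<in> T" "T \<subseteq> snd c ` (fst c \<inter> f -` fst d)"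
    "smooth_on (snd d \<circ> f \<circ> chart_inv c) T"
  using assms unfolding smooth_at_def by blast

text \<open>Both requirements of \<open>smooth_map\<close> are local: around each point of the
  coordinate domain a witness \<open>T\<close> of \<open>smooth_at\<close> fits inside it, which
  gives openness and smoothness at once.\<close>

lemma smooth_map_iff_smooth_at:
  assumes X: "atlas X"
  shows "smooth_map X Y f \<longleftrightarrow> (\<forall>p\<in>pts X. smooth_at X Y f p)"
proof
  assume f: "smooth_map X Y f"
  show "\<forall>p\<in>pts X. smooth_at X Y f p"
  proof (intro ballI smooth_atI)
    fix p c d assume "p \<in> pts X" "c \<in> charts X" "p \<in> fst c" "d \<in> charts Y" "f p \<in> fst d"
    then show "\<exists>T. open T \<and> snd c p \<in> T \<and>
        T \<subseteq> snd c ` (fst c \<inter> f -` fst d) \<and> smooth_on (snd d \<circ> f \<circ> chart_inv c) T"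
      using f unfolding smooth_map_def by (intro exI[of _ "snd c ` (fst c \<inter> f -` fst d)"]) auto
  qed (use f in \<open>auto simp: smooth_map_def\<close>)
next
  assume f: "\<forall>p\<in>pts X. smooth_at X Y f p"
  have *: "\<exists>T. open T \<and> y \<in> T \<and> T \<subseteq> snd c ` (fst c \<inter> f -` fst d) \<and> smooth_on (snd d \<circ> f \<circ> chart_inv c) T"
    if cd: "c \<in> charts X" "d \<in> charts Y" and y: "y \<in> snd c ` (fst c \<inter> f -` fst d)" for c d y
  proof -
    obtain p where p: "p \<in> fst c" "f p \<in> fst d" "y = snd c p" using y by auto
    then have "smooth_at X Y f p" using f atlas_pts[OF X cd(1)] by blast
    from smooth_atE[OF this cd(1) p(1) cd(2) p(2)] show ?thesis using p(3) by metis
  qed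
  show "smooth_map X Y f"
    unfolding smooth_map_def
  proof (intro conjI ballI)
    show "f ` pts X \<subseteq> pts Y" using f unfolding smooth_at_def by blast
    fix c d assume cd: "c \<in> charts X" "d \<in> charts Y"
    show "open (snd c ` (fst c \<inter> f -` fst d))"
      by (subst open_subopen) (use *[OF cd] in blast)
    show "smooth_on (snd d \<circ> f \<circ> chart_inv c) (snd c ` (fst c \<inter> f -` fst d))"
      by (rule smooth_on_local) (use *[OF cd] in blast)
  qed
qed

lemma smooth_mapD: "smooth_map X Y f \<Longrightarrow> atlas X \<Longrightarrow> p \<in> pts X \<Longrightarrow> smooth_at X Y f p"
  by (simp add: smooth_map_iff_smooth_at)

lemma smooth_at_compose:
  fixes Y :: "('y, 'c::real_inner) mfd"
  assumes X: "atlas X" and Y: "atlas Y" "findim TYPE('c)"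
    and f: "smooth_at X Y f p" and g: "smooth_at Y Z g (f p)"
  shows "smooth_at X Z (\<lambda>x. g (f x)) p"
proof (rule smooth_atI)
  show "g (f p) \<in> pts Z" using g unfolding smooth_at_def by blast
  fix c d assume c: "c \<in> charts X" "p \<in> fst c" and d: "d \<in> charts Z" "g (f p) \<in> fst d"
  obtain b where b: "b \<in> charts Y" "f p \<in> fst b"
    using atlas_chart[OF Y(1)] f unfolding smooth_at_def by blast
  obtain T1 where T1: "open T1" "snd c p \<in> T1" "T1 \<subseteq> snd c ` (fst c \<inter> f -` fst b)"
    "smooth_on (snd b \<circ> f \<circ> chart_inv c) T1" by (rule smooth_atE[OF f c b])
  obtain T2 where T2: "open T2" "snd b (f p) \<in> T2" "T2 \<subseteq> snd b ` (fst b \<inter> g -` fst d)"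
    "smooth_on (snd d \<circ> g \<circ> chart_inv b) T2" by (rule smooth_atE[OF g b d])
  let ?h = "snd b \<circ> f \<circ> chart_inv c"
  \<comment> \<open>Continuity of \<open>?h\<close> makes this set open. On it \<open>f\<close>
    lands in the domain of \<open>b\<close>, and injectivity of \<open>b\<close> turns membership of
    the coordinates in \<open>T2\<close> into the statement that \<open>g\<close> lands in the
    domain of \<open>d\<close>.\<close>
  let ?T = "T1 \<inter> ?h -` T2"
  have o: "open ?T" by (rule continuous_open_preimage[OF smooth_on_continuous[OF T1(4)] T1(1) T2(1)])
  have q: "\<exists>q. y = snd c q \<and> q \<in> fst c \<and> f q \<in> fst b \<and> g (f q) \<in> fst d" if y: "y \<in> ?T" for y
  proof -
    obtain q where q: "y = snd c q" "q \<in> fst c" "f q \<in> fst b" using y T1(3) by auto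
    have "snd b (f q) \<in> T2" using y q by (simp add: atlas_chart_inv[OF X c(1)])
    then obtain r where "r \<in> fst b" "g r \<in> fst d" "snd b (f q) = snd b r" using T2(3) by auto
    then have "g (f q) \<in> fst d" using atlas_inj[OF Y(1) b(1)] q by metis
    with q show ?thesis by blast
  qed
  have "smooth_on (\<lambda>y. (snd d \<circ> g \<circ> chart_inv b) (?h y)) ?T"
    by (rule smooth_on_compose[OF Y(2) o _ smooth_on_subset[OF T1(4)] T2(4)]) auto
  then have "smooth_on (snd d \<circ> (\<lambda>x. g (f x)) \<circ> chart_inv c) ?T"
  proof (rule smooth_on_cong[OF o, THEN iffD2, rotated])
    fix y assume "y \<in> ?T"
    from q[OF this] obtain q where "y = snd c q" "q \<in> fst c" "f q \<in> fst b" by blast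
    then show "(snd d \<circ> (\<lambda>x. g (f x)) \<circ> chart_inv c) y = (snd d \<circ> g \<circ> chart_inv b) (?h y)"
      by (simp add: atlas_chart_inv[OF X c(1)] atlas_chart_inv[OF Y(1) b(1)])
  qed
  moreover have "?T \<subseteq> snd c ` (fst c \<inter> (\<lambda>x. g (f x)) -` fst d)" using q by blast
  moreover have "snd c p \<in> ?T" using T1 T2 c by (simp add: atlas_chart_inv[OF X c(1)])
  ultimately show "\<exists>T. open T \<and> snd c p \<in> T \<and> T \<subseteq> snd c ` (fst c \<inter> (\<lambda>x. g (f x)) -` fst d) \<and>
      smooth_on (snd d \<circ> (\<lambda>x. g (f x)) \<circ> chart_inv c) T" using o by blast
qed

lemma smooth_at_cong:
  assumes X: "atlas X" and N: "openin (mfd_topology X) N" "p \<in> N"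
    and eq: "\<And>q. q \<in> N \<Longrightarrow> f q = g q" and f: "smooth_at X Y f p"
  shows "smooth_at X Y g p"
proof (rule smooth_atI)
  show "g p \<in> pts Y" using f eq[OF N(2)] unfolding smooth_at_def by metis
  fix c d assume c: "c \<in> charts X" "p \<in> fst c" and d: "d \<in> charts Y" "g p \<in> fst d"
  obtain T where T: "open T" "snd c p \<in> T" "T \<subseteq> snd c ` (fst c \<inter> f -` fst d)"
    "smooth_on (snd d \<circ> f \<circ> chart_inv c) T"
    using smooth_atE[OF f c d(1)] d(2) eq[OF N(2)] by metis
  let ?T = "T \<inter> snd c ` (fst c \<inter> N)"
  have o: "open ?T" using T(1) N(1) c(1) by (auto simp: atlas_openin[OF X])
  have "smooth_on (snd d \<circ> g \<circ> chart_inv c) ?T"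
    by (rule smooth_on_cong[OF o, THEN iffD2, OF _ smooth_on_subset[OF T(4)]])
      (auto simp: atlas_chart_inv[OF X c(1)] eq)
  moreover have "?T \<subseteq> snd c ` (fst c \<inter> g -` fst d)"
  proof
    fix y assume y: "y \<in> ?T"
    then obtain q where q: "q \<in> fst c" "q \<in> N" "y = snd c q" by blast
    obtain q' where q': "q' \<in> fst c" "f q' \<in> fst d" "y = snd c q'" using y T(3) by blast
    then have "q = q'" using atlas_inj[OF X c(1)] q by metis
    then show "y \<in> snd c ` (fst c \<inter> g -` fst d)" using q q' eq[OF q(2)] by auto
  qed
  ultimately show "\<exists>T. open T \<and> snd c p \<in> T \<and> T \<subseteq> snd c ` (fst c \<inter> g -` fst d) \<and>
      smooth_on (snd d \<circ> g \<circ> chart_inv c) T" using o T(2) c N(2) by blast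
qed

section \<open>Maps into and out of model spaces\<close>

lemma atlas_model: "atlas model_mfd"
  by (simp add: atlas_def model_mfd_def)

lemma model_mfd_simps [simp]:
  "pts model_mfd = UNIV" "charts model_mfd = {(UNIV, \<lambda>x. x)}"
  by (simp_all add: model_mfd_def)

lemma inv_into_UNIV_ident [simp]: "inv_into UNIV (\<lambda>x. x) = (\<lambda>x. x)"
  by (rule inv_equality) simp_all

lemma smooth_atlas_model: "findim TYPE('b::real_inner) \<Longrightarrow> smooth_atlas (model_mfd :: ('b, 'b) mfd)"
  by (auto simp: smooth_atlas_def atlas_model comp_def smooth_on_id)

lemma smooth_at_model_iff:
  "smooth_at X model_mfd f p \<longleftrightarrow>
     (\<forall>c\<in>charts_at X p. \<exists>T. open T \<and> snd c p \<in> T \<and> T \<subseteq> snd c ` fst c \<and> smooth_on (\<lambda>y. f (chart_inv c y)) T)"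
  unfolding smooth_at_def by (simp add: comp_def)

lemma smooth_at_model_model_iff:
  "smooth_at model_mfd model_mfd f y \<longleftrightarrow> (\<exists>T. open T \<and> y \<in> T \<and> smooth_on f T)"
  unfolding smooth_at_model_iff by simp

lemma smooth_at_const: "smooth_atlas X \<Longrightarrow> smooth_at X model_mfd (\<lambda>x. k) p"
  unfolding smooth_at_model_iff by (auto intro!: smooth_on_const dest: smooth_atlasD)

text \<open>Transfers a closure property of smooth functions on open subsets of the model space to
  functions on a manifold. The binary version below intersects the two witnesses.\<close>

lemma smooth_at_lift:
  fixes X :: "('x, 'b::real_normed_vector) mfd"
  assumes f: "smooth_at X model_mfd f p"
    and h: "\<And>S (u :: 'b \<Rightarrow> _). open S \<Longrightarrow> smooth_on u S \<Longrightarrow> smooth_on (\<lambda>y. h (u y)) S"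
  shows "smooth_at X model_mfd (\<lambda>x. h (f x)) p"
  unfolding smooth_at_model_iff
proof
  fix c assume "c \<in> charts_at X p"
  then obtain T where T: "open T" "snd c p \<in> T" "T \<subseteq> snd c ` fst c" "smooth_on (\<lambda>y. f (chart_inv c y)) T"
    using f unfolding smooth_at_model_iff by blast
  then show "\<exists>T. open T \<and> snd c p \<in> T \<and> T \<subseteq> snd c ` fst c \<and> smooth_on (\<lambda>y. h (f (chart_inv c y))) T"
    using h[OF T(1,4)] by blast
qed

lemma smooth_at_lift2:
  fixes X :: "('x, 'b::real_normed_vector) mfd"
  assumes f: "smooth_at X model_mfd f p" and g: "smooth_at X model_mfd g p"
    and h: "\<And>S (u :: 'b \<Rightarrow> _) v. open S \<Longrightarrow> smooth_on u S \<Longrightarrow> smooth_on v S \<Longrightarrow> smooth_on (\<lambda>y. h (u y) (v y)) S"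
  shows "smooth_at X model_mfd (\<lambda>x. h (f x) (g x)) p"
  unfolding smooth_at_model_iff
proof
  fix c assume c: "c \<in> charts_at X p"
  obtain T1 where T1: "open T1" "snd c p \<in> T1" "T1 \<subseteq> snd c ` fst c" "smooth_on (\<lambda>y. f (chart_inv c y)) T1"
    using f c unfolding smooth_at_model_iff by blast
  obtain T2 where T2: "open T2" "snd c p \<in> T2" "T2 \<subseteq> snd c ` fst c" "smooth_on (\<lambda>y. g (chart_inv c y)) T2"
    using g c unfolding smooth_at_model_iff by blast
  have "smooth_on (\<lambda>y. h (f (chart_inv c y)) (g (chart_inv c y))) (T1 \<inter> T2)"
    by (rule h[OF open_Int[OF T1(1) T2(1)] smooth_on_subset[OF T1(4) Int_lower1]
          smooth_on_subset[OF T2(4) Int_lower2]])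
  then show "\<exists>T. open T \<and> snd c p \<in> T \<and> T \<subseteq> snd c ` fst c \<and>
      smooth_on (\<lambda>y. h (f (chart_inv c y)) (g (chart_inv c y))) T"
    using T1 T2 by (intro exI[of _ "T1 \<inter> T2"]) auto
qed

lemma smooth_at_linear:
  "bounded_linear L \<Longrightarrow> smooth_at X model_mfd f p \<Longrightarrow> smooth_at X model_mfd (\<lambda>x. L (f x)) p"
  by (rule smooth_at_lift[where f = f and h = "L"]) (simp_all add: smooth_on_linear)

lemma smooth_at_add:
  "smooth_at X model_mfd f p \<Longrightarrow> smooth_at X model_mfd g p \<Longrightarrow> smooth_at X model_mfd (\<lambda>x. f x + g x) p"
  by (rule smooth_at_lift2[where f = f and g = g and h = "(+)"]) (simp_all add: smooth_on_add)

lemma smooth_at_bilinear: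
  "bounded_bilinear P \<Longrightarrow> smooth_at X model_mfd f p \<Longrightarrow> smooth_at X model_mfd g p \<Longrightarrow>
     smooth_at X model_mfd (\<lambda>x. P (f x) (g x)) p"
  by (rule smooth_at_lift2[where f = f and g = g and h = "P"]) (simp_all add: smooth_on_bilinear)

lemmas smooth_at_mult = smooth_at_bilinear[OF bounded_bilinear_mult]

lemma smooth_at_Pair:
  "smooth_at X model_mfd f p \<Longrightarrow> smooth_at X model_mfd g p \<Longrightarrow> smooth_at X model_mfd (\<lambda>x. (f x, g x)) p"
  by (rule smooth_at_lift2[where f = f and g = g and h = "Pair"]) (simp_all add: smooth_on_Pair)

lemma smooth_at_sum:
  assumes "smooth_atlas X" "\<And>i. i \<in> I \<Longrightarrow> smooth_at X model_mfd (f i) p"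
  shows "smooth_at X model_mfd (\<lambda>x. \<Sum>i\<in>I. f i x) p"
  using assms(2)
proof (induction I rule: infinite_finite_induct)
  case (insert i I)
  then show ?case using smooth_at_add[of X "f i" p] by simp
qed (simp_all add: smooth_at_const assms(1))

text \<open>Composition with inversion on the punctured line. As this is open, \<open>f\<close> need
  be nonzero at \<open>p\<close> only.\<close>

lemma smooth_at_inverse:
  fixes f :: "'x \<Rightarrow> real"
  assumes X: "atlas X" and f: "smooth_at X model_mfd f p" and "f p \<noteq> 0"
  shows "smooth_at X model_mfd (\<lambda>x. inverse (f x)) p"
proof -
  have "smooth_at model_mfd model_mfd (inverse :: real \<Rightarrow> real) (f p)"
    unfolding smooth_at_model_model_iff
  proof (intro exI conjI)
    show "open (- {0::real})" by (simp add: open_Compl)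
    show "f p \<in> - {0}" using assms(3) by simp
    show "smooth_on (inverse :: real \<Rightarrow> real) (- {0})"
      using smooth_on_inverse[of "- {0::real}" "\<lambda>x. x"] by (simp add: smooth_on_id open_Compl)
  qed
  then show ?thesis by (rule smooth_at_compose[OF X atlas_model findim_real f])
qed

text \<open>In charts this is precisely the smoothness of the transition maps; the same holds for a
  chart and its inverse below.\<close>

lemma smooth_at_id: 
  assumes X: "smooth_atlas X" and p: "p \<in> pts X"
  shows "smooth_at X X (\<lambda>x. x) p"
proof (rule smooth_atI)
  fix c d assume "c \<in> charts X" "p \<in> fst c" "d \<in> charts X" "p \<in> fst d"
  then show "\<exists>T. open T \<and> snd c p \<in> T \<and> T \<subseteq> snd c ` (fst c \<inter> (\<lambda>x. x) -` fst d) \<and>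
      smooth_on (snd d \<circ> (\<lambda>x. x) \<circ> chart_inv c) T"
    using smooth_atlasD(4,5)[OF X, of c d]
    by (intro exI[of _ "snd c ` (fst c \<inter> fst d)"]) (auto simp: comp_def)
qed (rule p)

lemma smooth_at_chart:
  assumes X: "smooth_atlas X" and d: "d \<in> charts X" "p \<in> fst d"
  shows "smooth_at X model_mfd (snd d) p"
  unfolding smooth_at_model_iff
proof
  fix c assume "c \<in> charts_at X p"
  then show "\<exists>T. open T \<and> snd c p \<in> T \<and> T \<subseteq> snd c ` fst c \<and> smooth_on (\<lambda>y. snd d (chart_inv c y)) T"
    using smooth_atlasD(4,5)[OF X, of c d] d
    by (intro exI[of _ "snd c ` (fst c \<inter> fst d)"]) (auto simp: comp_def)
qed

lemma smooth_at_chart_inv: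
  assumes X: "smooth_atlas X" and c: "c \<in> charts X" "p \<in> fst c"
  shows "smooth_at model_mfd X (chart_inv c) (snd c p)"
proof (rule smooth_atI)
  note a = atlas_chart_inv[OF smooth_atlasD(2)[OF X] c(1)]
  show "chart_inv c (snd c p) \<in> pts X" using a c atlas_pts[OF smooth_atlasD(2)[OF X]] by simp
  fix b d assume b: "b \<in> charts model_mfd" "snd c p \<in> fst b" and d: "d \<in> charts X" "chart_inv c (snd c p) \<in> fst d"
  show "\<exists>T. open T \<and> snd b (snd c p) \<in> T \<and> T \<subseteq> snd b ` (fst b \<inter> chart_inv c -` fst d) \<and>
      smooth_on (snd d \<circ> chart_inv c \<circ> chart_inv b) T"
    using smooth_atlasD(4,5)[OF X c(1) d(1)] b d(2) c(2) a
    by (intro exI[of _ "snd c ` (fst c \<inter> fst d)"]) (auto simp: comp_def)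
qed

text \<open>\<open>smooth_at\<close> quantifies over all charts around \<open>p\<close>. In a smooth
  atlas one suffices, since near \<open>p\<close> the function factors as its expression in
  \<open>c\<close> after the chart \<open>c\<close>.\<close>

lemma smooth_at_model_chartI:
  assumes X: "smooth_atlas X" and c: "c \<in> charts X" "p \<in> fst c"
    and T: "open T" "snd c p \<in> T" "smooth_on (\<lambda>y. f (chart_inv c y)) T"
  shows "smooth_at X model_mfd f p"
proof -
  have "smooth_at X model_mfd (\<lambda>x. (\<lambda>y. f (chart_inv c y)) (snd c x)) p"
    by (rule smooth_at_compose[OF smooth_atlasD(2)[OF X] atlas_model smooth_atlasD(1)[OF X]
          smooth_at_chart[OF X c]]) (use T in \<open>auto simp: smooth_at_model_model_iff\<close>)
  then show ?thesis
    by (rule smooth_at_cong[OF smooth_atlasD(2)[OF X] openin_chart_domain[OF X c(1)] c(2), rotated])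
      (simp add: atlas_chart_inv[OF smooth_atlasD(2)[OF X] c(1)])
qed

section \<open>Open submanifolds and products\<close>

lemma open_submfd_simps [simp]:
  "pts (open_submfd X U) = pts X \<inter> U"
  "charts (open_submfd X U) = (\<lambda>c. (fst c \<inter> U, snd c)) ` charts X"
  by (simp_all add: open_submfd_def)

lemma atlas_open_submfd: "atlas X \<Longrightarrow> atlas (open_submfd X U)"
  unfolding atlas_def by (auto intro: inj_on_subset)

lemma smooth_at_open_submfd_iff:
  assumes X: "atlas X" and U: "openin (mfd_topology X) U" and p: "p \<in> U"
  shows "smooth_at (open_submfd X U) Y f p \<longleftrightarrow> smooth_at X Y f p"
proof -
  \<comment> \<open>\<open>inv_into\<close> depends on the domain, so the inverses of a chart and of
    its restriction agree only on the image of the smaller domain.\<close>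
  have inv: "inv_into (fst c \<inter> U) (snd c) y = chart_inv c y"
    if "c \<in> charts X" "y \<in> snd c ` (fst c \<inter> U)" for c y
  proof -
    have "inj_on (snd c) (fst c)" using that X unfolding atlas_def by blast
    then show ?thesis using that(2) by (auto simp: inv_into_f_f inj_on_subset)
  qed
  show ?thesis
  proof
    assume f: "smooth_at (open_submfd X U) Y f p"
    show "smooth_at X Y f p"
    proof (rule smooth_atI)
      show "f p \<in> pts Y" using f unfolding smooth_at_def by blast
      fix c d assume c: "c \<in> charts X" "p \<in> fst c" and d: "d \<in> charts Y" "f p \<in> fst d"
      let ?c = "(fst c \<inter> U, snd c)"
      have "?c \<in> charts (open_submfd X U)" "p \<in> fst ?c" using c p by auto
      from smooth_atE[OF f this d] obtain T where T: "open T" "snd c p \<in> T"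
        "T \<subseteq> snd c ` (fst c \<inter> U \<inter> f -` fst d)" "smooth_on (snd d \<circ> f \<circ> inv_into (fst c \<inter> U) (snd c)) T"
        by (metis fst_conv snd_conv)
      have "smooth_on (snd d \<circ> f \<circ> chart_inv c) T"
        by (rule smooth_on_cong[OF T(1), THEN iffD1, OF _ T(4)]) (use T(3) inv[OF c(1)] in \<open>force\<close>)
      moreover have "T \<subseteq> snd c ` (fst c \<inter> f -` fst d)" using T(3) by blast
      ultimately show "\<exists>T. open T \<and> snd c p \<in> T \<and> T \<subseteq> snd c ` (fst c \<inter> f -` fst d) \<and>
        smooth_on (snd d \<circ> f \<circ> chart_inv c) T" using T(1,2) by blast
    qed
  next
    assume f: "smooth_at X Y f p"
    show "smooth_at (open_submfd X U) Y f p"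
    proof (rule smooth_atI)
      show "f p \<in> pts Y" using f unfolding smooth_at_def by blast
      fix c' d assume c': "c' \<in> charts (open_submfd X U)" "p \<in> fst c'" and d: "d \<in> charts Y" "f p \<in> fst d"
      then obtain c where c: "c \<in> charts X" "c' = (fst c \<inter> U, snd c)" "p \<in> fst c" by auto
      obtain T where T: "open T" "snd c p \<in> T"
        "T \<subseteq> snd c ` (fst c \<inter> f -` fst d)" "smooth_on (snd d \<circ> f \<circ> chart_inv c) T"
        by (rule smooth_atE[OF f c(1) c(3) d])
      let ?T = "T \<inter> snd c ` (fst c \<inter> U)"
      have o: "open ?T" using T(1) U c(1) by (auto simp: atlas_openin[OF X])
      have "smooth_on (snd d \<circ> f \<circ> inv_into (fst c \<inter> U) (snd c)) ?T"
        by (rule smooth_on_cong[OF o, THEN iffD2, OF _ smooth_on_subset[OF T(4)]]) (use inv[OF c(1)] in auto)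
      moreover have "?T \<subseteq> snd c ` (fst c \<inter> U \<inter> f -` fst d)"
      proof
        fix y assume y: "y \<in> ?T"
        then obtain q where q: "q \<in> fst c" "q \<in> U" "y = snd c q" by blast
        obtain q' where q': "q' \<in> fst c" "f q' \<in> fst d" "y = snd c q'" using y T(3) by blast
        then have "q = q'" using atlas_inj[OF X c(1)] q by metis
        then show "y \<in> snd c ` (fst c \<inter> U \<inter> f -` fst d)" using q q' by auto
      qed
      moreover have "snd c p \<in> ?T" using T(2) c(3) p by auto
      ultimately show "\<exists>T. open T \<and> snd c' p \<in> T \<and> T \<subseteq> snd c' ` (fst c' \<inter> f -` fst d) \<and>
        smooth_on (snd d \<circ> f \<circ> chart_inv c') T" unfolding c(2) fst_conv snd_conv using o by blast
    qed
  qed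
qed

lemma smooth_at_into_open_submfdD:
  assumes "smooth_at X (open_submfd Y W) f p"
  shows "smooth_at X Y f p"
proof (rule smooth_atI)
  show "f p \<in> pts Y" using assms unfolding smooth_at_def by simp
  fix c d assume c: "c \<in> charts X" "p \<in> fst c" and d: "d \<in> charts Y" "f p \<in> fst d"
  have "f p \<in> W" using assms unfolding smooth_at_def by simp
  then have "(fst d \<inter> W, snd d) \<in> charts (open_submfd Y W)" "f p \<in> fst (fst d \<inter> W, snd d)" using d by auto
  from smooth_atE[OF assms c this] obtain T where "open T" "snd c p \<in> T"
    "T \<subseteq> snd c ` (fst c \<inter> f -` (fst d \<inter> W))" "smooth_on (snd d \<circ> f \<circ> chart_inv c) T"
    by (metis fst_conv snd_conv)
  then show "\<exists>T. open T \<and> snd c p \<in> T \<and> T \<subseteq> snd c ` (fst c \<inter> f -` fst d) \<and>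
      smooth_on (snd d \<circ> f \<circ> chart_inv c) T" by blast
qed

text \<open>A neighbourhood of \<open>p\<close> must be found that \<open>f\<close> maps into
  \<open>W\<close>: the witness \<open>T\<close> is cut down to the preimage of \<open>W\<close>
  read in the chart \<open>d\<close>, which is open by continuity.\<close>

lemma smooth_at_into_open_submfdI:
  assumes X: "atlas X" and Y: "atlas Y" and W: "openin (mfd_topology Y) W" "f p \<in> W"
    and f: "smooth_at X Y f p"
  shows "smooth_at X (open_submfd Y W) f p"
proof (rule smooth_atI)
  show "f p \<in> pts (open_submfd Y W)" using f W unfolding smooth_at_def by simp
  fix c d' assume c: "c \<in> charts X" "p \<in> fst c" and d': "d' \<in> charts (open_submfd Y W)" "f p \<in> fst d'"
  then obtain d where d: "d \<in> charts Y" "d' = (fst d \<inter> W, snd d)" "f p \<in> fst d" by auto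
  obtain T where T: "open T" "snd c p \<in> T"
    "T \<subseteq> snd c ` (fst c \<inter> f -` fst d)" "smooth_on (snd d \<circ> f \<circ> chart_inv c) T"
    by (rule smooth_atE[OF f c d(1) d(3)])
  let ?h = "snd d \<circ> f \<circ> chart_inv c"
  let ?T = "T \<inter> ?h -` (snd d ` (fst d \<inter> W))"
  have "open (snd d ` (fst d \<inter> W))" using W(1) d(1) by (simp add: atlas_openin[OF Y])
  then have o: "open ?T" by (rule continuous_open_preimage[OF smooth_on_continuous[OF T(4)] T(1)])
  have "?T \<subseteq> snd c ` (fst c \<inter> f -` (fst d \<inter> W))"
  proof
    fix y assume y: "y \<in> ?T"
    then obtain q where q: "y = snd c q" "q \<in> fst c" "f q \<in> fst d" using T(3) by auto
    have "snd d (f q) \<in> snd d ` (fst d \<inter> W)" using y q by (simp add: atlas_chart_inv[OF X c(1)])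
    then obtain r where r: "r \<in> fst d" "r \<in> W" "snd d (f q) = snd d r" by blast
    then have "f q \<in> W" using atlas_inj[OF Y d(1) q(3) r(1)] by simp
    then show "y \<in> snd c ` (fst c \<inter> f -` (fst d \<inter> W))" using q by auto
  qed
  moreover have "snd c p \<in> ?T" using T(2) c d W(2) by (simp add: atlas_chart_inv[OF X c(1)])
  moreover have "smooth_on ?h ?T" using T(4) smooth_on_subset by blast
  ultimately show "\<exists>T. open T \<and> snd c p \<in> T \<and> T \<subseteq> snd c ` (fst c \<inter> f -` fst d') \<and>
      smooth_on (snd d' \<circ> f \<circ> chart_inv c) T" unfolding d(2) fst_conv snd_conv using o by blast
qed

text \<open>Near a point sent into \<open>W\<close> the map is smooth into the open submanifold on
  \<open>W\<close>, and the definition of \<open>smooth_at\<close> then supplies an open set of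
  coordinates mapped into \<open>W\<close>.\<close>

lemma smooth_map_open_vimage:
  assumes X: "atlas X" and Y: "atlas Y" and f: "smooth_map X Y f" and W: "openin (mfd_topology Y) W"
  shows "openin (mfd_topology X) (pts X \<inter> f -` W)"
  unfolding atlas_openin[OF X]
proof (intro conjI ballI)
  fix c assume c: "c \<in> charts X"
  show "open (snd c ` (fst c \<inter> (pts X \<inter> f -` W)))"
  proof (subst open_subopen, intro ballI)
    fix y assume "y \<in> snd c ` (fst c \<inter> (pts X \<inter> f -` W))"
    then obtain p where p: "y = snd c p" "p \<in> fst c" "p \<in> pts X" "f p \<in> W" by blast
    have f': "smooth_at X (open_submfd Y W) f p"
      by (rule smooth_at_into_open_submfdI[OF X Y W p(4) smooth_mapD[OF f X p(3)]])
    then have "f p \<in> pts (open_submfd Y W)" unfolding smooth_at_def by blast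
    then obtain d where d: "d \<in> charts (open_submfd Y W)" "f p \<in> fst d"
      using atlas_chart[OF atlas_open_submfd[OF Y]] by blast
    obtain T where T: "open T" "snd c p \<in> T" "T \<subseteq> snd c ` (fst c \<inter> f -` fst d)"
      by (rule smooth_atE[OF f' c p(2) d])
    have "fst d \<subseteq> W" "fst c \<subseteq> pts X" using d(1) atlas_pts[OF X c] by auto
    then have "snd c ` (fst c \<inter> f -` fst d) \<subseteq> snd c ` (fst c \<inter> (pts X \<inter> f -` W))" by auto
    then show "\<exists>T. open T \<and> y \<in> T \<and> T \<subseteq> snd c ` (fst c \<inter> (pts X \<inter> f -` W))"
      using T p(1) by (intro exI[of _ T]) simp
  qed
qed auto

lemma prod_mfd_simps [simp]:
  "pts (prod_mfd X Y) = pts X \<times> pts Y"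
  "charts (prod_mfd X Y) =
     (\<lambda>(c, d). (fst c \<times> fst d, map_prod (snd c) (snd d))) ` (charts X \<times> charts Y)"
  by (simp_all add: prod_mfd_def)

lemma atlas_prod:
  assumes "atlas X" "atlas Y"
  shows "atlas (prod_mfd X Y)"
proof -
  have p: "pts X = (\<Union>c\<in>charts X. fst c)" "pts Y = (\<Union>c\<in>charts Y. fst c)"
    using assms unfolding atlas_def by simp_all
  have "(\<Union>e\<in>charts (prod_mfd X Y). fst e) = pts (prod_mfd X Y)"
    unfolding prod_mfd_simps p by force
  moreover have "inj_on (snd e) (fst e)" if e: "e \<in> charts (prod_mfd X Y)" for e
  proof -
    obtain c d where "c \<in> charts X" "d \<in> charts Y" "e = (fst c \<times> fst d, map_prod (snd c) (snd d))"
      using e by auto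
    then show ?thesis using assms unfolding atlas_def by (simp add: map_prod_inj_on)
  qed
  ultimately show ?thesis unfolding atlas_def by blast
qed

lemma smooth_at_snd_prod:
  assumes Y: "atlas Y" and f: "smooth_at X (prod_mfd Y Z) f p"
  shows "smooth_at X Z (\<lambda>x. snd (f x)) p"
proof (rule smooth_atI)
  have fp: "f p \<in> pts Y \<times> pts Z" using f unfolding smooth_at_def by simp
  then show "snd (f p) \<in> pts Z" by auto
  fix c d assume c: "c \<in> charts X" "p \<in> fst c" and d: "d \<in> charts Z" "snd (f p) \<in> fst d"
  \<comment> \<open>Any chart at the first component will do; it completes \<open>d\<close> to a
    chart of the product.\<close>
  obtain b where b: "b \<in> charts Y" "fst (f p) \<in> fst b" using atlas_chart[OF Y] fp by fastforce
  let ?e = "(fst b \<times> fst d, map_prod (snd b) (snd d))"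
  have "?e \<in> charts (prod_mfd Y Z)" "f p \<in> fst ?e" using b d by (auto simp: mem_Times_iff)
  from smooth_atE[OF f c this] obtain T where T: "open T" "snd c p \<in> T" "T \<subseteq> snd c ` (fst c \<inter> f -` (fst b \<times> fst d))"
    "smooth_on (map_prod (snd b) (snd d) \<circ> f \<circ> chart_inv c) T" by (metis fst_conv snd_conv)
  have "smooth_on (snd d \<circ> (\<lambda>x. snd (f x)) \<circ> chart_inv c) T"
    using smooth_on_linear[OF T(1) bounded_linear_snd T(4)] by (simp add: comp_def)
  then show "\<exists>T. open T \<and> snd c p \<in> T \<and> T \<subseteq> snd c ` (fst c \<inter> (\<lambda>x. snd (f x)) -` fst d) \<and>
      smooth_on (snd d \<circ> (\<lambda>x. snd (f x)) \<circ> chart_inv c) T" using T by fastforce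
qed

lemma smooth_at_pair_prod:
  assumes X: "atlas X" and f: "smooth_at X Y f p" and g: "smooth_at X Z g p"
  shows "smooth_at X (prod_mfd Y Z) (\<lambda>x. (f x, g x)) p"
proof (rule smooth_atI)
  show "(f p, g p) \<in> pts (prod_mfd Y Z)" using f g unfolding smooth_at_def by simp
  fix c e assume c: "c \<in> charts X" "p \<in> fst c" and e: "e \<in> charts (prod_mfd Y Z)" "(f p, g p) \<in> fst e"
  then obtain d b where e': "e = (fst d \<times> fst b, map_prod (snd d) (snd b))"
    and d: "d \<in> charts Y" "f p \<in> fst d" and b: "b \<in> charts Z" "g p \<in> fst b" by auto
  obtain T where T: "open T" "snd c p \<in> T" "T \<subseteq> snd c ` (fst c \<inter> f -` fst d)"
    "smooth_on (snd d \<circ> f \<circ> chart_inv c) T" by (rule smooth_atE[OF f c d])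
  obtain S where S: "open S" "snd c p \<in> S" "S \<subseteq> snd c ` (fst c \<inter> g -` fst b)"
    "smooth_on (snd b \<circ> g \<circ> chart_inv c) S" by (rule smooth_atE[OF g c b])
  have o: "open (T \<inter> S)" using T S by auto
  have "smooth_on (\<lambda>y. ((snd d \<circ> f \<circ> chart_inv c) y, (snd b \<circ> g \<circ> chart_inv c) y)) (T \<inter> S)"
    by (intro smooth_on_Pair[OF o] smooth_on_subset[OF T(4)] smooth_on_subset[OF S(4)]) auto
  then have "smooth_on (snd e \<circ> (\<lambda>x. (f x, g x)) \<circ> chart_inv c) (T \<inter> S)" by (simp add: e' comp_def)
  moreover have "T \<inter> S \<subseteq> snd c ` (fst c \<inter> (\<lambda>x. (f x, g x)) -` fst e)"
  proof
    fix y assume "y \<in> T \<inter> S"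
    then obtain q r where "q \<in> fst c" "f q \<in> fst d" "y = snd c q" "r \<in> fst c" "g r \<in> fst b" "y = snd c r"
      using T(3) S(3) by blast
    moreover from this have "q = r" using atlas_inj[OF X c(1)] by metis
    ultimately show "y \<in> snd c ` (fst c \<inter> (\<lambda>x. (f x, g x)) -` fst e)" by (auto simp: e')
  qed
  ultimately show "\<exists>T. open T \<and> snd c p \<in> T \<and> T \<subseteq> snd c ` (fst c \<inter> (\<lambda>x. (f x, g x)) -` fst e) \<and>
      smooth_on (snd e \<circ> (\<lambda>x. (f x, g x)) \<circ> chart_inv c) T" using o T(2) S(2) by blast
qed

section \<open>Tangent vectors\<close>

lemma smooth_at_chart_differentiable:
  assumes g: "smooth_at X model_mfd g p" and c: "c \<in> charts X" "p \<in> fst c"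
  shows "(g \<circ> chart_inv c) differentiable (at (snd c p))"
proof -
  obtain T where T: "snd c p \<in> T" "smooth_on (\<lambda>y. g (chart_inv c y)) T"
    using g c unfolding smooth_at_model_iff by blast
  show ?thesis using smooth_on_differentiable[OF T(2,1)] by (simp add: comp_def)
qed

lemma frechet_derivative_chain:
  assumes X: "atlas X" and Y: "atlas Y"
    and f: "smooth_at X Y f p" and g: "smooth_at Y model_mfd g (f p)"
    and c: "c \<in> charts X" "p \<in> fst c" and d: "d \<in> charts Y" "f p \<in> fst d"
  shows "frechet_derivative (g \<circ> f \<circ> chart_inv c) (at (snd c p)) v =
    frechet_derivative (g \<circ> chart_inv d) (at (snd d (f p)))
      (frechet_derivative (snd d \<circ> f \<circ> chart_inv c) (at (snd c p)) v)"
proof -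
  obtain T where T: "open T" "snd c p \<in> T" "T \<subseteq> snd c ` (fst c \<inter> f -` fst d)"
    "smooth_on (snd d \<circ> f \<circ> chart_inv c) T" by (rule smooth_atE[OF f c d])
  let ?h = "snd d \<circ> f \<circ> chart_inv c" and ?g = "g \<circ> chart_inv d"
  have h: "(?h has_derivative frechet_derivative ?h (at (snd c p))) (at (snd c p))"
    using smooth_on_differentiable[OF T(4,2)] by (simp add: frechet_derivative_works)
  have hp: "?h (snd c p) = snd d (f p)" by (simp add: atlas_chart_inv[OF X c])
  have "(?g has_derivative frechet_derivative ?g (at (?h (snd c p)))) (at (?h (snd c p)))"
    using smooth_at_chart_differentiable[OF g d] unfolding hp by (simp add: frechet_derivative_works)
  from has_derivative_compose[OF h this]
  have "frechet_derivative (\<lambda>y. ?g (?h y)) (at (snd c p)) =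
      (\<lambda>v. frechet_derivative ?g (at (snd d (f p))) (frechet_derivative ?h (at (snd c p)) v))"
    unfolding hp by (rule frechet_derivativeI)
  moreover have "frechet_derivative (g \<circ> f \<circ> chart_inv c) (at (snd c p)) =
      frechet_derivative (\<lambda>y. ?g (?h y)) (at (snd c p))"
  proof (rule frechet_derivative_cong_open(1)[OF T(1,2)])
    fix y assume "y \<in> T"
    then obtain q where "y = snd c q" "q \<in> fst c" "f q \<in> fst d" using T(3) by auto
    then show "(g \<circ> f \<circ> chart_inv c) y = ?g (?h y)"
      by (simp add: atlas_chart_inv[OF X c(1)] atlas_chart_inv[OF Y d(1)])
  qed
  ultimately show ?thesis by simp
qed

text \<open>The chain rule for the identity, read in the charts \<open>c\<close> and
  \<open>d\<close>.\<close>

lemma frechet_derivative_chart_change: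
  assumes X: "smooth_atlas X" and f: "smooth_at X model_mfd f p"
    and c: "c \<in> charts X" "p \<in> fst c" and d: "d \<in> charts X" "p \<in> fst d"
  shows "frechet_derivative (f \<circ> chart_inv c) (at (snd c p)) v =
    frechet_derivative (f \<circ> chart_inv d) (at (snd d p))
      (frechet_derivative (snd d \<circ> chart_inv c) (at (snd c p)) v)"
proof -
  note a = smooth_atlasD(2)[OF X]
  show ?thesis
    using frechet_derivative_chain[OF a a smooth_at_id[OF X atlas_pts[OF a c]] f c d, of v]
    by (simp add: comp_def)
qed

lemma tangent_vectors_iff:
  "\<nu> \<in> tangent_vectors X \<longleftrightarrow> fst \<nu> \<in> pts X \<and>
     (\<forall>c\<in>charts_at X (fst \<nu>). \<forall>d\<in>charts_at X (fst \<nu>).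
        snd \<nu> d = frechet_derivative (snd d \<circ> chart_inv c) (at (snd c (fst \<nu>))) (snd \<nu> c)) \<and>
     (\<forall>c. c \<notin> charts_at X (fst \<nu>) \<longrightarrow> snd \<nu> c = 0)"
  unfolding tangent_vectors_def by (cases \<nu>) simp

lemma tangent_pts: "\<nu> \<in> tangent_vectors X \<Longrightarrow> fst \<nu> \<in> pts X"
  unfolding tangent_vectors_iff by blast

lemma tangent_outside: "\<nu> \<in> tangent_vectors X \<Longrightarrow> c \<notin> charts_at X (fst \<nu>) \<Longrightarrow> snd \<nu> c = 0"
  unfolding tangent_vectors_iff by blast

lemma tangent_coord:
  assumes "\<nu> \<in> tangent_vectors X" "c \<in> charts X" "fst \<nu> \<in> fst c" "d \<in> charts X" "fst \<nu> \<in> fst d"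
  shows "snd \<nu> d = frechet_derivative (snd d \<circ> chart_inv c) (at (snd c (fst \<nu>))) (snd \<nu> c)"
proof -
  have "c \<in> charts_at X (fst \<nu>)" "d \<in> charts_at X (fst \<nu>)" using assms by auto
  then show ?thesis using assms(1) unfolding tangent_vectors_iff by blast
qed

text \<open>One coordinate vector fixes those in all charts around the base point through the
  transition maps, and at all other arguments the representation is 0 by convention.\<close>

lemma tangent_eqI:
  assumes \<nu>: "\<nu> \<in> tangent_vectors X" and \<mu>: "\<mu> \<in> tangent_vectors X" and eq: "fst \<nu> = fst \<mu>"
    and c: "c \<in> charts X" "fst \<nu> \<in> fst c" and v: "snd \<nu> c = snd \<mu> c"
  shows "\<nu> = \<mu>"
proof (rule prod_eqI[OF eq], rule ext)
  fix d
  show "snd \<nu> d = snd \<mu> d"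
  proof (cases "d \<in> charts_at X (fst \<nu>)")
    case True
    then have d: "d \<in> charts X" "fst \<nu> \<in> fst d" by auto
    show ?thesis
      using tangent_coord[OF \<nu> c d] tangent_coord[OF \<mu> c(1) _ d(1)] c(2) d(2) eq v by simp
  next
    case False
    then have "snd \<nu> d = 0" "snd \<mu> d = 0"
      using tangent_outside[OF \<nu>] tangent_outside[OF \<mu>] eq by simp_all
    then show ?thesis by simp
  qed
qed

text \<open>The tangent vector whose coordinate in the chart \<open>c\<close> is \<open>v\<close>.
  For fixed \<open>v\<close> and varying \<open>p\<close> it is a coordinate vector field of
  \<open>c\<close>; these fields are the frame in which the metric of the base is expanded.\<close>

definition coord_vec :: "('x, 'b::real_normed_vector) mfd \<Rightarrow> ('x, 'b) chart \<Rightarrow> 'x \<Rightarrow> 'b \<Rightarrow> ('x, 'b) tvec" where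
  "coord_vec X c p v =
     (p, \<lambda>d. if d \<in> charts_at X p then frechet_derivative (snd d \<circ> chart_inv c) (at (snd c p)) v else 0)"

lemma fst_coord_vec [simp]: "fst (coord_vec X c p v) = p"
  by (simp add: coord_vec_def)

lemma coord_vec_tangent:
  assumes X: "smooth_atlas X" and c: "c \<in> charts X" "p \<in> fst c"
  shows "coord_vec X c p v \<in> tangent_vectors X"
  unfolding tangent_vectors_iff
proof (intro conjI ballI allI impI)
  show "fst (coord_vec X c p v) \<in> pts X" using atlas_pts[OF smooth_atlasD(2)[OF X] c] by simp
  fix d e assume "d \<in> charts_at X (fst (coord_vec X c p v))" "e \<in> charts_at X (fst (coord_vec X c p v))"
  then have d: "d \<in> charts X" "p \<in> fst d" and e: "e \<in> charts X" "p \<in> fst e" by auto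
  show "snd (coord_vec X c p v) e =
     frechet_derivative (snd e \<circ> chart_inv d) (at (snd d (fst (coord_vec X c p v)))) (snd (coord_vec X c p v) d)"
    using frechet_derivative_chart_change[OF X smooth_at_chart[OF X e] c d] d e
    by (simp add: coord_vec_def)
qed (auto simp: coord_vec_def)

lemma coord_vec_coord:
  assumes X: "smooth_atlas X" and c: "c \<in> charts X" "p \<in> fst c"
  shows "snd (coord_vec X c p v) c = v"
proof -
  have "frechet_derivative (snd c \<circ> chart_inv c) (at (snd c p)) = frechet_derivative (\<lambda>y. y) (at (snd c p))"
    by (rule frechet_derivative_cong_open(1)[OF smooth_atlasD(3)[OF X c(1)]])
      (use c in \<open>auto simp: f_inv_into_f\<close>)
  then show ?thesis using c by (simp add: coord_vec_def)
qed

lemma coord_vec_eq: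
  assumes X: "smooth_atlas X" and \<nu>: "\<nu> \<in> tangent_vectors X" and c: "c \<in> charts X" "fst \<nu> \<in> fst c"
  shows "coord_vec X c (fst \<nu>) (snd \<nu> c) = \<nu>"
  by (rule tangent_eqI[OF coord_vec_tangent[OF X c] \<nu> _ c(1)]) (simp_all add: coord_vec_coord[OF X c] c)

text \<open>The chart chosen inside \<open>dfun\<close> depends on the base point only, so a single
  one serves all functions and all vectors at that point. Linearity and locality of
  \<open>dfun\<close> then follow without comparing charts.\<close>

lemma dfun_some_chart:
  assumes "atlas X" "fst \<nu> \<in> pts X"
  obtains c where "c \<in> charts X" "fst \<nu> \<in> fst c"
    "\<And>f \<mu>. fst \<mu> = fst \<nu> \<Longrightarrow> dfun X f \<mu> = frechet_derivative (f \<circ> chart_inv c) (at (snd c (fst \<nu>))) (snd \<mu> c)"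
proof -
  let ?c = "SOME c. c \<in> charts_at X (fst \<nu>)"
  have "?c \<in> charts_at X (fst \<nu>)" using atlas_chart[OF assms] by (rule someI_ex)
  then show thesis using that[of ?c] by (simp add: dfun_def Let_def)
qed

lemma dfun_coord:
  assumes X: "smooth_atlas X" and \<nu>: "\<nu> \<in> tangent_vectors X" and f: "smooth_at X model_mfd f (fst \<nu>)"
    and c: "c \<in> charts X" "fst \<nu> \<in> fst c"
  shows "dfun X f \<nu> = frechet_derivative (f \<circ> chart_inv c) (at (snd c (fst \<nu>))) (snd \<nu> c)"
proof -
  obtain d where d: "d \<in> charts X" "fst \<nu> \<in> fst d"
    and *: "dfun X f \<nu> = frechet_derivative (f \<circ> chart_inv d) (at (snd d (fst \<nu>))) (snd \<nu> d)"
    using dfun_some_chart[OF smooth_atlasD(2)[OF X] tangent_pts[OF \<nu>]] by metis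
  show ?thesis
    unfolding * tangent_coord[OF \<nu> d c] by (rule frechet_derivative_chart_change[OF X f d c])
qed

lemma dfun_cong:
  fixes f g :: "'x \<Rightarrow> 'v::real_normed_vector"
  assumes X: "atlas X" and N: "openin (mfd_topology X) N" "fst \<nu> \<in> N"
    and eq: "\<And>q. q \<in> N \<Longrightarrow> f q = g q"
  shows "dfun X f \<nu> = dfun X g \<nu>"
proof -
  have "fst \<nu> \<in> pts X" using N by (auto simp: atlas_openin[OF X])
  then obtain c where c: "c \<in> charts X" "fst \<nu> \<in> fst c"
    and *: "\<And>(f :: 'x \<Rightarrow> 'v) \<mu>. fst \<mu> = fst \<nu> \<Longrightarrow> dfun X f \<mu> = frechet_derivative (f \<circ> chart_inv c) (at (snd c (fst \<nu>))) (snd \<mu> c)"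
    using dfun_some_chart[OF X] by metis
  have "open (snd c ` (fst c \<inter> N))" using N(1) c(1) by (simp add: atlas_openin[OF X])
  then have "frechet_derivative (f \<circ> chart_inv c) (at (snd c (fst \<nu>))) = frechet_derivative (g \<circ> chart_inv c) (at (snd c (fst \<nu>)))"
    by (rule frechet_derivative_cong_open(1)) (use c N eq in \<open>auto simp: atlas_chart_inv[OF X c(1)]\<close>)
  then show ?thesis by (simp add: *)
qed

section \<open>Tangent maps and the chain rule\<close>

lemma fst_tangent_map [simp]: "fst (tangent_map X Y f \<nu>) = f (fst \<nu>)"
  by (simp add: tangent_map_def)

lemma snd_tangent_map:
  "d \<in> charts Y \<Longrightarrow> f (fst \<nu>) \<in> fst d \<Longrightarrow> snd (tangent_map X Y f \<nu>) d = dfun X (snd d \<circ> f) \<nu>"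
  by (simp add: tangent_map_def)

lemma tangent_map_cong:
  fixes Y :: "('y, 'c::real_normed_vector) mfd"
  assumes X: "atlas X" and N: "openin (mfd_topology X) N" "fst \<nu> \<in> N"
    and eq: "\<And>q. q \<in> N \<Longrightarrow> f q = g q"
  shows "tangent_map X Y f \<nu> = tangent_map X Y g \<nu>"
proof -
  have "dfun X (snd d \<circ> f) \<nu> = dfun X (snd d \<circ> g) \<nu>" for d :: "('y, 'c) chart"
    by (rule dfun_cong[OF X N]) (simp add: eq)
  then show ?thesis by (simp only: tangent_map_def eq[OF N(2)])
qed

lemma smooth_at_chart_comp:
  fixes Y :: "('y, 'c::real_inner) mfd"
  assumes X: "atlas X" and Y: "smooth_atlas Y" and f: "smooth_at X Y f p" and d: "d \<in> charts Y" "f p \<in> fst d"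
  shows "smooth_at X model_mfd (snd d \<circ> f) p"
  using smooth_at_compose[OF X smooth_atlasD(2)[OF Y] smooth_atlasD(1)[OF Y] f smooth_at_chart[OF Y d]]
  by (simp add: comp_def)

text \<open>The coordinates of the image in \<open>d\<close> and \<open>e\<close> are related by the
  chain rule for \<open>snd e \<circ> f\<close>, factored through the chart
  \<open>d\<close>.\<close>

lemma tangent_map_tangent:
  assumes X: "smooth_atlas X" and Y: "smooth_atlas Y" and \<nu>: "\<nu> \<in> tangent_vectors X"
    and f: "smooth_at X Y f (fst \<nu>)"
  shows "tangent_map X Y f \<nu> \<in> tangent_vectors Y"
  unfolding tangent_vectors_iff
proof (intro conjI ballI allI impI)
  let ?T = "tangent_map X Y f \<nu>"
  show "fst ?T \<in> pts Y" using f unfolding smooth_at_def by simp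
  fix d e assume "d \<in> charts_at Y (fst ?T)" "e \<in> charts_at Y (fst ?T)"
  then have d: "d \<in> charts Y" "f (fst \<nu>) \<in> fst d" and e: "e \<in> charts Y" "f (fst \<nu>) \<in> fst e" by auto
  obtain c where c: "c \<in> charts X" "fst \<nu> \<in> fst c"
    using atlas_chart[OF smooth_atlasD(2)[OF X] tangent_pts[OF \<nu>]] by blast
  note a = smooth_atlasD(2)[OF X] smooth_atlasD(2)[OF Y]
  have "dfun X (snd e \<circ> f) \<nu> = frechet_derivative (snd e \<circ> f \<circ> chart_inv c) (at (snd c (fst \<nu>))) (snd \<nu> c)"
    by (rule dfun_coord[OF X \<nu> smooth_at_chart_comp[OF a(1) Y f e] c])
  also have "\<dots> = frechet_derivative (snd e \<circ> chart_inv d) (at (snd d (f (fst \<nu>)))) (dfun X (snd d \<circ> f) \<nu>)"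
    unfolding dfun_coord[OF X \<nu> smooth_at_chart_comp[OF a(1) Y f d] c]
    by (rule frechet_derivative_chain[OF a f smooth_at_chart[OF Y e] c d])
  finally show "snd ?T e = frechet_derivative (snd e \<circ> chart_inv d) (at (snd d (fst ?T))) (snd ?T d)"
    using d e by (simp add: snd_tangent_map)
qed (auto simp: tangent_map_def)

lemma dfun_tangent_map:
  assumes X: "smooth_atlas X" and Y: "smooth_atlas Y" and \<nu>: "\<nu> \<in> tangent_vectors X"
    and f: "smooth_at X Y f (fst \<nu>)" and g: "smooth_at Y model_mfd g (f (fst \<nu>))"
  shows "dfun Y g (tangent_map X Y f \<nu>) = dfun X (g \<circ> f) \<nu>"
proof -
  note a = smooth_atlasD(2)[OF X] smooth_atlasD(2)[OF Y]
  obtain c where c: "c \<in> charts X" "fst \<nu> \<in> fst c"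
    using atlas_chart[OF a(1) tangent_pts[OF \<nu>]] by blast
  have "f (fst \<nu>) \<in> pts Y" using f unfolding smooth_at_def by blast
  then obtain d where d: "d \<in> charts Y" "f (fst \<nu>) \<in> fst d"
    using atlas_chart[OF a(2)] by blast
  have gf: "smooth_at X model_mfd (g \<circ> f) (fst \<nu>)"
    using smooth_at_compose[OF a smooth_atlasD(1)[OF Y] f g] by (simp add: comp_def)
  have "dfun Y g (tangent_map X Y f \<nu>) =
      frechet_derivative (g \<circ> chart_inv d) (at (snd d (f (fst \<nu>)))) (dfun X (snd d \<circ> f) \<nu>)"
    using dfun_coord[OF Y tangent_map_tangent[OF X Y \<nu> f] _ d(1)] g d by (simp add: snd_tangent_map)
  also have "\<dots> = frechet_derivative (g \<circ> f \<circ> chart_inv c) (at (snd c (fst \<nu>))) (snd \<nu> c)"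
    unfolding dfun_coord[OF X \<nu> smooth_at_chart_comp[OF a(1) Y f d] c]
    by (rule frechet_derivative_chain[OF a f g c d, symmetric])
  also have "\<dots> = dfun X (g \<circ> f) \<nu>" by (rule dfun_coord[OF X \<nu> gf c, symmetric])
  finally show ?thesis .
qed

lemma tangent_map_compose:
  assumes X: "smooth_atlas X" and Y: "smooth_atlas Y" and Z: "smooth_atlas Z" and \<nu>: "\<nu> \<in> tangent_vectors X"
    and f: "smooth_at X Y f (fst \<nu>)" and g: "smooth_at Y Z g (f (fst \<nu>))"
  shows "tangent_map Y Z g (tangent_map X Y f \<nu>) = tangent_map X Z (\<lambda>x. g (f x)) \<nu>"
proof -
  have "dfun Y (snd d \<circ> g) (tangent_map X Y f \<nu>) = dfun X (snd d \<circ> (\<lambda>x. g (f x))) \<nu>"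
    if "d \<in> charts_at Z (g (f (fst \<nu>)))" for d
    using dfun_tangent_map[OF X Y \<nu> f smooth_at_chart_comp[OF smooth_atlasD(2)[OF Y] Z g]] that
    by (simp add: comp_def)
  then show ?thesis by (auto simp: tangent_map_def fun_eq_iff)
qed

section \<open>Fibrewise linearity in the tangent bundle\<close>

lemma tangent_bundle_simps [simp]:
  "tot_space (tangent_bundle X) = tangent_mfd X" "base_space (tangent_bundle X) = X"
  "proj (tangent_bundle X) = fst"
  "vadd (tangent_bundle X) = (\<lambda>\<nu> \<mu>. (fst \<nu>, \<lambda>c. snd \<nu> c + snd \<mu> c))"
  "vsmul (tangent_bundle X) = (\<lambda>r \<nu>. (fst \<nu>, \<lambda>c. r *\<^sub>R snd \<nu> c))"
  "vzero (tangent_bundle X) = (\<lambda>p. (p, \<lambda>c. 0))"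
  by (simp_all add: tangent_bundle_def)

lemma tangent_mfd_simps [simp]:
  "pts (tangent_mfd X) = tangent_vectors X"
  "charts (tangent_mfd X) =
     (\<lambda>c. ({\<nu> \<in> tangent_vectors X. fst \<nu> \<in> fst c}, \<lambda>\<nu>. (snd c (fst \<nu>), snd \<nu> c))) ` charts X"
  by (simp_all add: tangent_mfd_def)

lemma fibre_tangent_bundle: "\<nu> \<in> fibre (tangent_bundle X) p \<longleftrightarrow> \<nu> \<in> tangent_vectors X \<and> fst \<nu> = p"
  by (simp add: fibre_def)

lemma dfun_add:
  fixes f :: "'x \<Rightarrow> 'v::real_normed_vector"
  assumes X: "atlas X" and p: "fst \<nu> \<in> pts X" "fst \<mu> = fst \<nu>" and f: "smooth_at X model_mfd f (fst \<nu>)"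
  shows "dfun X f (fst \<nu>, \<lambda>c. snd \<nu> c + snd \<mu> c) = dfun X f \<nu> + dfun X f \<mu>"
proof -
  obtain c where c: "c \<in> charts X" "fst \<nu> \<in> fst c"
    and *: "\<And>(f :: 'x \<Rightarrow> 'v) \<mu>. fst \<mu> = fst \<nu> \<Longrightarrow> dfun X f \<mu> = frechet_derivative (f \<circ> chart_inv c) (at (snd c (fst \<nu>))) (snd \<mu> c)"
    using dfun_some_chart[OF X p(1)] by metis
  have "linear (frechet_derivative (f \<circ> chart_inv c) (at (snd c (fst \<nu>))))"
    by (rule linear_frechet_derivative[OF smooth_at_chart_differentiable[OF f c]])
  then show ?thesis using p by (simp add: * linear_add)
qed

lemma dfun_scale:
  fixes f :: "'x \<Rightarrow> 'v::real_normed_vector"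
  assumes X: "atlas X" and p: "fst \<nu> \<in> pts X" and f: "smooth_at X model_mfd f (fst \<nu>)"
  shows "dfun X f (fst \<nu>, \<lambda>c. r *\<^sub>R snd \<nu> c) = r *\<^sub>R dfun X f \<nu>"
proof -
  obtain c where c: "c \<in> charts X" "fst \<nu> \<in> fst c"
    and *: "\<And>(f :: 'x \<Rightarrow> 'v) \<mu>. fst \<mu> = fst \<nu> \<Longrightarrow> dfun X f \<mu> = frechet_derivative (f \<circ> chart_inv c) (at (snd c (fst \<nu>))) (snd \<mu> c)"
    using dfun_some_chart[OF X p(1)] by metis
  have "linear (frechet_derivative (f \<circ> chart_inv c) (at (snd c (fst \<nu>))))"
    by (rule linear_frechet_derivative[OF smooth_at_chart_differentiable[OF f c]])
  then show ?thesis using p by (simp add: * linear_scale)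
qed

lemma dfun_Pair:
  assumes X: "smooth_atlas X" and \<nu>: "\<nu> \<in> tangent_vectors X"
    and f: "smooth_at X model_mfd f (fst \<nu>)" and g: "smooth_at X model_mfd g (fst \<nu>)"
  shows "dfun X (\<lambda>x. (f x, g x)) \<nu> = (dfun X f \<nu>, dfun X g \<nu>)"
proof -
  obtain c where c: "c \<in> charts X" "fst \<nu> \<in> fst c" using atlas_chart[OF smooth_atlasD(2)[OF X] tangent_pts[OF \<nu>]] by blast
  note d = smooth_at_chart_differentiable[OF f c] smooth_at_chart_differentiable[OF g c]
  have "((\<lambda>y. ((f \<circ> chart_inv c) y, (g \<circ> chart_inv c) y)) has_derivative
      (\<lambda>v. (frechet_derivative (f \<circ> chart_inv c) (at (snd c (fst \<nu>))) v,
        frechet_derivative (g \<circ> chart_inv c) (at (snd c (fst \<nu>))) v))) (at (snd c (fst \<nu>)))"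
    by (intro has_derivative_Pair) (use d in \<open>simp_all add: frechet_derivative_works comp_def\<close>)
  from frechet_derivativeI[OF this] show ?thesis
    by (simp add: dfun_coord[OF X \<nu> smooth_at_Pair[OF f g] c] dfun_coord[OF X \<nu> f c] dfun_coord[OF X \<nu> g c] comp_def)
qed

lemma tangent_map_add:
  assumes X: "atlas X" and Y: "smooth_atlas Y" and p: "fst \<nu> \<in> pts X" "fst \<mu> = fst \<nu>"
    and f: "smooth_at X Y f (fst \<nu>)"
  shows "tangent_map X Y f (vadd (tangent_bundle X) \<nu> \<mu>) =
    vadd (tangent_bundle Y) (tangent_map X Y f \<nu>) (tangent_map X Y f \<mu>)"
  using dfun_add[OF X p smooth_at_chart_comp[OF X Y f]] p
  by (auto simp: tangent_map_def fun_eq_iff)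

lemma tangent_map_scale:
  assumes X: "atlas X" and Y: "smooth_atlas Y" and p: "fst \<nu> \<in> pts X"
    and f: "smooth_at X Y f (fst \<nu>)"
  shows "tangent_map X Y f (vsmul (tangent_bundle X) r \<nu>) = vsmul (tangent_bundle Y) r (tangent_map X Y f \<nu>)"
  using dfun_scale[OF X p smooth_at_chart_comp[OF X Y f]]
  by (auto simp: tangent_map_def fun_eq_iff)

lemma tangent_chart_linear:
  assumes X: "smooth_atlas X" and c: "c \<in> charts X" "p \<in> fst c" and d: "d \<in> charts X" "p \<in> fst d"
  shows "linear (frechet_derivative (snd d \<circ> chart_inv c) (at (snd c p)))"
  by (rule linear_frechet_derivative[OF smooth_at_chart_differentiable[OF smooth_at_chart[OF X d] c]])

lemma tangent_scale:
  assumes X: "smooth_atlas X" and \<nu>: "\<nu> \<in> tangent_vectors X"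
  shows "(fst \<nu>, \<lambda>c. r *\<^sub>R snd \<nu> c) \<in> tangent_vectors X"
  unfolding tangent_vectors_iff
proof (intro conjI ballI allI impI; simp)
  show "fst \<nu> \<in> pts X" by (rule tangent_pts[OF \<nu>])
  show "r = 0 \<or> snd \<nu> c = 0" if "c \<in> charts X \<longrightarrow> fst \<nu> \<notin> fst c" for c
    using tangent_outside[OF \<nu>] that by simp
  fix c d assume "c \<in> charts X \<and> fst \<nu> \<in> fst c" "d \<in> charts X \<and> fst \<nu> \<in> fst d"
  then have c: "c \<in> charts X" "fst \<nu> \<in> fst c" and d: "d \<in> charts X" "fst \<nu> \<in> fst d" by auto
  show "r *\<^sub>R snd \<nu> d = frechet_derivative (snd d \<circ> chart_inv c) (at (snd c (fst \<nu>))) (r *\<^sub>R snd \<nu> c)"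
    using tangent_coord[OF \<nu> c d] by (simp add: linear_scale[OF tangent_chart_linear[OF X c d]])
qed

text \<open>Besides a finite-dimensional model, this is what \<open>smooth_at_compose\<close> asks
  of a middle space, so maps can be factored through the tangent manifold.\<close>

lemma atlas_tangent: 
  assumes X: "atlas X"
  shows "atlas (tangent_mfd X)"
  unfolding atlas_def
proof (intro conjI ballI)
  show "(\<Union>c\<in>charts (tangent_mfd X). fst c) = pts (tangent_mfd X)"
    using atlas_chart[OF X] tangent_pts[of _ X] by fastforce
  fix e assume "e \<in> charts (tangent_mfd X)"
  then obtain c where c: "c \<in> charts X"
    and e: "e = ({\<nu> \<in> tangent_vectors X. fst \<nu> \<in> fst c}, \<lambda>\<nu>. (snd c (fst \<nu>), snd \<nu> c))" by auto
  show "inj_on (snd e) (fst e)"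
  proof (rule inj_onI)
    fix \<nu> \<mu> assume "\<nu> \<in> fst e" "\<mu> \<in> fst e" and eq: "snd e \<nu> = snd e \<mu>"
    then have m: "\<nu> \<in> tangent_vectors X" "fst \<nu> \<in> fst c" "\<mu> \<in> tangent_vectors X" "fst \<mu> \<in> fst c"
      by (auto simp: e)
    have "fst \<nu> = fst \<mu>" using atlas_inj[OF X c m(2,4)] eq by (simp add: e)
    then show "\<nu> = \<mu>" using tangent_eqI[OF m(1,3) _ c m(2)] eq by (simp add: e)
  qed
qed

text \<open>In the tangent chart over \<open>c\<close> the function sends \<open>(y, v)\<close> to
  the derivative of the local expression of \<open>f\<close> at \<open>y\<close> in direction
  \<open>v\<close>, and this is jointly smooth.\<close>

lemma smooth_at_dfun:
  fixes X :: "('x, 'b::real_inner) mfd"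
  assumes X: "smooth_atlas X" and \<nu>: "\<nu> \<in> tangent_vectors X" and f: "smooth_at X model_mfd f (fst \<nu>)"
  shows "smooth_at (tangent_mfd X) model_mfd (dfun X f) \<nu>"
  unfolding smooth_at_model_iff
proof
  fix e assume e': "e \<in> charts_at (tangent_mfd X) \<nu>"
  then obtain c where c: "c \<in> charts X" "fst \<nu> \<in> fst c"
    and e: "e = ({\<nu> \<in> tangent_vectors X. fst \<nu> \<in> fst c}, \<lambda>\<nu>. (snd c (fst \<nu>), snd \<nu> c))" by auto
  obtain T where T: "open T" "snd c (fst \<nu>) \<in> T" "T \<subseteq> snd c ` fst c" "smooth_on (\<lambda>y. f (chart_inv c y)) T"
    using f c unfolding smooth_at_model_iff by blast
  have o: "open (T \<times> (UNIV::'b set))" using T(1) by (simp add: open_Times)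
  \<comment> \<open>Every pair over \<open>T\<close> is the coordinate of a tangent vector, so
    \<open>T \<times> UNIV\<close> lies in the image of the tangent chart.\<close>
  have *: "\<exists>\<mu>. \<mu> \<in> tangent_vectors X \<and> fst \<mu> \<in> fst c \<and> snd c (fst \<mu>) = y \<and> snd \<mu> c = v" if y: "y \<in> T" for y v :: 'b
  proof -
    obtain q where q: "q \<in> fst c" "y = snd c q" using T(3) y by blast
    show ?thesis
      using coord_vec_tangent[OF X c(1) q(1)] coord_vec_coord[OF X c(1) q(1)] q
      by (intro exI[of _ "coord_vec X c q v"]) simp
  qed
  have "smooth_on (\<lambda>(y, v). frechet_derivative (\<lambda>y. f (chart_inv c y)) (at y) v) (T \<times> (UNIV::'b set))"
    by (rule smooth_on_derivative[OF smooth_atlasD(1)[OF X] T(1,4)])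
  then have "smooth_on (\<lambda>z. dfun X f (chart_inv e z)) (T \<times> UNIV)"
  proof (rule smooth_on_cong[OF o, THEN iffD2, rotated])
    fix z assume z: "z \<in> T \<times> (UNIV::'b set)"
    obtain \<mu> where \<mu>: "\<mu> \<in> tangent_vectors X" "fst \<mu> \<in> fst c" "snd c (fst \<mu>) = fst z" "snd \<mu> c = snd z"
      using * z by force
    have "e \<in> charts (tangent_mfd X)" using e' by simp
    from atlas_chart_inv[OF atlas_tangent[OF smooth_atlasD(2)[OF X]] this, of \<mu>] \<mu>
    have ez: "chart_inv e z = \<mu>" by (simp add: e)
    \<comment> \<open>Evaluating \<open>dfun\<close> in \<open>c\<close> requires smoothness at the
      base point of \<open>\<mu>\<close>, which may differ from that of \<open>\<nu>\<close>; the
      local expression is smooth on all of \<open>T\<close>.\<close>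
    have "smooth_at X model_mfd f (fst \<mu>)"
      by (rule smooth_at_model_chartI[OF X c(1) \<mu>(2) T(1) _ T(4)]) (use z \<mu>(3) in auto)
    from dfun_coord[OF X \<mu>(1) this c(1) \<mu>(2)] \<mu>
    show "dfun X f (chart_inv e z) = (case z of (y, v) \<Rightarrow> frechet_derivative (\<lambda>y. f (chart_inv c y)) (at y) v)"
      by (simp add: ez comp_def split_beta)
  qed
  moreover have "T \<times> UNIV \<subseteq> snd e ` fst e"
  proof
    fix z assume "z \<in> T \<times> (UNIV::'b set)"
    then obtain \<mu> where "\<mu> \<in> tangent_vectors X" "fst \<mu> \<in> fst c" "snd c (fst \<mu>) = fst z" "snd \<mu> c = snd z"
      using * by force
    then show "z \<in> snd e ` fst e" by (intro image_eqI[of _ _ \<mu>]) (auto simp: e)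
  qed
  moreover have "snd e \<nu> \<in> T \<times> UNIV" using T(2) by (simp add: e)
  ultimately show "\<exists>T. open T \<and> snd e \<nu> \<in> T \<and> T \<subseteq> snd e ` fst e \<and> smooth_on (\<lambda>y. dfun X f (chart_inv e y)) T"
    using o by (intro exI[of _ "T \<times> UNIV"] conjI)
qed

text \<open>A tangent chart records base and vector coordinates, so these may be checked separately.
  Tangency on the neighbourhood \<open>N\<close> is what puts nearby values into the chart
  domain.\<close>

lemma smooth_at_into_tangent:
  assumes X: "atlas X" and N: "openin (mfd_topology X) N" "p \<in> N"
    and s: "\<And>q. q \<in> N \<Longrightarrow> s q \<in> tangent_vectors Y"
    and s1: "smooth_at X Y (\<lambda>q. fst (s q)) p"
    and s2: "\<And>d. d \<in> charts Y \<Longrightarrow> fst (s p) \<in> fst d \<Longrightarrow> smooth_at X model_mfd (\<lambda>q. snd (s q) d) p"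
  shows "smooth_at X (tangent_mfd Y) s p"
proof (rule smooth_atI)
  show "s p \<in> pts (tangent_mfd Y)" using s N(2) by simp
  fix c e assume c: "c \<in> charts X" "p \<in> fst c" and "e \<in> charts (tangent_mfd Y)" "s p \<in> fst e"
  then obtain d where d: "d \<in> charts Y" "fst (s p) \<in> fst d"
    and e: "e = ({\<nu> \<in> tangent_vectors Y. fst \<nu> \<in> fst d}, \<lambda>\<nu>. (snd d (fst \<nu>), snd \<nu> d))" by auto
  obtain T where T: "open T" "snd c p \<in> T" "T \<subseteq> snd c ` (fst c \<inter> (\<lambda>q. fst (s q)) -` fst d)"
    "smooth_on (snd d \<circ> (\<lambda>q. fst (s q)) \<circ> chart_inv c) T"
    by (rule smooth_atE[OF s1 c d])
  obtain S where S: "open S" "snd c p \<in> S" "S \<subseteq> snd c ` fst c" "smooth_on (\<lambda>y. snd (s (chart_inv c y)) d) S"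
    using s2[OF d] c unfolding smooth_at_model_iff by blast
  let ?T = "T \<inter> S \<inter> snd c ` (fst c \<inter> N)"
  have o: "open ?T" using T(1) S(1) N(1) c(1) by (auto simp: atlas_openin[OF X])
  have "smooth_on (\<lambda>y. ((snd d \<circ> (\<lambda>q. fst (s q)) \<circ> chart_inv c) y, snd (s (chart_inv c y)) d)) ?T"
    by (rule smooth_on_Pair[OF o smooth_on_subset[OF T(4)] smooth_on_subset[OF S(4)]]) auto
  then have "smooth_on (snd e \<circ> s \<circ> chart_inv c) ?T" by (simp add: e comp_def)
  moreover have "?T \<subseteq> snd c ` (fst c \<inter> s -` fst e)"
  proof
    fix y assume y: "y \<in> ?T"
    then obtain q where q: "q \<in> fst c" "q \<in> N" "y = snd c q" by blast
    obtain q' where q': "q' \<in> fst c" "fst (s q') \<in> fst d" "y = snd c q'" using y T(3) by blast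
    then have "q = q'" using atlas_inj[OF X c(1)] q by metis
    then show "y \<in> snd c ` (fst c \<inter> s -` fst e)" using q q' s[OF q(2)] by (auto simp: e)
  qed
  moreover have "snd c p \<in> ?T" using T(2) S(2) c(2) N(2) by auto
  ultimately show "\<exists>T. open T \<and> snd c p \<in> T \<and> T \<subseteq> snd c ` (fst c \<inter> s -` fst e) \<and>
      smooth_on (snd e \<circ> s \<circ> chart_inv c) T" using o by (intro exI[of _ ?T] conjI)
qed

text \<open>The coordinate in another chart \<open>d\<close> is the derivative of the transition map
  in the constant direction \<open>v\<close>.\<close>

lemma smooth_at_coord_vec:
  fixes X :: "('x, 'b::real_inner) mfd"
  assumes X: "smooth_atlas X" and c: "c \<in> charts X" "p \<in> fst c"
  shows "smooth_at X (tangent_mfd X) (\<lambda>q. coord_vec X c q v) p"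
proof (rule smooth_at_into_tangent)
  note a = smooth_atlasD(2)[OF X]
  show "atlas X" "openin (mfd_topology X) (fst c)" "p \<in> fst c"
    using a openin_chart_domain[OF X c(1)] c by auto
  show "coord_vec X c q v \<in> tangent_vectors X" if "q \<in> fst c" for q
    by (rule coord_vec_tangent[OF X c(1) that])
  show "smooth_at X X (\<lambda>q. fst (coord_vec X c q v)) p"
    using smooth_at_id[OF X atlas_pts[OF a c]] by simp
  fix d assume d: "d \<in> charts X" "fst (coord_vec X c p v) \<in> fst d"
  let ?S = "snd c ` (fst c \<inter> fst d)"
  have "smooth_at model_mfd model_mfd (\<lambda>y. frechet_derivative (snd d \<circ> chart_inv c) (at y) v) (snd c p)"
    unfolding smooth_at_model_model_iff
    using smooth_atlasD(4)[OF X c(1) d(1)] smooth_on_frechet[OF smooth_atlasD(5)[OF X c(1) d(1)]] c d(2)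
    by (intro exI[of _ ?S]) auto
  then have "smooth_at X model_mfd (\<lambda>q. frechet_derivative (snd d \<circ> chart_inv c) (at (snd c q)) v) p"
    by (rule smooth_at_compose[OF a atlas_model smooth_atlasD(1)[OF X] smooth_at_chart[OF X c]])
  then show "smooth_at X model_mfd (\<lambda>q. snd (coord_vec X c q v) d) p"
    by (rule smooth_at_cong[OF a openin_chart_domain[OF X d(1)], rotated 2])
      (use d in \<open>auto simp: coord_vec_def\<close>)
qed

text \<open>The vector \<open>d/dt\<close> at 0 on the line; the case distinction follows the
  convention that vectors vanish outside the atlas. Velocities of curves are its images under
  tangent maps, which opens them to the chain rule.\<close>

definition unit_tangent :: "(real, real) tvec" where
  "unit_tangent = (0, \<lambda>c. if c = (UNIV, \<lambda>x. x) then 1 else 0)"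

lemma unit_tangent: "unit_tangent \<in> tangent_vectors model_mfd" "fst unit_tangent = 0"
  by (auto simp: tangent_vectors_iff unit_tangent_def comp_def)

lemma dfun_unit_tangent:
  assumes "f differentiable (at 0)"
  shows "dfun model_mfd f unit_tangent = vector_derivative f (at 0)"
proof -
  have "(SOME c. c = (UNIV, \<lambda>x. x) \<and> fst unit_tangent \<in> fst c) = ((UNIV, \<lambda>x. x) :: (real, real) chart)"
    by (rule some_equality) auto
  then have "dfun model_mfd f unit_tangent = frechet_derivative f (at 0) 1"
    by (simp add: dfun_def comp_def) (simp add: unit_tangent_def)
  then show ?thesis using frechet_derivative_eq_vector_derivative[OF assms] by simp
qed

lemma velocity_eq_tangent_map:
  assumes X: "smooth_atlas X" and \<gamma>: "smooth_at model_mfd X \<gamma> 0"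
  shows "velocity X \<gamma> = tangent_map model_mfd X \<gamma> unit_tangent"
proof -
  have "vector_derivative (snd c \<circ> \<gamma>) (at 0) = dfun model_mfd (snd c \<circ> \<gamma>) unit_tangent"
    if "c \<in> charts_at X (\<gamma> 0)" for c
  proof (rule dfun_unit_tangent[symmetric])
    have "smooth_at model_mfd model_mfd (snd c \<circ> \<gamma>) 0"
      using smooth_at_chart_comp[OF atlas_model X \<gamma>] that by simp
    then show "(snd c \<circ> \<gamma>) differentiable (at 0)"
      unfolding smooth_at_model_model_iff using smooth_on_differentiable by blast
  qed
  then show ?thesis by (auto simp: velocity_def tangent_map_def unit_tangent(2) fun_eq_iff)
qed

section \<open>Vector bundles and vertical lifts\<close>

lemma bundle_metricD:
  assumes "bundle_metric V g" "x \<in> pts (base_space V)" "e \<in> fibre V x" "e' \<in> fibre V x"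
  shows "g e e' = g e' e"
    and "e'' \<in> fibre V x \<Longrightarrow> g (vadd V e e') e'' = g e e'' + g e' e''"
    and "g (vsmul V r e) e' = r * g e e'"
    and "e \<noteq> vzero V x \<Longrightarrow> g e e > 0"
proof -
  note B = assms(1)[unfolded bundle_metric_def, THEN conjunct1, rule_format, OF assms(2)]
  show "g e e' = g e' e"
    and "e'' \<in> fibre V x \<Longrightarrow> g (vadd V e e') e'' = g e e'' + g e' e''"
    and "g (vsmul V r e) e' = r * g e e'"
    and "e \<noteq> vzero V x \<Longrightarrow> g e e > 0"
    using B assms(3,4) by simp_all
qed

lemma smooth_at_const_point:
  assumes X: "smooth_atlas X" and y: "y \<in> pts Y"
  shows "smooth_at X Y (\<lambda>x. y) p"
proof (rule smooth_atI)
  fix c d assume c: "c \<in> charts X" "p \<in> fst c" and d: "d \<in> charts Y" "y \<in> fst d"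
  have "smooth_on (snd d \<circ> (\<lambda>x. y) \<circ> chart_inv c) (snd c ` fst c)"
    by (simp add: comp_def smooth_on_const)
  then show "\<exists>T. open T \<and> snd c p \<in> T \<and> T \<subseteq> snd c ` (fst c \<inter> (\<lambda>x. y) -` fst d) \<and>
      smooth_on (snd d \<circ> (\<lambda>x. y) \<circ> chart_inv c) T"
    using smooth_atlasD(3)[OF X c(1)] c(2) d(2)
    by (intro exI[of _ "snd c ` fst c"]) auto
qed (rule y)

text \<open>
  A bundle metric is only known to be smooth along sections over the base. Expanding it in a local
  frame \<open>L\<close> makes it smooth along the map \<open>q\<close> as well.
\<close>

lemma smooth_at_metric_frame:
  fixes V :: "('e, 'c::real_normed_vector, 'm, 'b::real_inner) vbundle"
    and X :: "('x, 'a::real_inner) mfd" and L :: "'m \<Rightarrow> 'v::real_inner \<Rightarrow> 'e"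
  assumes X: "smooth_atlas X" and M: "smooth_atlas (base_space V)" and g: "bundle_metric V g"
    and W: "openin (mfd_topology (base_space V)) W" and fd: "findim TYPE('v)"
    and L: "\<And>x v. x \<in> W \<Longrightarrow> L x v \<in> fibre V x"
    and L_add: "\<And>x v w. x \<in> W \<Longrightarrow> L x (v + w) = vadd V (L x v) (L x w)"
    and L_scale: "\<And>x v r. x \<in> W \<Longrightarrow> L x (r *\<^sub>R v) = vsmul V r (L x v)"
    and L_smooth: "\<And>x v. x \<in> W \<Longrightarrow> smooth_at (base_space V) (tot_space V) (\<lambda>x. L x v) x"
    and q: "smooth_at X (base_space V) q p"
    and N: "openin (mfd_topology X) N" "p \<in> N" "\<And>y. y \<in> N \<Longrightarrow> q y \<in> W"
    and f: "smooth_at X model_mfd f p" and h: "smooth_at X model_mfd h p"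
  shows "smooth_at X model_mfd (\<lambda>y. g (L (q y) (f y)) (L (q y) (h y))) p"
proof -
  let ?M = "base_space V"
  note aX = smooth_atlasD(2)[OF X] and aM = smooth_atlasD(2)[OF M]
  have WM: "W \<subseteq> pts ?M" using W by (simp add: atlas_openin[OF aM])
  obtain B :: "'v set" where B: "finite B" "\<And>w. (\<Sum>b\<in>B. (w \<bullet> b) *\<^sub>R b) = w"
    using findim_basis[OF fd] by blast
  have bil: "bilinear (\<lambda>v w. g (L x v) (L x w))" if x: "x \<in> W" for x
  proof -
    have xM: "x \<in> pts ?M" using WM x by blast
    note gD = bundle_metricD[OF g xM L[OF x] L[OF x]]
    have 1: "g (L x (v + v')) (L x w) = g (L x v) (L x w) + g (L x v') (L x w)" for v v' w
      unfolding L_add[OF x] by (rule gD(2)[OF L[OF x]])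
    have 2: "g (L x (r *\<^sub>R v)) (L x w) = r * g (L x v) (L x w)" for r v w
      unfolding L_scale[OF x] by (rule gD(3))
    have 3: "g (L x v) (L x w) = g (L x w) (L x v)" for v w by (rule gD(1))
    show ?thesis
      unfolding bilinear_def
    proof (intro conjI allI linearI)
      fix v w w' r
      show "g (L x v) (L x (w + w')) = g (L x v) (L x w) + g (L x v) (L x w')"
        unfolding 3[of v] by (rule 1)
      show "g (L x v) (L x (r *\<^sub>R w)) = r *\<^sub>R g (L x v) (L x w)"
        unfolding 3[of v] real_scaleR_def by (rule 2)
    qed (simp_all add: 1 2)
  qed
  \<comment> \<open>For fixed \<open>v\<close> the frame gives sections over the base, so the
    smoothness clause of the metric applies and yields smooth coefficients on \<open>W\<close>,
    which are then composed with \<open>q\<close>.\<close>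
  have sec: "local_section V W (\<lambda>x. L x v)" for v
  proof -
    have "smooth_map (open_submfd ?M W) (tot_space V) (\<lambda>x. L x v)"
      unfolding smooth_map_iff_smooth_at[OF atlas_open_submfd[OF aM]]
      by (simp add: smooth_at_open_submfd_iff[OF aM W] L_smooth)
    then show ?thesis unfolding local_section_def using L by (simp add: fibre_def)
  qed
  have smooth_g: "smooth_at ?M model_mfd (\<lambda>x. g (L x b) (L x c)) x" if "x \<in> W" for x b c
  proof -
    have "smooth_map (open_submfd ?M W) model_mfd (\<lambda>x. g (L x b) (L x c))"
      using g[unfolded bundle_metric_def, THEN conjunct2, rule_format, OF conjI[OF W conjI[OF sec sec]]] .
    from smooth_mapD[OF this atlas_open_submfd[OF aM], of x]
    show ?thesis using that WM by (auto simp: smooth_at_open_submfd_iff[OF aM W that])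
  qed
  have "smooth_at X model_mfd (\<lambda>y. \<Sum>b\<in>B. \<Sum>c\<in>B. (f y \<bullet> b) * ((h y \<bullet> c) * g (L (q y) b) (L (q y) c))) p"
  proof (intro smooth_at_sum[OF X] smooth_at_mult)
    fix b c
    show "smooth_at X model_mfd (\<lambda>y. f y \<bullet> b) p" "smooth_at X model_mfd (\<lambda>y. h y \<bullet> c) p"
      by (rule smooth_at_linear[OF bounded_linear_inner_left f] smooth_at_linear[OF bounded_linear_inner_left h])+
    show "smooth_at X model_mfd (\<lambda>y. g (L (q y) b) (L (q y) c)) p"
      by (rule smooth_at_compose[OF aX aM smooth_atlasD(1)[OF M] q smooth_g[OF N(3)[OF N(2)]]])
  qed
  then show ?thesis
  proof (rule smooth_at_cong[OF aX N(1,2), rotated])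
    fix y assume "y \<in> N"
    from bilinear_expand[OF B bil[OF N(3)[OF this]], of "f y" "h y"]
    show "(\<Sum>b\<in>B. \<Sum>c\<in>B. (f y \<bullet> b) * ((h y \<bullet> c) * g (L (q y) b) (L (q y) c))) =
       g (L (q y) (f y)) (L (q y) (h y))" by simp
  qed
qed

text \<open>The inverse of a local trivialization, curried. The domain is written as in
  \<open>open_submfd\<close>, so that this is the very inverse whose smoothness
  \<open>diffeomorphism\<close> asserts.\<close>

definition triv_inv ::
  "('e, 'c::real_normed_vector, 'm, 'b) vbundle \<Rightarrow> 'm set \<Rightarrow> ('e \<Rightarrow> 'f) \<Rightarrow> 'm \<Rightarrow> 'f \<Rightarrow> 'e" where
  "triv_inv V U \<Phi> x v = inv_into (pts (tot_space V) \<inter> proj V -` U) (\<lambda>e. (proj V e, \<Phi> e)) (x, v)"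

locale smooth_vector_bundle =
  fixes V :: "('e, 'b::real_inner \<times> 'f::real_inner, 'm, 'b) vbundle"
  assumes vector_bundle: "vector_bundle V"
begin

abbreviation "E \<equiv> tot_space V"
abbreviation "M \<equiv> base_space V"

lemma E: "smooth_atlas E" and M: "smooth_atlas M"
  using vector_bundle smooth_manifold_atlas unfolding vector_bundle_def by auto

lemmas aE = smooth_atlasD(2)[OF E] and aM = smooth_atlasD(2)[OF M]

lemma proj_smooth_map: "smooth_map E M (proj V)"
  using vector_bundle unfolding vector_bundle_def by blast

lemma proj_smooth: "e \<in> pts E \<Longrightarrow> smooth_at E M (proj V) e"
  by (rule smooth_mapD[OF proj_smooth_map aE])

lemma proj_pts: "e \<in> pts E \<Longrightarrow> proj V e \<in> pts M"
  using proj_smooth_map unfolding smooth_map_def by blast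

lemma fibre_proj: "e \<in> pts E \<Longrightarrow> e \<in> fibre V (proj V e)"
  by (simp add: fibre_def)

lemma fibre_ops:
  assumes "e \<in> fibre V x"
  shows "x \<in> pts M" "e' \<in> fibre V x \<Longrightarrow> vadd V e e' \<in> fibre V x" "vsmul V r e \<in> fibre V x"
proof -
  show x: "x \<in> pts M" using assms proj_pts by (auto simp: fibre_def)
  show "e' \<in> fibre V x \<Longrightarrow> vadd V e e' \<in> fibre V x" "vsmul V r e \<in> fibre V x"
    using vector_bundle assms x unfolding vector_bundle_def by blast+
qed

lemma vzero_fibre: "x \<in> pts M \<Longrightarrow> vzero V x \<in> fibre V x"
  using vector_bundle unfolding vector_bundle_def by blast

lemma trivialization:
  assumes "x \<in> pts M"
  obtains U and \<Phi> :: "'e \<Rightarrow> 'f" where "x \<in> U" "local_trivialization V U \<Phi>"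
  using vector_bundle assms unfolding vector_bundle_def by blast

context
  fixes U \<Phi>
  assumes triv: "local_trivialization V U (\<Phi> :: 'e \<Rightarrow> 'f)"
begin

lemma triv_open: "openin (mfd_topology M) U"
  using triv unfolding local_trivialization_def by blast

lemma triv_subset: "U \<subseteq> pts M"
  using triv_open by (simp add: atlas_openin[OF aM])

lemma triv_bij: "bij_betw (\<lambda>e. (proj V e, \<Phi> e)) (pts E \<inter> proj V -` U) ((pts M \<inter> U) \<times> UNIV)"
  using triv unfolding local_trivialization_def diffeomorphism_def by simp

lemma triv_linear:
  assumes "e \<in> fibre V x" "x \<in> U"
  shows "\<Phi> (vzero V x) = 0" "e' \<in> fibre V x \<Longrightarrow> \<Phi> (vadd V e e') = \<Phi> e + \<Phi> e'"
    "\<Phi> (vsmul V r e) = r *\<^sub>R \<Phi> e"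
  using triv assms unfolding local_trivialization_def by blast+

lemma triv_inv_triv:
  assumes "e \<in> fibre V x" "x \<in> U"
  shows "triv_inv V U \<Phi> x (\<Phi> e) = e"
proof -
  have "e \<in> pts E \<inter> proj V -` U" "proj V e = x" using assms by (auto simp: fibre_def)
  then show ?thesis
    using inv_into_f_f[OF bij_betw_imp_inj_on[OF triv_bij], of e] by (simp add: triv_inv_def)
qed

lemma triv_triv_inv:
  assumes "x \<in> U"
  shows "triv_inv V U \<Phi> x v \<in> fibre V x" "\<Phi> (triv_inv V U \<Phi> x v) = v"
proof -
  have "(x, v) \<in> (\<lambda>e. (proj V e, \<Phi> e)) ` (pts E \<inter> proj V -` U)"
    using bij_betw_imp_surj_on[OF triv_bij] assms triv_subset by auto
  then obtain e where "e \<in> fibre V x" "v = \<Phi> e" by (auto simp: fibre_def)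
  then show "triv_inv V U \<Phi> x v \<in> fibre V x" "\<Phi> (triv_inv V U \<Phi> x v) = v"
    using triv_inv_triv assms by simp_all
qed

text \<open>Linearity of \<open>\<Phi>\<close> on the fibre passes to its inverse.\<close>

lemma triv_inv_linear:
  assumes "x \<in> U"
  shows "triv_inv V U \<Phi> x (v + w) = vadd V (triv_inv V U \<Phi> x v) (triv_inv V U \<Phi> x w)"
    and "triv_inv V U \<Phi> x (r *\<^sub>R v) = vsmul V r (triv_inv V U \<Phi> x v)"
    and "triv_inv V U \<Phi> x 0 = vzero V x"
proof -
  let ?P = "triv_inv V U \<Phi> x"
  note P = triv_triv_inv[OF assms]
  show "?P (v + w) = vadd V (?P v) (?P w)"
    using triv_inv_triv[OF fibre_ops(2)[OF P(1) P(1)] assms, of v w]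
    by (simp add: triv_linear(2)[OF P(1) assms P(1)] P(2))
  show "?P (r *\<^sub>R v) = vsmul V r (?P v)"
    using triv_inv_triv[OF fibre_ops(3)[OF P(1)] assms, of r v]
    by (simp add: triv_linear(3)[OF P(1) assms] P(2))
  show "?P 0 = vzero V x"
    using triv_inv_triv[OF vzero_fibre assms] triv_linear(1)[OF P(1) assms] triv_subset assms by auto
qed

lemma triv_smooth:
  assumes e: "e \<in> pts E" "proj V e \<in> U"
  shows "smooth_at E model_mfd \<Phi> e"
proof -
  let ?W = "pts E \<inter> proj V -` U"
  have oW: "openin (mfd_topology E) ?W"
    by (rule smooth_map_open_vimage[OF aE aM proj_smooth_map triv_open])
  have sm: "smooth_map (open_submfd E (proj V -` U)) (prod_mfd (open_submfd M U) model_mfd) (\<lambda>e. (proj V e, \<Phi> e))"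
    using triv unfolding local_trivialization_def diffeomorphism_def by blast
  \<comment> \<open>The bare preimage of \<open>U\<close> may contain elements outside
    \<open>pts E\<close> and so fail to be open in \<open>E\<close>. Chart domains lie in
    \<open>pts E\<close>, so both sets cut out the same submanifold.\<close>
  have eq: "open_submfd E (proj V -` U) = open_submfd E ?W"
  proof -
    have "fst c \<inter> proj V -` U = fst c \<inter> ?W" if "c \<in> charts E" for c
      using atlas_pts[OF aE that] by blast
    then show ?thesis unfolding open_submfd_def by (auto intro!: image_cong)
  qed
  have "smooth_at (open_submfd E ?W) (prod_mfd (open_submfd M U) model_mfd) (\<lambda>e. (proj V e, \<Phi> e)) e"
    by (rule smooth_mapD[OF sm[unfolded eq] atlas_open_submfd[OF aE]]) (use e in simp)
  then have "smooth_at E (prod_mfd (open_submfd M U) model_mfd) (\<lambda>e. (proj V e, \<Phi> e)) e"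
    using e by (simp add: smooth_at_open_submfd_iff[OF aE oW])
  from smooth_at_snd_prod[OF atlas_open_submfd[OF aM] this] show ?thesis by simp
qed

text \<open>Stated along arbitrary smooth maps \<open>q\<close> and \<open>f\<close> so that frame
  sections, the zero section, vertical curves and local parametrizations of \<open>E\<close> are all
  instances.\<close>

lemma triv_inv_smooth:
  fixes X :: "('x, 'a::real_inner) mfd"
  assumes X: "atlas X" and q: "smooth_at X M q p" "q p \<in> U" and f: "smooth_at X model_mfd f p"
  shows "smooth_at X E (\<lambda>y. triv_inv V U \<Phi> (q y) (f y)) p"
proof -
  let ?P = "prod_mfd (open_submfd M U) model_mfd :: ('m \<times> 'f, 'b \<times> 'f) mfd"
  have aP: "atlas ?P" by (rule atlas_prod[OF atlas_open_submfd[OF aM] atlas_model])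
  have "smooth_map ?P (open_submfd E (proj V -` U))
      (inv_into (pts (open_submfd E (proj V -` U))) (\<lambda>e. (proj V e, \<Phi> e)))"
    using triv unfolding local_trivialization_def diffeomorphism_def by blast
  then have "smooth_map ?P (open_submfd E (proj V -` U)) (\<lambda>z. triv_inv V U \<Phi> (fst z) (snd z))"
    by (simp add: triv_inv_def[abs_def])
  from smooth_mapD[OF this aP, of "(q p, f p)"]
  have "smooth_at ?P (open_submfd E (proj V -` U)) (\<lambda>z. triv_inv V U \<Phi> (fst z) (snd z)) (q p, f p)"
    using q triv_subset by auto
  then have P: "smooth_at ?P E (\<lambda>z. triv_inv V U \<Phi> (fst z) (snd z)) (q p, f p)"
    by (rule smooth_at_into_open_submfdD)
  have "smooth_at X ?P (\<lambda>y. (q y, f y)) p"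
    by (rule smooth_at_pair_prod[OF X smooth_at_into_open_submfdI[OF X aM triv_open q(2,1)] f])
  from smooth_at_compose[OF X aP smooth_atlasD(1)[OF E] this P] show ?thesis by simp
qed

end

text \<open>\<open>vector_bundle\<close> demands of the operations that they preserve fibres; vector
  space laws such as this one are carried over from the model fibre by a trivialization.\<close>

lemma vsmul_0: 
  assumes "e \<in> fibre V x"
  shows "vsmul V 0 e = vzero V x"
proof -
  have x: "x \<in> pts M" using fibre_ops(1)[OF assms] .
  obtain U and \<Phi> :: "'e \<Rightarrow> 'f" where U: "x \<in> U" "local_trivialization V U \<Phi>" using trivialization[OF x] .
  have "\<Phi> (vsmul V 0 e) = \<Phi> (vzero V x)"
    using triv_linear[OF U(2) assms U(1)] by simp
  then show ?thesis
    using triv_inv_triv[OF U(2) fibre_ops(3)[OF assms] U(1)] triv_inv_triv[OF U(2) vzero_fibre[OF x] U(1)]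
    by metis
qed

lemma vzero_smooth:
  assumes x: "x \<in> pts M"
  shows "smooth_at M E (vzero V) x"
proof -
  obtain U and \<Phi> :: "'e \<Rightarrow> 'f" where U: "x \<in> U" "local_trivialization V U \<Phi>" using trivialization[OF x] .
  have "smooth_at M E (\<lambda>x. triv_inv V U \<Phi> x 0) x"
    by (rule triv_inv_smooth[OF U(2) aM smooth_at_id[OF M x] U(1) smooth_at_const[OF M]])
  then show ?thesis
    by (rule smooth_at_cong[OF aM triv_open[OF U(2)] U(1), rotated]) (rule triv_inv_linear(3)[OF U(2)])
qed

section \<open>The derivative of the projection and vertical vectors\<close>

abbreviation D :: "('e, 'b \<times> 'f) tvec \<Rightarrow> ('m, 'b) tvec" where
  "D \<equiv> tangent_map E M (proj V)"

lemma D_tangent: "\<nu> \<in> tangent_vectors E \<Longrightarrow> D \<nu> \<in> tangent_vectors M"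
  by (rule tangent_map_tangent[OF E M _ proj_smooth[OF tangent_pts]])

lemma D_add:
  "\<nu> \<in> tangent_vectors E \<Longrightarrow> fst \<mu> = fst \<nu> \<Longrightarrow>
     D (vadd (tangent_bundle E) \<nu> \<mu>) = vadd (tangent_bundle M) (D \<nu>) (D \<mu>)"
  by (rule tangent_map_add[OF aE M tangent_pts _ proj_smooth[OF tangent_pts]])

lemma D_scale:
  "\<nu> \<in> tangent_vectors E \<Longrightarrow> D (vsmul (tangent_bundle E) r \<nu>) = vsmul (tangent_bundle M) r (D \<nu>)"
  by (rule tangent_map_scale[OF aE M tangent_pts proj_smooth[OF tangent_pts]])

text \<open>
  A local trivialization together with a chart of the base factors a chart of the total space near
  the base point, so the derivatives of \<open>proj V\<close> and \<open>\<Phi>\<close> determine a tangent vector.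
\<close>

lemma tangent_eq_triv:
  assumes \<nu>: "\<nu> \<in> tangent_vectors E" and \<mu>: "\<mu> \<in> tangent_vectors E" and eq: "fst \<nu> = fst \<mu>"
    and U: "local_trivialization V U \<Phi>" "proj V (fst \<nu>) \<in> U"
    and D: "D \<nu> = D \<mu>" and \<Phi>: "dfun E \<Phi> \<nu> = dfun E \<Phi> \<mu>"
  shows "\<nu> = \<mu>"
proof -
  define e where "e = fst \<nu>"
  have e: "e \<in> pts E" "proj V e \<in> U" using tangent_pts[OF \<nu>] U(2) by (auto simp: e_def)
  obtain c where c: "c \<in> charts E" "e \<in> fst c" using atlas_chart[OF aE e(1)] by blast
  obtain a where a: "a \<in> charts M" "proj V e \<in> fst a" using atlas_chart[OF aM proj_pts[OF e(1)]] by blast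
  \<comment> \<open>\<open>F\<close> is the product coordinate system made of the chart
    \<open>a\<close> of the base and the fibre coordinate \<open>\<Phi>\<close>, and
    \<open>H\<close> undoes it near \<open>e\<close>.\<close>
  define F where "F = (\<lambda>e. ((snd a \<circ> proj V) e, \<Phi> e))"
  define H where "H = (\<lambda>z. triv_inv V U \<Phi> (chart_inv a (fst z)) (snd z))"
  have ap: "smooth_at E model_mfd (snd a \<circ> proj V) e"
    by (rule smooth_at_chart_comp[OF aE M proj_smooth[OF e(1)] a])
  have Fs: "smooth_at E model_mfd F e"
    unfolding F_def by (rule smooth_at_Pair[OF ap triv_smooth[OF U(1) e]])
  have fd: "findim TYPE('b \<times> 'f)" by (rule smooth_atlasD(1)[OF E])
  have idm: "smooth_at model_mfd model_mfd (\<lambda>z :: 'b \<times> 'f. z) (F e)"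
    by (rule smooth_at_id[OF smooth_atlas_model[OF fd]]) simp
  have Fe: "fst (F e) = snd a (proj V e)" by (simp add: F_def)
  have Hs: "smooth_at model_mfd E H (F e)"
    unfolding H_def
  proof (rule triv_inv_smooth[OF U(1) atlas_model])
    show "smooth_at model_mfd model_mfd (snd :: 'b \<times> 'f \<Rightarrow> 'f) (F e)"
      by (rule smooth_at_linear[OF bounded_linear_snd idm])
    have "smooth_at model_mfd M (chart_inv a) (fst (F e))"
      unfolding Fe by (rule smooth_at_chart_inv[OF M a])
    then show "smooth_at model_mfd M (\<lambda>z :: 'b \<times> 'f. chart_inv a (fst z)) (F e)"
      by (rule smooth_at_compose[OF atlas_model atlas_model smooth_atlasD(1)[OF M]
            smooth_at_linear[OF bounded_linear_fst idm]])
    show "chart_inv a (fst (F e)) \<in> U" unfolding Fe atlas_chart_inv[OF aM a] by (rule e(2))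
  qed
  let ?N = "pts E \<inter> proj V -` (U \<inter> fst a)"
  have N: "openin (mfd_topology E) ?N"
    by (rule smooth_map_open_vimage[OF aE aM proj_smooth_map
          openin_Int[OF triv_open[OF U(1)] openin_chart_domain[OF M a(1)]]])
  have HF: "H (F q) = q" if "q \<in> ?N" for q
    using that triv_inv_triv[OF U(1) fibre_proj, of q]
    by (simp add: H_def F_def atlas_chart_inv[OF aM a(1)])
  have eN: "e \<in> ?N" using e a by simp
  have cH: "smooth_at model_mfd model_mfd (snd c \<circ> H) (F e)"
    by (rule smooth_at_chart_comp[OF atlas_model E Hs c(1)]) (simp add: HF[OF eN] c)
  \<comment> \<open>Near \<open>e\<close> the chart \<open>c\<close> equals
    \<open>(snd c \<circ> H) \<circ> F\<close>, so the coordinate of \<open>\<xi>\<close> in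
    \<open>c\<close> depends on \<open>\<xi>\<close> only through its image under the derivative of
    \<open>F\<close>.\<close>
  have key: "snd \<xi> c = dfun model_mfd (snd c \<circ> H) (tangent_map E model_mfd F \<xi>)"
    if \<xi>: "\<xi> \<in> tangent_vectors E" "fst \<xi> = e" for \<xi>
  proof -
    have "snd \<xi> c = frechet_derivative (snd c \<circ> chart_inv c) (at (snd c (fst \<xi>))) (snd \<xi> c)"
      using tangent_coord[OF \<xi>(1), of c c] c \<xi>(2) by simp
    also have "\<dots> = dfun E (snd c) \<xi>"
      using dfun_coord[OF E \<xi>(1) smooth_at_chart[OF E c(1)] c(1)] c \<xi>(2) by simp
    also have "\<dots> = dfun E (snd c \<circ> H \<circ> F) \<xi>"
      by (rule dfun_cong[OF aE N]) (use eN \<xi>(2) HF in auto)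
    also have "\<dots> = dfun model_mfd (snd c \<circ> H) (tangent_map E model_mfd F \<xi>)"
      using dfun_tangent_map[OF E smooth_atlas_model[OF fd] \<xi>(1), of F "snd c \<circ> H"] Fs cH \<xi>(2) by simp
    finally show ?thesis .
  qed
  have dF: "dfun E F \<xi> = (snd (D \<xi>) a, dfun E \<Phi> \<xi>)" if "\<xi> \<in> tangent_vectors E" "fst \<xi> = e" for \<xi>
    using dfun_Pair[OF E that(1), of "snd a \<circ> proj V" \<Phi>] ap triv_smooth[OF U(1) e] that(2) a
    by (simp add: F_def snd_tangent_map)
  have \<mu>e: "fst \<mu> = e" and \<nu>e: "fst \<nu> = e" using eq by (simp_all add: e_def)
  have "dfun E F \<nu> = dfun E F \<mu>"
    unfolding dF[OF \<nu> \<nu>e] dF[OF \<mu> \<mu>e] D \<Phi> by simp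
  then have "tangent_map E model_mfd F \<nu> = tangent_map E model_mfd F \<mu>"
    using \<nu>e \<mu>e by (auto simp: tangent_map_def comp_def intro!: ext)
  then have "snd \<nu> c = snd \<mu> c" unfolding key[OF \<nu> \<nu>e] key[OF \<mu> \<mu>e] by simp
  then show ?thesis using tangent_eqI[OF \<nu> \<mu> eq c(1)] c(2) \<nu>e by simp
qed

context
  fixes e \<eta>
  assumes e: "e \<in> pts E" and \<eta>: "\<eta> \<in> fibre V (proj V e)"
begin

text \<open>In a trivialization the curve is an affine line in the model fibre, from which its
  smoothness and its velocity are read off.\<close>

lemma vertical_curve:
  assumes U: "local_trivialization V U \<Phi>" "proj V e \<in> U"
  shows "vadd V e (vsmul V t \<eta>) = triv_inv V U \<Phi> (proj V e) (\<Phi> e + t *\<^sub>R \<Phi> \<eta>)"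
  by (simp add: triv_inv_linear[OF U] triv_inv_triv[OF U(1) fibre_proj[OF e] U(2)] triv_inv_triv[OF U(1) \<eta> U(2)])

lemma vertical_lift_map:
  "smooth_at model_mfd E (\<lambda>t. vadd V e (vsmul V t \<eta>)) 0"
  "vertical_lift V e \<eta> = tangent_map model_mfd E (\<lambda>t. vadd V e (vsmul V t \<eta>)) unit_tangent"
proof -
  obtain U and \<Phi> :: "'e \<Rightarrow> 'f" where U: "proj V e \<in> U" "local_trivialization V U \<Phi>"
    using trivialization[OF proj_pts[OF e]] .
  have R: "smooth_atlas (model_mfd :: (real, real) mfd)" by (rule smooth_atlas_model[OF findim_real])
  have l: "bounded_linear (\<lambda>t. t *\<^sub>R \<Phi> \<eta>)" by (rule bounded_linear_scaleR_left)
  show 1: "smooth_at model_mfd E (\<lambda>t. vadd V e (vsmul V t \<eta>)) 0"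
    unfolding vertical_curve[OF U(2,1)]
    by (intro triv_inv_smooth[OF U(2) atlas_model] smooth_at_const_point[OF R] proj_pts[OF e] U(1)
        smooth_at_add smooth_at_const[OF R] smooth_at_linear[OF l] smooth_at_id[OF R]) simp
  show "vertical_lift V e \<eta> = tangent_map model_mfd E (\<lambda>t. vadd V e (vsmul V t \<eta>)) unit_tangent"
    unfolding vertical_lift_def by (rule velocity_eq_tangent_map[OF E 1])
qed

lemma vadd_vsmul_fibre: "vadd V e (vsmul V t \<eta>) \<in> fibre V (proj V e)"
  by (rule fibre_ops(2)[OF fibre_proj[OF e] fibre_ops(3)[OF \<eta>]])

lemma vadd_vsmul_0: "vadd V e (vsmul V 0 \<eta>) = e"
proof -
  obtain U and \<Phi> :: "'e \<Rightarrow> 'f" where U: "proj V e \<in> U" "local_trivialization V U \<Phi>"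
    using trivialization[OF proj_pts[OF e]] .
  show ?thesis
    unfolding vertical_curve[OF U(2,1)] by (simp add: triv_inv_triv[OF U(2) fibre_proj[OF e] U(1)])
qed

lemma vertical_lift_tangent:
  "vertical_lift V e \<eta> \<in> tangent_vectors E" "fst (vertical_lift V e \<eta>) = e"
proof -
  have R: "smooth_atlas (model_mfd :: (real, real) mfd)" by (rule smooth_atlas_model[OF findim_real])
  show "vertical_lift V e \<eta> \<in> tangent_vectors E"
    unfolding vertical_lift_map(2)
    by (rule tangent_map_tangent[OF R E unit_tangent(1)]) (simp add: unit_tangent(2) vertical_lift_map(1))
  show "fst (vertical_lift V e \<eta>) = e"
    unfolding vertical_lift_map(2) by (simp add: unit_tangent(2) vadd_vsmul_0)
qed

text \<open>The curve stays in one fibre, so its projection is constant.\<close>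

lemma D_vertical_lift: "D (vertical_lift V e \<eta>) = vzero (tangent_bundle M) (proj V e)"
proof -
  have R: "smooth_atlas (model_mfd :: (real, real) mfd)" by (rule smooth_atlas_model[OF findim_real])
  have p: "proj V (vadd V e (vsmul V t \<eta>)) = proj V e" for t
    using vadd_vsmul_fibre by (simp add: fibre_def)
  have "D (vertical_lift V e \<eta>) = tangent_map model_mfd M (\<lambda>t. proj V e) unit_tangent"
    unfolding vertical_lift_map(2)
    using tangent_map_compose[OF R E M unit_tangent(1), of "\<lambda>t. vadd V e (vsmul V t \<eta>)" "proj V"]
      vertical_lift_map(1) proj_smooth[OF e] by (simp add: unit_tangent(2) vadd_vsmul_0 p)
  also have "\<dots> = vzero (tangent_bundle M) (proj V e)"
  proof -
    have "dfun model_mfd (snd d \<circ> (\<lambda>t. proj V e)) unit_tangent = 0" for d :: "('m, 'b) chart"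
      by (subst dfun_unit_tangent) (simp_all add: comp_def)
    then show ?thesis by (simp add: tangent_map_def comp_def cong: if_cong)
  qed
  finally show ?thesis .
qed

text \<open>\<open>\<Phi>\<close> maps the curve to a line with direction
  \<open>\<Phi> \<eta>\<close>. Together with \<open>D_vertical_lift\<close> this gives both data by
  which \<open>tangent_eq_triv\<close> identifies a vector.\<close>

lemma dfun_vertical_lift:
  assumes U: "local_trivialization V U \<Phi>" "proj V e \<in> U"
  shows "dfun E \<Phi> (vertical_lift V e \<eta>) = \<Phi> \<eta>"
proof -
  have R: "smooth_atlas (model_mfd :: (real, real) mfd)" by (rule smooth_atlas_model[OF findim_real])
  have p: "\<Phi> \<circ> (\<lambda>t. vadd V e (vsmul V t \<eta>)) = (\<lambda>t. \<Phi> e + t *\<^sub>R \<Phi> \<eta>)"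
    by (simp add: vertical_curve[OF U] triv_triv_inv(2)[OF U] comp_def)
  have v: "((\<lambda>t. \<Phi> e + t *\<^sub>R \<Phi> \<eta>) has_vector_derivative \<Phi> \<eta>) (at 0)"
    by (auto intro!: derivative_eq_intros)
  have "dfun E \<Phi> (vertical_lift V e \<eta>) = dfun model_mfd (\<lambda>t. \<Phi> e + t *\<^sub>R \<Phi> \<eta>) unit_tangent"
    unfolding vertical_lift_map(2)
    using dfun_tangent_map[OF R E unit_tangent(1), of "\<lambda>t. vadd V e (vsmul V t \<eta>)" \<Phi>]
      vertical_lift_map(1) triv_smooth[OF U(1) e U(2)] by (simp add: unit_tangent(2) vadd_vsmul_0 p)
  also have "\<dots> = \<Phi> \<eta>"
    using v by (subst dfun_unit_tangent) (auto intro: vector_derivative_at differentiableI_vector)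
  finally show ?thesis .
qed

end

end

section \<open>Cheeger--Gromoll metrics\<close>

locale metric_vector_bundle = smooth_vector_bundle V
  for V :: "('e, 'b::real_inner \<times> 'f::real_inner, 'm, 'b) vbundle" +
  fixes gM :: "('m, 'b) tvec \<Rightarrow> ('m, 'b) tvec \<Rightarrow> real"
    and gE :: "'e \<Rightarrow> 'e \<Rightarrow> real"
    and K :: "('e, 'b \<times> 'f) tvec \<Rightarrow> 'e"
  assumes gM: "bundle_metric (tangent_bundle (base_space V)) gM"
    and gE: "bundle_metric V gE"
    and K: "metric_connection V gE K"
begin

section \<open>Positivity and the Cauchy-Schwarz inequality in the fibres\<close>

lemma gE_sym: "e \<in> fibre V x \<Longrightarrow> e' \<in> fibre V x \<Longrightarrow> gE e e' = gE e' e"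
  by (rule bundle_metricD(1)[OF gE fibre_ops(1)])

lemma gE_add:
  "e \<in> fibre V x \<Longrightarrow> e' \<in> fibre V x \<Longrightarrow> e'' \<in> fibre V x \<Longrightarrow> gE (vadd V e e') e'' = gE e e'' + gE e' e''"
  by (rule bundle_metricD(2)[OF gE fibre_ops(1)])

lemma gE_scale: "e \<in> fibre V x \<Longrightarrow> e' \<in> fibre V x \<Longrightarrow> gE (vsmul V r e) e' = r * gE e e'"
  by (rule bundle_metricD(3)[OF gE fibre_ops(1)])

lemma gE_zero: "e \<in> fibre V x \<Longrightarrow> gE (vzero V x) e = 0"
  using gE_scale[of e x e 0] by (simp add: vsmul_0)

lemma gE_pos: "e \<in> fibre V x \<Longrightarrow> e \<noteq> vzero V x \<Longrightarrow> gE e e > 0"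
  by (rule bundle_metricD(4)[OF gE fibre_ops(1)])

lemma gE_nonneg: "e \<in> fibre V x \<Longrightarrow> gE e e \<ge> 0"
  using gE_pos[of e x] gE_zero[of e x] by (cases "e = vzero V x") auto

lemma gE_Cauchy_Schwarz:
  assumes e: "e \<in> fibre V x" and e': "e' \<in> fibre V x"
  shows "(gE e e')\<^sup>2 \<le> gE e e * gE e' e'"
proof (cases "e' = vzero V x")
  case True
  then show ?thesis using gE_zero[OF e] gE_zero[OF e'] gE_sym[OF e e'] by simp
next
  case False
  define c where "c = gE e' e'"
  have c: "c > 0" using gE_pos[OF e' False] by (simp add: c_def)
  \<comment> \<open>The minimiser of the square norm along the line through \<open>e\<close> in
    direction \<open>e'\<close>; nonnegativity at the minimum is the claim.\<close>
  define r where "r = - gE e e' / c"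
  let ?f = "vadd V e (vsmul V r e')"
  have s: "vsmul V r e' \<in> fibre V x" and f: "?f \<in> fibre V x"
    using fibre_ops(2)[OF e] fibre_ops(3)[OF e'] by auto
  have "gE ?f ?f = gE e ?f + r * gE e' ?f"
    by (simp add: gE_add[OF e s f] gE_scale[OF e' f])
  also have "gE e ?f = gE e e + r * gE e e'"
    unfolding gE_sym[OF e f] gE_add[OF e s e] gE_scale[OF e' e] gE_sym[OF e' e] ..
  also have "gE e' ?f = gE e e' + r * c"
    unfolding gE_sym[OF e' f] gE_add[OF e s e'] gE_scale[OF e' e'] c_def ..
  finally have "gE ?f ?f = gE e e - (gE e e')\<^sup>2 / c"
    using c by (simp add: r_def field_simps power2_eq_square)
  then have "(gE e e')\<^sup>2 / c \<le> gE e e" using gE_nonneg[OF f] by simp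
  then show ?thesis using c by (simp add: c_def field_simps)
qed

section \<open>The connection and the projection to the zero section\<close>

lemma K_morphism: "bundle_morphism (tangent_bundle E) V K (proj V)" "bundle_morphism (prolonged_bundle V) V K fst"
  using K unfolding metric_connection_def connection_def by auto

lemma K_fibre:
  assumes "\<nu> \<in> tangent_vectors E"
  shows "K \<nu> \<in> fibre V (proj V (fst \<nu>))"
proof -
  have "K \<nu> \<in> pts E" "proj V (K \<nu>) = proj V (fst \<nu>)"
    using K_morphism(1) assms unfolding bundle_morphism_def smooth_map_def by auto
  then show ?thesis by (simp add: fibre_def)
qed

lemma K_smooth: "\<nu> \<in> tangent_vectors E \<Longrightarrow> smooth_at (tangent_mfd E) E K \<nu>"
  using K_morphism(1) smooth_mapD[of "tangent_mfd E" E K \<nu>] atlas_tangent[OF aE]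
  unfolding bundle_morphism_def by simp

lemma K_add:
  assumes "\<nu> \<in> tangent_vectors E" "\<mu> \<in> tangent_vectors E" "fst \<mu> = fst \<nu>"
  shows "K (vadd (tangent_bundle E) \<nu> \<mu>) = vadd V (K \<nu>) (K \<mu>)"
proof -
  have "fst \<nu> \<in> pts (base_space (tangent_bundle E))" using tangent_pts[OF assms(1)] by simp
  moreover have "\<nu> \<in> fibre (tangent_bundle E) (fst \<nu>)" "\<mu> \<in> fibre (tangent_bundle E) (fst \<nu>)"
    using assms by (simp_all add: fibre_tangent_bundle)
  ultimately show ?thesis using K_morphism(1) unfolding bundle_morphism_def by blast
qed

lemma K_scale:
  assumes "\<nu> \<in> tangent_vectors E"
  shows "K (vsmul (tangent_bundle E) r \<nu>) = vsmul V r (K \<nu>)"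
proof -
  have "fst \<nu> \<in> pts (base_space (tangent_bundle E))" using tangent_pts[OF assms(1)] by simp
  moreover have "\<nu> \<in> fibre (tangent_bundle E) (fst \<nu>)"
    using assms by (simp add: fibre_tangent_bundle)
  ultimately show ?thesis using K_morphism(1) unfolding bundle_morphism_def by blast
qed

lemma K_vertical_lift:
  "e \<in> pts E \<Longrightarrow> \<eta> \<in> fibre V (proj V e) \<Longrightarrow> K (vertical_lift V e \<eta>) = \<eta>"
  using K unfolding metric_connection_def connection_def by blast

lemma dfun_gE: "\<nu> \<in> tangent_vectors E \<Longrightarrow> dfun E (\<lambda>e. gE e e) \<nu> = 2 * gE (K \<nu>) (fst \<nu>)"
  using K unfolding metric_connection_def by blast

definition hor :: "('e, 'b \<times> 'f) tvec \<Rightarrow> ('e, 'b \<times> 'f) tvec" where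
  "hor \<nu> = tangent_map M E (vzero V) (D \<nu>)"

text \<open>By the chain rule \<open>hor\<close> is the derivative of a self-map of
  \<open>E\<close>, the one that sends a point to the zero vector of its fibre.\<close>

lemma hor_eq:
  assumes \<nu>: "\<nu> \<in> tangent_vectors E"
  shows "hor \<nu> = tangent_map E E (\<lambda>e. vzero V (proj V e)) \<nu>"
  unfolding hor_def
  by (rule tangent_map_compose[OF E M E \<nu> proj_smooth[OF tangent_pts[OF \<nu>]]
        vzero_smooth[OF proj_pts[OF tangent_pts[OF \<nu>]]]])

lemma vzero_proj_smooth:
  assumes "e \<in> pts E"
  shows "smooth_at E E (\<lambda>e. vzero V (proj V e)) e"
  by (rule smooth_at_compose[OF aE aM smooth_atlasD(1)[OF M] proj_smooth[OF assms]
        vzero_smooth[OF proj_pts[OF assms]]])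

text \<open>Passing to the zero vector of the same fibre does not change the projection.\<close>

lemma D_hor:
  assumes \<nu>: "\<nu> \<in> tangent_vectors E"
  shows "D (hor \<nu>) = D \<nu>"
proof -
  note e = tangent_pts[OF \<nu>]
  have z: "vzero V (proj V q) \<in> pts E" "proj V (vzero V (proj V q)) = proj V q" if "q \<in> pts E" for q
    using vzero_fibre[OF proj_pts[OF that]] by (auto simp: fibre_def)
  have "D (hor \<nu>) = tangent_map E M (\<lambda>e. proj V (vzero V (proj V e))) \<nu>"
    unfolding hor_eq[OF \<nu>]
    by (rule tangent_map_compose[OF E E M \<nu> vzero_proj_smooth[OF e] proj_smooth[OF z(1)[OF e]]])
  also have "\<dots> = D \<nu>"
    by (rule tangent_map_cong[OF aE openin_pts[OF E] e z(2)])
  finally show ?thesis .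
qed

text \<open>
  The horizontal part of \<open>\<nu>\<close> is \<open>0 \<cdot> \<nu>\<close> for the vector bundle structure of the tangent manifold
  of the total space over that of the base, in whose fibres \<open>K\<close> is also linear.
\<close>

lemma K_hor:
  assumes \<nu>: "\<nu> \<in> tangent_vectors E"
  shows "K (hor \<nu>) = vzero V (proj V (fst \<nu>))"
proof -
  \<comment> \<open>Sending a point to the zero vector of its fibre is multiplication by 0, and the
    derivative of that is the scalar multiplication of \<open>prolonged_bundle\<close>.\<close>
  have "hor \<nu> = tangent_map E E (vsmul V 0) \<nu>"
    unfolding hor_eq[OF \<nu>]
    by (rule tangent_map_cong[OF aE openin_pts[OF E] tangent_pts[OF \<nu>]])
      (simp add: vsmul_0[OF fibre_proj])
  then have "hor \<nu> = vsmul (prolonged_bundle V) 0 \<nu>" by (simp add: prolonged_bundle_def)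
  moreover have "D \<nu> \<in> pts (base_space (prolonged_bundle V))" "\<nu> \<in> fibre (prolonged_bundle V) (D \<nu>)"
    using \<nu> D_tangent by (simp_all add: prolonged_bundle_def fibre_def)
  ultimately have "K (hor \<nu>) = vsmul V 0 (K \<nu>)"
    using K_morphism(2) unfolding bundle_morphism_def by metis
  then show ?thesis by (simp add: vsmul_0[OF K_fibre[OF \<nu>]])
qed

section \<open>Inequalities and definiteness for the Cheeger-Gromoll metric\<close>

abbreviation "G \<equiv> cheeger_gromoll V gM gE K"

lemma G_eq:
  "G \<nu> \<mu> = gM (D \<nu>) (D \<mu>) +
     (gE (K \<nu>) (K \<mu>) + gE (K \<nu>) (fst \<nu>) * gE (K \<mu>) (fst \<mu>)) / (1 + gE (fst \<nu>) (fst \<nu>))"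
  by (simp add: cheeger_gromoll_def Let_def)

lemma D_fibre:
  "\<nu> \<in> tangent_vectors E \<Longrightarrow> D \<nu> \<in> fibre (tangent_bundle M) (proj V (fst \<nu>))"
  using D_tangent by (simp add: fibre_tangent_bundle)

lemma gM_zero:
  assumes \<xi>: "\<xi> \<in> tangent_vectors M"
  shows "gM (vzero (tangent_bundle M) (fst \<xi>)) \<xi> = 0"
  using bundle_metricD(3)[OF gM, of "fst \<xi>" \<xi> \<xi> 0] tangent_pts[OF \<xi>] \<xi> by (simp add: fibre_tangent_bundle)

lemma gM_pos:
  assumes \<xi>: "\<xi> \<in> tangent_vectors M" and "\<xi> \<noteq> vzero (tangent_bundle M) (fst \<xi>)"
  shows "gM \<xi> \<xi> > 0"
  by (rule bundle_metricD(4)[OF gM, of "fst \<xi>" \<xi> \<xi>])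
    (use \<xi> assms(2) tangent_pts[OF \<xi>] in \<open>simp_all add: fibre_tangent_bundle\<close>)

lemma gM_nonneg: "\<xi> \<in> tangent_vectors M \<Longrightarrow> gM \<xi> \<xi> \<ge> 0"
  using gM_pos[of \<xi>] gM_zero[of \<xi>] by (cases "\<xi> = vzero (tangent_bundle M) (fst \<xi>)") auto

lemma G_hor_le:
  assumes \<nu>: "\<nu> \<in> tangent_vectors E"
  shows "G (hor \<nu>) (hor \<nu>) \<le> G \<nu> \<nu>"
proof -
  note e = tangent_pts[OF \<nu>]
  have x: "proj V (fst \<nu>) \<in> pts M" by (rule proj_pts[OF e])
  have f: "fst (hor \<nu>) = vzero V (proj V (fst \<nu>))" by (simp add: hor_eq[OF \<nu>])
  have "G (hor \<nu>) (hor \<nu>) = gM (D \<nu>) (D \<nu>)"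
    unfolding G_eq D_hor[OF \<nu>] K_hor[OF \<nu>] f gE_zero[OF vzero_fibre[OF x]] by simp
  moreover have "0 \<le> (gE (K \<nu>) (K \<nu>) + gE (K \<nu>) (fst \<nu>) * gE (K \<nu>) (fst \<nu>)) / (1 + gE (fst \<nu>) (fst \<nu>))"
    using gE_nonneg[OF K_fibre[OF \<nu>]] gE_nonneg[OF fibre_proj[OF e]] by simp
  ultimately show ?thesis by (simp add: G_eq)
qed

lemma G_bounds_dfun:
  assumes \<nu>: "\<nu> \<in> tangent_vectors E"
  shows "(dfun E (\<lambda>e. gE e e) \<nu>)\<^sup>2 \<le> 4 * gE (fst \<nu>) (fst \<nu>) * G \<nu> \<nu>"
proof -
  define a k i where "a = gE (fst \<nu>) (fst \<nu>)" and "k = gE (K \<nu>) (K \<nu>)" and "i = gE (K \<nu>) (fst \<nu>)"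
  have a: "a \<ge> 0" unfolding a_def by (rule gE_nonneg[OF fibre_proj[OF tangent_pts[OF \<nu>]]])
  have "i\<^sup>2 \<le> k * a"
    unfolding a_def k_def i_def
    by (rule gE_Cauchy_Schwarz[OF K_fibre[OF \<nu>] fibre_proj[OF tangent_pts[OF \<nu>]]])
  then have "i\<^sup>2 * (1 + a) \<le> a * (k + i * i)" by (simp add: algebra_simps power2_eq_square)
  then have "i\<^sup>2 \<le> a * ((k + i * i) / (1 + a))" using a by (simp add: field_simps)
  also have "\<dots> \<le> a * G \<nu> \<nu>"
    using gM_nonneg[OF D_tangent[OF \<nu>]] a by (intro mult_left_mono) (simp_all add: G_eq a_def k_def i_def)
  finally have "i\<^sup>2 \<le> a * G \<nu> \<nu>" .
  then show ?thesis unfolding dfun_gE[OF \<nu>] by (simp add: a_def i_def power_mult_distrib)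
qed

lemma G_vertical_lift:
  assumes e: "e \<in> pts E"
  shows "G (vertical_lift V e e) (vertical_lift V e e) = gE e e"
proof -
  note f = fibre_proj[OF e]
  have x: "proj V e \<in> pts M" by (rule proj_pts[OF e])
  let ?\<nu> = "vertical_lift V e e"
  have "gM (D ?\<nu>) (D ?\<nu>) = 0"
    using gM_zero[OF D_tangent[OF vertical_lift_tangent(1)[OF e f]]] D_vertical_lift[OF e f] by simp
  moreover have "1 + gE e e > 0" using gE_nonneg[OF f] by simp
  ultimately show ?thesis
    unfolding G_eq K_vertical_lift[OF e f] vertical_lift_tangent(2)[OF e f] by (simp add: field_simps)
qed

lemma G_pos:
  assumes \<nu>: "\<nu> \<in> tangent_vectors E" and nz: "\<nu> \<noteq> vzero (tangent_bundle E) (fst \<nu>)"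
  shows "G \<nu> \<nu> > 0"
proof (rule ccontr)
  define e where "e = fst \<nu>"
  have e: "e \<in> pts E" unfolding e_def by (rule tangent_pts[OF \<nu>])
  assume neg: "\<not> G \<nu> \<nu> > 0"
  have 1: "0 \<le> gM (D \<nu>) (D \<nu>)" by (rule gM_nonneg[OF D_tangent[OF \<nu>]])
  have 2: "0 \<le> gE (K \<nu>) (K \<nu>)" by (rule gE_nonneg[OF K_fibre[OF \<nu>]])
  have 3: "0 \<le> gE e e" by (rule gE_nonneg[OF fibre_proj[OF e]])
  have "gE (K \<nu>) (K \<nu>) / (1 + gE e e) \<le> (gE (K \<nu>) (K \<nu>) + gE (K \<nu>) e * gE (K \<nu>) e) / (1 + gE e e)"
    using 3 by (intro divide_right_mono) auto
  moreover have "0 \<le> gE (K \<nu>) (K \<nu>) / (1 + gE e e)" using 2 3 by simp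
  ultimately have gM0: "gM (D \<nu>) (D \<nu>) = 0" and "gE (K \<nu>) (K \<nu>) / (1 + gE e e) = 0"
    using neg 1 unfolding G_eq e_def[symmetric] by linarith+
  then have "gE (K \<nu>) (K \<nu>) = 0" using 3 by auto
  then have K0: "K \<nu> = vzero V (proj V e)"
    using gE_pos[OF K_fibre[OF \<nu>]] e_def by force
  have D0: "D \<nu> = vzero (tangent_bundle M) (proj V e)"
    using gM_pos[OF D_tangent[OF \<nu>]] gM0 e_def by force
  obtain U and \<Phi> :: "'e \<Rightarrow> 'f" where U: "proj V e \<in> U" "local_trivialization V U \<Phi>"
    using trivialization[OF proj_pts[OF e]] .
  \<comment> \<open>The only candidate: the vertical lift of a fibre vector has its
    \<open>\<Phi>\<close>-coordinate as derivative of \<open>\<Phi>\<close>, so this coordinate must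
    be that of \<open>\<nu>\<close>.\<close>
  let ?\<eta> = "triv_inv V U \<Phi> (proj V e) (dfun E \<Phi> \<nu>)"
  note \<eta> = triv_triv_inv[OF U(2,1), of "dfun E \<Phi> \<nu>"]
  have "\<nu> = vertical_lift V e ?\<eta>"
    by (rule tangent_eq_triv[OF \<nu> vertical_lift_tangent(1)[OF e \<eta>(1)] _ U(2)])
      (simp_all add: vertical_lift_tangent(2)[OF e \<eta>(1)] e_def[symmetric] U(1) D0
        D_vertical_lift[OF e \<eta>(1)] dfun_vertical_lift[OF e \<eta>(1) U(2,1)] \<eta>(2) del: tangent_bundle_simps)
  \<comment> \<open>\<open>K\<close> recovers \<open>?\<eta>\<close> from its vertical lift, which
    is \<open>\<nu>\<close>, and \<open>K \<nu>\<close> is zero.\<close>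
  then have "?\<eta> = vzero V (proj V e)" using K_vertical_lift[OF e \<eta>(1)] K0 by simp
  then have \<Phi>0: "dfun E \<Phi> \<nu> = 0" using \<eta>(2) triv_linear(1)[OF U(2) \<eta>(1) U(1)] by simp
  have z: "vsmul (tangent_bundle E) 0 \<nu> = vzero (tangent_bundle E) (fst \<nu>)" by simp
  \<comment> \<open>Now the derivatives of both the projection and \<open>\<Phi>\<close> vanish on
    \<open>\<nu>\<close>, exactly as on the zero vector, here written as
    \<open>0 \<cdot> \<nu>\<close> to use homogeneity.\<close>
  have "\<nu> = vsmul (tangent_bundle E) 0 \<nu>"
  proof (rule tangent_eq_triv[OF \<nu> _ _ U(2)])
    show "vsmul (tangent_bundle E) 0 \<nu> \<in> tangent_vectors E"
      using tangent_scale[OF E \<nu>, of 0] by simp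
    show "D \<nu> = D (vsmul (tangent_bundle E) 0 \<nu>)"
      unfolding D_scale[OF \<nu>] D0 by (simp add: e_def)
    show "dfun E \<Phi> \<nu> = dfun E \<Phi> (vsmul (tangent_bundle E) 0 \<nu>)"
      using dfun_scale[OF aE tangent_pts[OF \<nu>] triv_smooth[OF U(2) tangent_pts[OF \<nu>]], of 0] U(1)
      by (simp add: \<Phi>0 e_def)
  qed (use U(1) in \<open>simp_all add: e_def\<close>)
  then show False using nz unfolding z by simp
qed

section \<open>Smoothness of the Cheeger-Gromoll metric\<close>

lemma gE_smooth:
  assumes e: "e \<in> pts E" and N: "openin (mfd_topology E) N" "e \<in> N"
    and h: "smooth_at E E h e" "\<And>q. q \<in> N \<Longrightarrow> h q \<in> fibre V (proj V q)"
    and k: "smooth_at E E k e" "\<And>q. q \<in> N \<Longrightarrow> k q \<in> fibre V (proj V q)"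
  shows "smooth_at E model_mfd (\<lambda>q. gE (h q) (k q)) e"
proof -
  obtain U and \<Phi> :: "'e \<Rightarrow> 'f" where U: "proj V e \<in> U" "local_trivialization V U \<Phi>"
    using trivialization[OF proj_pts[OF e]] .
  let ?N = "N \<inter> (pts E \<inter> proj V -` U)"
  have oN: "openin (mfd_topology E) ?N"
    by (rule openin_Int[OF N(1) smooth_map_open_vimage[OF aE aM proj_smooth_map triv_open[OF U(2)]]])
  have eN: "e \<in> ?N" using N(2) e U(1) by simp
  have \<Phi>: "smooth_at E model_mfd (\<lambda>q. \<Phi> (h q)) e" if "smooth_at E E h e" "h e \<in> fibre V (proj V e)" for h
    by (rule smooth_at_compose[OF aE aE smooth_atlasD(1)[OF E] that(1) triv_smooth[OF U(2)]])
      (use that(2) U(1) in \<open>auto simp: fibre_def\<close>)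
  \<comment> \<open>\<open>h\<close> and \<open>k\<close> are sections along the projection. Writing
    their values through fibre coordinates splits them into a frame over the base and coefficients
    that are smooth on \<open>E\<close>.\<close>
  have "smooth_at E model_mfd (\<lambda>q. gE (triv_inv V U \<Phi> (proj V q) (\<Phi> (h q))) (triv_inv V U \<Phi> (proj V q) (\<Phi> (k q)))) e"
  proof (rule smooth_at_metric_frame[OF E M gE triv_open[OF U(2)] findim_snd[OF smooth_atlasD(1)[OF E]] _ _ _ _
        proj_smooth[OF e] oN eN])
    show "smooth_at M E (\<lambda>x. triv_inv V U \<Phi> x v) x" if "x \<in> U" for x v
      by (rule triv_inv_smooth[OF U(2) aM smooth_at_id[OF M] that smooth_at_const[OF M]])
        (use triv_subset[OF U(2)] that in blast)
  qed (use h k N(2) in \<open>auto intro: \<Phi> simp: triv_triv_inv[OF U(2)] triv_inv_linear[OF U(2)]\<close>)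
  then show ?thesis
    by (rule smooth_at_cong[OF aE oN eN, rotated])
      (simp add: triv_inv_triv[OF U(2) h(2)] triv_inv_triv[OF U(2) k(2)])
qed

text \<open>The counterpart of \<open>gE_smooth\<close> for the tangent bundle of the base, with the
  coordinate frame of a chart \<open>a\<close> in place of a trivialization. The coefficient of
  \<open>D (s q)\<close> is the derivative of \<open>snd a \<circ> proj V\<close> along
  \<open>s q\<close>, hence smooth in \<open>q\<close>.\<close>

lemma gM_smooth:
  assumes e: "e \<in> pts E" and N: "openin (mfd_topology E) N" "e \<in> N"
    and s: "smooth_at E (tangent_mfd E) s e" "\<And>q. q \<in> N \<Longrightarrow> s q \<in> tangent_vectors E \<and> fst (s q) = q"
    and t: "smooth_at E (tangent_mfd E) t e" "\<And>q. q \<in> N \<Longrightarrow> t q \<in> tangent_vectors E \<and> fst (t q) = q"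
  shows "smooth_at E model_mfd (\<lambda>q. gM (D (s q)) (D (t q))) e"
proof -
  obtain a where a: "a \<in> charts M" "proj V e \<in> fst a" using atlas_chart[OF aM proj_pts[OF e]] by blast
  note oa = openin_chart_domain[OF M a(1)]
  let ?N = "N \<inter> (pts E \<inter> proj V -` fst a)"
  have oN: "openin (mfd_topology E) ?N"
    by (rule openin_Int[OF N(1) smooth_map_open_vimage[OF aE aM proj_smooth_map oa]])
  have eN: "e \<in> ?N" using N(2) e a(2) by simp
  let ?d = "dfun E (snd a \<circ> proj V)"
  have fd: "findim TYPE(('b \<times> 'f) \<times> ('b \<times> 'f))"
    by (rule findim_prod[OF smooth_atlasD(1)[OF E] smooth_atlasD(1)[OF E]])
  have d: "smooth_at E model_mfd (\<lambda>q. ?d (s q)) e"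
    if s: "smooth_at E (tangent_mfd E) s e" "s e \<in> tangent_vectors E \<and> fst (s e) = e" for s
    by (rule smooth_at_compose[OF aE atlas_tangent[OF aE] fd s(1) smooth_at_dfun[OF E]])
      (use s(2) smooth_at_chart_comp[OF aE M proj_smooth[OF e] a] in auto)
  have c: "coord_vec M a (proj V q) (?d (s q)) = D (s q)"
    if "q \<in> ?N" "s q \<in> tangent_vectors E \<and> fst (s q) = q" for q s
    using coord_vec_eq[OF M D_tangent[of "s q"] a(1)] that a(1) by (simp add: snd_tangent_map)
  have "smooth_at E model_mfd (\<lambda>q. gM (coord_vec M a (proj V q) (?d (s q))) (coord_vec M a (proj V q) (?d (t q)))) e"
  proof (rule smooth_at_metric_frame[OF E _ gM, where W = "fst a"])
    show "smooth_atlas (base_space (tangent_bundle M))" using M by simp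
    show "openin (mfd_topology (base_space (tangent_bundle M))) (fst a)" using oa by simp
    show "findim TYPE('b)" by (rule smooth_atlasD(1)[OF M])
    fix x v w r assume x: "x \<in> fst a"
    have l: "linear (frechet_derivative (snd d \<circ> chart_inv a) (at (snd a x)))" if "d \<in> charts_at M x" for d
      using tangent_chart_linear[OF M a(1) x] that by simp
    show "coord_vec M a x v \<in> fibre (tangent_bundle M) x"
      using coord_vec_tangent[OF M a(1) x] by (simp add: fibre_tangent_bundle)
    show "coord_vec M a x (v + w) = vadd (tangent_bundle M) (coord_vec M a x v) (coord_vec M a x w)"
      using linear_add[OF l] by (auto simp: coord_vec_def intro!: ext)
    show "coord_vec M a x (r *\<^sub>R v) = vsmul (tangent_bundle M) r (coord_vec M a x v)"
      using linear_scale[OF l] by (auto simp: coord_vec_def intro!: ext)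
    show "smooth_at (base_space (tangent_bundle M)) (tot_space (tangent_bundle M)) (\<lambda>x. coord_vec M a x v) x"
      using smooth_at_coord_vec[OF M a(1) x] by simp
  next
    show "smooth_at E (base_space (tangent_bundle M)) (proj V) e" using proj_smooth[OF e] by simp
    show "openin (mfd_topology E) ?N" "e \<in> ?N" by (rule oN eN)+
    show "smooth_at E model_mfd (\<lambda>q. ?d (s q)) e" "smooth_at E model_mfd (\<lambda>q. ?d (t q)) e"
      by (rule d[OF s(1) s(2)[OF N(2)]] d[OF t(1) t(2)[OF N(2)]])+
  qed simp
  then show ?thesis
    by (rule smooth_at_cong[OF aE oN eN, rotated]) (use c s(2) t(2) in simp)
qed

lemma G_smooth:
  assumes e: "e \<in> pts E" and N: "openin (mfd_topology E) N" "e \<in> N"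
    and s: "smooth_at E (tangent_mfd E) s e" "\<And>q. q \<in> N \<Longrightarrow> s q \<in> tangent_vectors E \<and> fst (s q) = q"
    and t: "smooth_at E (tangent_mfd E) t e" "\<And>q. q \<in> N \<Longrightarrow> t q \<in> tangent_vectors E \<and> fst (t q) = q"
  shows "smooth_at E model_mfd (\<lambda>q. G (s q) (t q)) e"
proof -
  have fd: "findim TYPE(('b \<times> 'f) \<times> ('b \<times> 'f))"
    by (rule findim_prod[OF smooth_atlasD(1)[OF E] smooth_atlasD(1)[OF E]])
  have NE: "q \<in> pts E" if "q \<in> N" for q using N(1) that by (auto simp: atlas_openin[OF aE])
  have Ks: "smooth_at E E (\<lambda>q. K (s q)) e" "\<And>q. q \<in> N \<Longrightarrow> K (s q) \<in> fibre V (proj V q)"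
    if s: "smooth_at E (tangent_mfd E) s e" "\<And>q. q \<in> N \<Longrightarrow> s q \<in> tangent_vectors E \<and> fst (s q) = q" for s
  proof -
    show "smooth_at E E (\<lambda>q. K (s q)) e"
      by (rule smooth_at_compose[OF aE atlas_tangent[OF aE] fd s(1) K_smooth]) (use s(2)[OF N(2)] in simp)
    show "K (s q) \<in> fibre V (proj V q)" if "q \<in> N" for q
      using K_fibre[of "s q"] s(2)[OF that] by simp
  qed
  note k1 = Ks[OF s] and k2 = Ks[OF t]
  \<comment> \<open>The identity counts as a section along the projection as well, so
    \<open>gE_smooth\<close> also handles the terms that contain the base point.\<close>
  have k0: "smooth_at E E (\<lambda>q. q) e" "\<And>q. q \<in> N \<Longrightarrow> q \<in> fibre V (proj V q)"
    using smooth_at_id[OF E e] NE fibre_proj by auto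
  note S = gE_smooth[OF e N]
  have p: "1 + gE e e \<noteq> 0" using gE_nonneg[OF fibre_proj[OF e]] by linarith
  have "smooth_at E model_mfd (\<lambda>q. gM (D (s q)) (D (t q)) +
      (gE (K (s q)) (K (t q)) + gE (K (s q)) q * gE (K (t q)) q) * inverse (1 + gE q q)) e"
    by (intro smooth_at_add smooth_at_mult smooth_at_inverse[OF aE] smooth_at_const[OF E] gM_smooth[OF e N s t]
        S[OF k1 k2] S[OF k1 k0] S[OF k2 k0] S[OF k0 k0] p)
  then show ?thesis
    by (rule smooth_at_cong[OF aE N, rotated]) (simp add: G_eq s(2) t(2) divide_inverse)
qed

lemma G_riemannian: "riemannian_metric E G"
  unfolding riemannian_metric_def bundle_metric_def
proof (intro conjI ballI allI impI)
  fix e \<nu> \<mu> \<omega> r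
  assume e: "e \<in> pts (base_space (tangent_bundle E))" and "\<nu> \<in> fibre (tangent_bundle E) e"
  then have \<nu>: "\<nu> \<in> tangent_vectors E" "fst \<nu> = e" by (simp_all add: fibre_tangent_bundle)
  have e': "e \<in> pts E" and x: "proj V e \<in> pts (base_space (tangent_bundle M))"
    using e proj_pts by simp_all
  note f = fibre_proj[OF e']
  have K\<nu>: "K \<nu> \<in> fibre V (proj V e)" and D\<nu>: "D \<nu> \<in> fibre (tangent_bundle M) (proj V e)"
    using K_fibre[OF \<nu>(1)] D_fibre[OF \<nu>(1)] \<nu>(2) by auto
  show "\<nu> \<noteq> vzero (tangent_bundle E) e \<Longrightarrow> 0 < G \<nu> \<nu>"
    using G_pos[OF \<nu>(1)] \<nu>(2) by simp
  assume "\<mu> \<in> fibre (tangent_bundle E) e"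
  then have \<mu>: "\<mu> \<in> tangent_vectors E" "fst \<mu> = e" by (simp_all add: fibre_tangent_bundle)
  have K\<mu>: "K \<mu> \<in> fibre V (proj V e)" and D\<mu>: "D \<mu> \<in> fibre (tangent_bundle M) (proj V e)"
    using K_fibre[OF \<mu>(1)] D_fibre[OF \<mu>(1)] \<mu>(2) by auto
  \<comment> \<open>The denominator is formed from the base point of the first argument; symmetry
    uses that both vectors are tangent at \<open>e\<close>.\<close>
  show "G \<nu> \<mu> = G \<mu> \<nu>"
    unfolding G_eq using bundle_metricD(1)[OF gM x D\<nu> D\<mu>] gE_sym[OF K\<nu> K\<mu>] \<nu>(2) \<mu>(2) by simp
  have "fst (vsmul (tangent_bundle E) r \<nu>) = e" using \<nu>(2) by simp
  then show "G (vsmul (tangent_bundle E) r \<nu>) \<mu> = r * G \<nu> \<mu>"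
    unfolding G_eq D_scale[OF \<nu>(1)] K_scale[OF \<nu>(1)] bundle_metricD(3)[OF gM x D\<nu> D\<mu>] \<nu>(2) \<mu>(2)
    by (simp add: gE_scale[OF K\<nu> K\<mu>] gE_scale[OF K\<nu> f] algebra_simps add_divide_distrib)
  assume "\<omega> \<in> fibre (tangent_bundle E) e"
  then have \<omega>: "\<omega> \<in> tangent_vectors E" "fst \<omega> = e" by (simp_all add: fibre_tangent_bundle)
  have K\<omega>: "K \<omega> \<in> fibre V (proj V e)" and D\<omega>: "D \<omega> \<in> fibre (tangent_bundle M) (proj V e)"
    using K_fibre[OF \<omega>(1)] D_fibre[OF \<omega>(1)] \<omega>(2) by auto
  have eq: "fst \<mu> = fst \<nu>" using \<mu>(2) \<nu>(2) by simp
  have "fst (vadd (tangent_bundle E) \<nu> \<mu>) = e" using \<nu>(2) by simp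
  then show "G (vadd (tangent_bundle E) \<nu> \<mu>) \<omega> = G \<nu> \<omega> + G \<mu> \<omega>"
    unfolding G_eq D_add[OF \<nu>(1) eq] K_add[OF \<nu>(1) \<mu>(1) eq] bundle_metricD(2)[OF gM x D\<nu> D\<mu> D\<omega>] \<nu>(2) \<mu>(2) \<omega>(2)
    by (simp add: gE_add[OF K\<nu> K\<mu> K\<omega>] gE_add[OF K\<nu> K\<mu> f] algebra_simps add_divide_distrib)
next
  fix U s t
  assume a: "openin (mfd_topology (base_space (tangent_bundle E))) U \<and>
    local_section (tangent_bundle E) U s \<and> local_section (tangent_bundle E) U t"
  then have U: "openin (mfd_topology E) U" by simp
  have UE: "U \<subseteq> pts E" using U by (simp add: atlas_openin[OF aE])
  \<comment> \<open>Smoothness over the open set \<open>U\<close> amounts to smoothness in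
    \<open>E\<close> at each of its points, so \<open>U\<close> itself serves as the neighbourhood
    in \<open>G_smooth\<close>.\<close>
  have sec: "smooth_at E (tangent_mfd E) s e" "s e \<in> tangent_vectors E \<and> fst (s e) = e"
    if "local_section (tangent_bundle E) U s" "e \<in> U" for s e
  proof -
    have s: "smooth_map (open_submfd E U) (tangent_mfd E) s" "\<And>q. q \<in> U \<Longrightarrow> fst (s q) = q"
      using that(1) UE unfolding local_section_def by auto
    show "smooth_at E (tangent_mfd E) s e"
      using smooth_mapD[OF s(1) atlas_open_submfd[OF aE], of e] that(2) UE
      by (auto simp: smooth_at_open_submfd_iff[OF aE U])
    then show "s e \<in> tangent_vectors E \<and> fst (s e) = e" using s(2)[OF that(2)] unfolding smooth_at_def by simp
  qed
  have "smooth_at E model_mfd (\<lambda>e. G (s e) (t e)) e" if "e \<in> U" for e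
    by (rule G_smooth[OF _ U that]) (use a sec that UE in auto)
  then have "smooth_map (open_submfd E U) model_mfd (\<lambda>e. G (s e) (t e))"
    by (simp add: smooth_map_iff_smooth_at[OF atlas_open_submfd[OF aE]] smooth_at_open_submfd_iff[OF aE U])
  then show "smooth_map (open_submfd (base_space (tangent_bundle E)) U) model_mfd (\<lambda>e. G (s e) (t e))" by simp
qed

lemma G_strongly_concordant: "strongly_concordant V gE G"
  unfolding strongly_concordant_def Let_def
proof (intro conjI ballI exI[of _ "1::real"])
  show "riemannian_metric E G" by (rule G_riemannian)
  show "G (tangent_map M E (vzero V) (D \<nu>)) (tangent_map M E (vzero V) (D \<nu>)) \<le> G \<nu> \<nu>"
    if "\<nu> \<in> tangent_vectors E" for \<nu> using G_hor_le[OF that] unfolding hor_def .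
  show "(inverse 1 * dfun E (\<lambda>e. gE e e) \<nu>)\<^sup>2 \<le> 4 * gE (fst \<nu>) (fst \<nu>) * G \<nu> \<nu>"
    if "\<nu> \<in> tangent_vectors E" for \<nu> using G_bounds_dfun[OF that] by simp
  show "G (vertical_lift V e e) (vertical_lift V e e) \<le> 1\<^sup>2 * gE e e" if "e \<in> pts E" for e
    using G_vertical_lift[OF that] by simp
qed simp

end

theorem proposition4p16:
  fixes M :: "('m, 'b::real_inner) mfd"
    and gM :: "('m, 'b) tvec \<Rightarrow> ('m, 'b) tvec \<Rightarrow> real"
    and V :: "('e, 'b \<times> 'f::real_inner, 'm, 'b) vbundle"
    and gE :: "'e \<Rightarrow> 'e \<Rightarrow> real"
    and K :: "('e, 'b \<times> 'f) tvec \<Rightarrow> 'e"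
  assumes "riemannian_manifold M gM"
    and "vector_bundle V" and "base_space V = M"
    and "bundle_metric V gE"
    and "metric_connection V gE K"
  shows "strongly_concordant V gE (cheeger_gromoll V gM gE K)"
proof -
  interpret metric_vector_bundle V gM gE K
    using assms by unfold_locales (simp_all add: riemannian_manifold_def riemannian_metric_def)
  show ?thesis by (rule G_strongly_concordant)
qed

end
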